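(* Let $q$ be a prime power and let $G\cong{\rm PSL}_2(q)$. If $(\rho_0,\rho_1,\rho_2,\rho_3)$ is a string representation of rank $4$ of $G$, then the subgroup $G_3=\langle\rho_0,\rho_1,\rho_2\rangle$ is isomorphic to the symmetric group $\mathrm{S}_4$, to the alternating group $\mathrm{A}_5$, or to $G$.
   Context: A string representation of rank $n$ of a group $G$ is an $n$-tuple $(g_0,\ldots,g_{n-1})$ of pairwise distinct involutions of $G$ that generate $G$ and satisfy $g_ig_j=g_jg_i$ whenever $|i-j|>1$. *)

theory Defs
  imports
    "HOL-Analysis.Determinants"
    "HOL-Algebra.Sym_Groups"
    "HOL-Algebra.Multiplicative_Group"
    "HOL-Number_Theory.Prime_Powers"
begin

definition center :: "('a, 'b) monoid_scheme \<Rightarrow> 'a set" where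
  "center G = {z \<in> carrier G. \<forall>x \<in> carrier G. x \<otimes>\<^bsub>G\<^esub> z = z \<otimes>\<^bsub>G\<^esub> x}"

lemma center_normal:
  assumes "group G"
  shows "center G \<lhd> G"
proof -
  interpret group G by fact
  have sub: "subgroup (center G) G"
  proof (rule subgroupI)
    show "center G \<subseteq> carrier G" by (auto simp: center_def)
    show "center G \<noteq> {}" by (auto simp: center_def intro!: exI[of _ "\<one>\<^bsub>G\<^esub>"])
  next
    fix a assume a: "a \<in> center G"
    then have ac: "a \<in> carrier G" by (auto simp: center_def)
    have "x \<otimes>\<^bsub>G\<^esub> inv\<^bsub>G\<^esub> a = inv\<^bsub>G\<^esub> a \<otimes>\<^bsub>G\<^esub> x" if x: "x \<in> carrier G" for x
    proof -
      have "x \<otimes>\<^bsub>G\<^esub> a = a \<otimes>\<^bsub>G\<^esub> x" using a x by (auto simp: center_def)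
      then have "inv\<^bsub>G\<^esub> a \<otimes>\<^bsub>G\<^esub> (x \<otimes>\<^bsub>G\<^esub> a) = x"
        using ac x by (simp add: m_assoc[symmetric])
      then have "inv\<^bsub>G\<^esub> a \<otimes>\<^bsub>G\<^esub> x \<otimes>\<^bsub>G\<^esub> a = x"
        using ac x by (simp add: m_assoc)
      then show ?thesis using ac x inv_solve_right by (metis inv_closed m_closed)
    qed
    then show "inv\<^bsub>G\<^esub> a \<in> center G" using ac by (auto simp: center_def)
  next
    fix a b assume "a \<in> center G" "b \<in> center G"
    then have a: "a \<in> carrier G" and b: "b \<in> carrier G"
      and ca: "\<And>x. x \<in> carrier G \<Longrightarrow> x \<otimes>\<^bsub>G\<^esub> a = a \<otimes>\<^bsub>G\<^esub> x"
      and cb: "\<And>x. x \<in> carrier G \<Longrightarrow> x \<otimes>\<^bsub>G\<^esub> b = b \<otimes>\<^bsub>G\<^esub> x"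
      by (auto simp: center_def)
    have "x \<otimes>\<^bsub>G\<^esub> (a \<otimes>\<^bsub>G\<^esub> b) = a \<otimes>\<^bsub>G\<^esub> b \<otimes>\<^bsub>G\<^esub> x" if x: "x \<in> carrier G" for x
    proof -
      have "x \<otimes>\<^bsub>G\<^esub> (a \<otimes>\<^bsub>G\<^esub> b) = a \<otimes>\<^bsub>G\<^esub> x \<otimes>\<^bsub>G\<^esub> b"
        using a b x ca[OF x] by (simp add: m_assoc[symmetric])
      also have "\<dots> = a \<otimes>\<^bsub>G\<^esub> b \<otimes>\<^bsub>G\<^esub> x"
        using a b x cb[OF x] by (simp add: m_assoc)
      finally show ?thesis .
    qed
    then show "a \<otimes>\<^bsub>G\<^esub> b \<in> center G" using a b by (auto simp: center_def)
  qed
  have "x \<otimes>\<^bsub>G\<^esub> z \<otimes>\<^bsub>G\<^esub> inv\<^bsub>G\<^esub> x = z" if "x \<in> carrier G" "z \<in> center G" for x z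
  proof -
    have "x \<otimes>\<^bsub>G\<^esub> z = z \<otimes>\<^bsub>G\<^esub> x" "z \<in> carrier G" using that by (auto simp: center_def)
    then show ?thesis using that(1) by (simp add: m_assoc)
  qed
  then show ?thesis
    unfolding normal_inv_iff using sub by simp
qed

definition SL :: "('f::field ^ 'n::finite ^ 'n) monoid" where
  "SL = \<lparr>carrier = {A. det A = 1}, mult = (**), one = mat 1\<rparr>"

lemma group_SL: "group (SL :: ('f::field ^ 'n::finite ^ 'n) monoid)"
proof (rule groupI)
  fix A :: "'f ^ 'n ^ 'n" assume "A \<in> carrier SL"
  then have d: "det A = 1" by (simp add: SL_def)
  then have "invertible A" by (simp add: invertible_det_nz)
  then obtain B where B: "A ** B = mat 1" "B ** A = mat 1" by (auto simp: invertible_def)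
  then have "det B = 1" using d by (metis det_I det_mul mult_1_right)
  with B show "\<exists>B \<in> carrier SL. B \<otimes>\<^bsub>SL\<^esub> A = \<one>\<^bsub>SL\<^esub>" by (auto simp: SL_def)
qed (auto simp: SL_def det_mul matrix_mul_assoc)

definition PSL :: "('f::field ^ 'n::finite ^ 'n) set monoid" where
  "PSL = SL Mod center SL"

lemma group_PSL: "group (PSL :: ('f::field ^ 'n::finite ^ 'n) set monoid)"
  unfolding PSL_def by (intro normal.factorgroup_is_group center_normal group_SL)

definition involution :: "('a, 'b) monoid_scheme \<Rightarrow> 'a \<Rightarrow> bool" where
  "involution G x \<longleftrightarrow> x \<in> carrier G \<and> group.ord G x = 2"

definition string_representation :: "('a, 'b) monoid_scheme \<Rightarrow> nat \<Rightarrow> 'a list \<Rightarrow> bool" where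
  "string_representation G n g \<longleftrightarrow>
     length g = n \<and>
     distinct g \<and>
     (\<forall>x \<in> set g. involution G x) \<and>
     generate G (set g) = carrier G \<and>
     (\<forall>i<n. \<forall>j<n. \<bar>int i - int j\<bar> > 1 \<longrightarrow> g ! i \<otimes>\<^bsub>G\<^esub> g ! j = g ! j \<otimes>\<^bsub>G\<^esub> g ! i)"

end

theory Submission
  imports Defs "HOL-Algebra.Algebraic_Closure_Type" "HOL-Algebra.Group_Action"
begin

text \<open>
  In characteristic two commuting is transitive on involutions, so \<open>\<rho>\<^sub>0\<close> would be central. In odd
  characteristic let \<open>H = \<langle>\<rho>\<^sub>0, \<rho>\<^sub>1, \<rho>\<^sub>2\<rangle>\<close> act on the projective line over the algebraic closure, where
  every nontrivial element fixes one or two points. As \<open>\<rho>\<^sub>3\<close> commutes with \<open>\<rho>\<^sub>0\<close> and \<open>\<rho>\<^sub>1\<close>, the group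
  \<open>H\<close> has no orbit of length one or two. Counting pairs (element, fixed point) then leaves the polyhedral
  types \<open>A\<^sub>4\<close> (impossible), \<open>S\<^sub>4\<close> and \<open>A\<^sub>5\<close>, or an orbit which is a projective line over a finite
  subfield \<open>F\<close>. In the last case \<open>\<rho>\<^sub>3\<close>, being the cross product of \<open>\<rho>\<^sub>0\<close> and \<open>\<rho>\<^sub>1\<close> in the Lie algebra of
  traceless matrices, is defined over \<open>F\<close> up to a scalar, so the whole group preserves that orbit. This
  bounds the index of \<open>H\<close> by two, and \<open>H\<close> contains all squares, in particular all transvections.
\<close>

section \<open>Finite groups whose nontrivial elements fix one or two points\<close>

text \<open>Subgroups of \<open>PSL\<close> are not taken from Dickson's list; a count replaces it.
  Over a field with square roots each nontrivial element has an eigenvector, hence one or two fixed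
  points. Counting an element with a single fixed point twice makes every element contribute exactly
  2, so one equation holds whether or not the characteristic divides the group order. Excluding
  orbits of length one and two removes the subgroups that fix a point or a pair, the unbounded
  triangular and dihedral families that would blur the count. Those exclusions share one
  contradiction: an involution commuting with all four generators would be central, while
  \<open>PSL\<close> has trivial centre. The index bound is two and not one because the count does
  not separate a copy of PSL_2(m) from one of PGL_2(m), whose orders differ by that factor for odd
  m. Two fields are in play: the algebraic closure supplies fixed points, and the original finite
  field is needed at the end, where the transvections generate.\<close>

context group
begin

definition cnj :: "'a \<Rightarrow> 'a \<Rightarrow> 'a" where
  "cnj g x = g \<otimes> x \<otimes> inv g"

lemma cnj_closed [simp]: "g \<in> carrier G \<Longrightarrow> x \<in> carrier G \<Longrightarrow> cnj g x \<in> carrier G"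
  by (simp add: cnj_def)

lemma cnj_mult: "g \<in> carrier G \<Longrightarrow> x \<in> carrier G \<Longrightarrow> y \<in> carrier G \<Longrightarrow>
    cnj g (x \<otimes> y) = cnj g x \<otimes> cnj g y"
  by (simp add: cnj_def m_assoc inv_solve_left)

lemma cnj_one [simp]: "g \<in> carrier G \<Longrightarrow> cnj g \<one> = \<one>"
  by (simp add: cnj_def)

lemma one_cnj [simp]: "x \<in> carrier G \<Longrightarrow> cnj \<one> x = x"
  by (simp add: cnj_def)

lemma cnj_cnj: "g \<in> carrier G \<Longrightarrow> h \<in> carrier G \<Longrightarrow> x \<in> carrier G \<Longrightarrow>
    cnj (g \<otimes> h) x = cnj g (cnj h x)"
  by (simp add: cnj_def m_assoc inv_mult_group)

lemma cnj_inv_cancel [simp]: "g \<in> carrier G \<Longrightarrow> x \<in> carrier G \<Longrightarrow> cnj (inv g) (cnj g x) = x"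
    "g \<in> carrier G \<Longrightarrow> x \<in> carrier G \<Longrightarrow> cnj g (cnj (inv g) x) = x"
  by (simp_all flip: cnj_cnj)

lemma cnj_eq_iff: "g \<in> carrier G \<Longrightarrow> x \<in> carrier G \<Longrightarrow> y \<in> carrier G \<Longrightarrow>
    cnj g x = cnj g y \<longleftrightarrow> x = y"
  by (metis cnj_inv_cancel(1))

lemma cnj_eq_one_iff: "g \<in> carrier G \<Longrightarrow> x \<in> carrier G \<Longrightarrow> cnj g x = \<one> \<longleftrightarrow> x = \<one>"
  using cnj_eq_iff[of g x \<one>] by simp

lemma cnj_eq_self_iff: "g \<in> carrier G \<Longrightarrow> x \<in> carrier G \<Longrightarrow> cnj g x = x \<longleftrightarrow> g \<otimes> x = x \<otimes> g"
  by (simp add: cnj_def inv_solve_right')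

lemma subgroup_centralizer:
  assumes w: "w \<in> carrier G"
  shows "subgroup {g \<in> carrier G. cnj g w = w} G"
proof (rule subgroupI)
  show "{g \<in> carrier G. cnj g w = w} \<noteq> {}" using w by (auto intro!: exI[of _ \<one>])
  fix a b assume a: "a \<in> {g \<in> carrier G. cnj g w = w}" and b: "b \<in> {g \<in> carrier G. cnj g w = w}"
  show "inv a \<in> {g \<in> carrier G. cnj g w = w}" using a w cnj_inv_cancel(1)[of a w] by simp
  show "a \<otimes> b \<in> {g \<in> carrier G. cnj g w = w}" using a b w by (simp add: cnj_cnj)
qed auto

lemma card_subgroup_dvd:
  assumes "subgroup A G" "subgroup B G" "A \<subseteq> B"
  shows "card A dvd card B"
proof -
  have "subgroup A (G\<lparr>carrier := B\<rparr>)" using assms subgroup_incl by blast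
  then show ?thesis using group.lagrange[OF subgroup_imp_group[OF assms(2)]]
    by (metis dvd_triv_right Coset.order_def partial_object.simps(1) partial_object.surjective partial_object.update_convs(1))
qed

end

text \<open>Freeness makes every orbit a copy of \<open>K\<close>, and the orbits partition
  \<open>E\<close>.\<close>

lemma (in group) card_dvd_of_free_action:
  fixes act :: "'a \<Rightarrow> 'x \<Rightarrow> 'x"
  assumes K: "subgroup K G" "finite K" and E: "finite E"
    and act_one: "\<And>e. act \<one> e = e"
    and act_mult: "\<And>g h e. g \<in> K \<Longrightarrow> h \<in> K \<Longrightarrow> act (g \<otimes> h) e = act g (act h e)"
    and closed: "\<And>g e. g \<in> K \<Longrightarrow> e \<in> E \<Longrightarrow> act g e \<in> E"
    and free: "\<And>g e. g \<in> K \<Longrightarrow> e \<in> E \<Longrightarrow> act g e = e \<Longrightarrow> g = \<one>"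
  shows "card K dvd card E"
proof -
  interpret K: subgroup K G by fact
  define orb where "orb e = (\<lambda>k. act k e) ` K" for e
  have inj: "inj_on (\<lambda>k. act k e) K" if "e \<in> E" for e
  proof (rule inj_onI)
    fix g h assume gh: "g \<in> K" "h \<in> K" "act g e = act h e"
    then have "act (inv h \<otimes> g) e = act (inv h) (act h e)"
      by (simp add: act_mult)
    also have "\<dots> = e" using gh by (simp flip: act_mult add: act_one)
    finally have "inv h \<otimes> g = \<one>" using free gh that by blast
    then show "g = h" using gh by (metis K.mem_carrier inv_closed inv_equality inv_inv)
  qed
  have orb_eq: "orb a = orb b" if "a \<in> E" "b \<in> E" "c \<in> orb a" "c \<in> orb b" for a b c
  proof -
    have *: "orb (act k e) = orb e" if "e \<in> E" "k \<in> K" for e k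
    proof -
      have "act g (act k e) \<in> orb e" if "g \<in> K" for g
        unfolding orb_def using \<open>k \<in> K\<close> that by (auto simp flip: act_mult)
      moreover have "act g e \<in> orb (act k e)" if "g \<in> K" for g
      proof -
        have "act g e = act (g \<otimes> inv k) (act k e)"
          using \<open>k \<in> K\<close> that by (simp flip: act_mult add: m_assoc)
        then show ?thesis unfolding orb_def using \<open>k \<in> K\<close> that by blast
      qed
      ultimately show ?thesis by (auto simp: orb_def)
    qed
    show ?thesis using that * by (metis (no_types, lifting) imageE orb_def)
  qed
  have un: "\<Union> (orb ` E) = E"
  proof
    show "\<Union> (orb ` E) \<subseteq> E" using closed by (auto simp: orb_def)
    show "E \<subseteq> \<Union> (orb ` E)"
    proof
      fix e assume "e \<in> E"
      moreover have "e \<in> orb e" unfolding orb_def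
        by (rule image_eqI[of _ _ \<one>]) (simp_all add: act_one)
      ultimately show "e \<in> \<Union> (orb ` E)" by blast
    qed
  qed
  have "card K * card (orb ` E) = card (\<Union> (orb ` E))"
  proof (rule card_partition)
    show "finite (orb ` E)" using E by simp
    show "finite (\<Union> (orb ` E))" using E un by simp
    show "\<And>c. c \<in> orb ` E \<Longrightarrow> card c = card K" using inj by (auto simp: orb_def card_image)
    show "\<And>c1 c2. c1 \<in> orb ` E \<Longrightarrow> c2 \<in> orb ` E \<Longrightarrow> c1 \<noteq> c2 \<Longrightarrow> c1 \<inter> c2 = {}"
      using orb_eq by blast
  qed
  then show ?thesis using un by (metis dvd_triv_left)
qed

text \<open>The axioms abstract a finite subgroup of PSL_2 acting on the projective line over a
  field with square roots in which 2 is nonzero. An element with a single fixed point is unipotent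
  up to sign, so \<open>unip\<close> says that the unipotent elements of a point stabiliser form a
  subgroup. \<open>invol_fix\<close> holds because an involution has two distinct eigenvalues when 2
  is nonzero.\<close>

locale fix_action = group G for G :: "('a, 'b) monoid_scheme" (structure) +
  fixes act :: "'a \<Rightarrow> 'x \<Rightarrow> 'x"
  assumes fin: "finite (carrier G)"
    and act_one [simp]: "act \<one> x = x"
    and act_mult: "g \<in> carrier G \<Longrightarrow> h \<in> carrier G \<Longrightarrow> act (g \<otimes> h) x = act g (act h x)"
    and card_fix: "g \<in> carrier G \<Longrightarrow> g \<noteq> \<one> \<Longrightarrow> card {x. act g x = x} \<in> {1, 2}"
    and unip: "subgroup {g \<in> carrier G. act g x = x \<and> (g = \<one> \<or> card {x. act g x = x} = 1)} G"
    and invol_fix: "g \<in> carrier G \<Longrightarrow> g \<noteq> \<one> \<Longrightarrow> g \<otimes> g = \<one> \<Longrightarrow> card {x. act g x = x} = 2"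
begin

definition Fix :: "'a \<Rightarrow> 'x set" where "Fix g = {x. act g x = x}"
definition Stab :: "'x \<Rightarrow> 'a set" where "Stab x = {g \<in> carrier G. act g x = x}"
definition Unip :: "'x \<Rightarrow> 'a set" where "Unip x = {g \<in> Stab x. g = \<one> \<or> card (Fix g) = 1}"
definition Orb :: "'x \<Rightarrow> 'x set" where "Orb x = (\<lambda>g. act g x) ` carrier G"

lemma act_inv_cancel [simp]:
  "g \<in> carrier G \<Longrightarrow> act (inv g) (act g x) = x"
  "g \<in> carrier G \<Longrightarrow> act g (act (inv g) x) = x"
  by (simp_all flip: act_mult)

lemma act_eq_iff: "g \<in> carrier G \<Longrightarrow> act g x = act g y \<longleftrightarrow> x = y"
  by (metis act_inv_cancel(1))

lemma card_Fix: "g \<in> carrier G \<Longrightarrow> g \<noteq> \<one> \<Longrightarrow> card (Fix g) = 1 \<or> card (Fix g) = 2"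
  using card_fix by (auto simp: Fix_def)

lemma finite_Fix: "g \<in> carrier G \<Longrightarrow> g \<noteq> \<one> \<Longrightarrow> finite (Fix g)"
  using card_Fix by (metis card.infinite zero_neq_numeral zero_neq_one)

lemma Fix_nonempty: "g \<in> carrier G \<Longrightarrow> g \<noteq> \<one> \<Longrightarrow> Fix g \<noteq> {}"
  using card_Fix by (metis card.empty zero_neq_numeral zero_neq_one)

lemma eq_one_of_fixes_three:
  assumes "g \<in> carrier G" "act g x = x" "act g y = y" "act g z = z" "x \<noteq> y" "x \<noteq> z" "y \<noteq> z"
  shows "g = \<one>"
proof (rule ccontr)
  assume "g \<noteq> \<one>"
  have "card {x, y, z} \<le> card (Fix g)"
    using assms finite_Fix[OF assms(1) \<open>g \<noteq> \<one>\<close>] by (intro card_mono) (auto simp: Fix_def)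
  then show False using card_Fix[OF assms(1) \<open>g \<noteq> \<one>\<close>] assms by auto
qed

lemma Fix_cnj: "h \<in> carrier G \<Longrightarrow> g \<in> carrier G \<Longrightarrow> Fix (cnj h g) = act h ` Fix g"
proof -
  assume hg: "h \<in> carrier G" "g \<in> carrier G"
  have "act (cnj h g) (act h x) = act h x \<longleftrightarrow> act g x = x" for x
    using hg by (simp add: cnj_def act_mult act_eq_iff)
  then show ?thesis
    unfolding Fix_def using hg by (auto simp: image_iff) (metis act_inv_cancel(2))
qed

lemma card_Fix_cnj: "h \<in> carrier G \<Longrightarrow> g \<in> carrier G \<Longrightarrow> card (Fix (cnj h g)) = card (Fix g)"
  by (simp add: Fix_cnj card_image inj_on_def act_eq_iff)

lemma Stab_subset: "Stab x \<subseteq> carrier G" and Unip_subset: "Unip x \<subseteq> Stab x"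
  by (auto simp: Stab_def Unip_def)

lemma finite_Stab: "finite (Stab x)"
  using fin Stab_subset finite_subset by blast

lemma finite_Unip: "finite (Unip x)"
  using finite_Stab Unip_subset finite_subset by blast

lemma finite_Orb: "finite (Orb x)"
  using fin by (simp add: Orb_def)

lemma subgroup_Stab: "subgroup (Stab x) G"
  by (rule subgroupI) (auto simp: Stab_def act_mult, metis act_inv_cancel(1))

lemma subgroup_Unip: "subgroup (Unip x) G"
  using unip[of x] by (simp add: Unip_def Stab_def Fix_def conj_assoc)

lemma Stab_act: "h \<in> carrier G \<Longrightarrow> Stab (act h x) = cnj h ` Stab x"
proof (intro equalityI subsetI)
  fix g assume h: "h \<in> carrier G" and g: "g \<in> Stab (act h x)"
  then have gG: "g \<in> carrier G" by (simp add: Stab_def)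
  have "act (cnj (inv h) g) x = x"
    using h g by (simp add: Stab_def cnj_def act_mult)
  then show "g \<in> cnj h ` Stab x"
    using h gG by (intro image_eqI[of _ _ "cnj (inv h) g"]) (auto simp: Stab_def)
next
  fix g assume h: "h \<in> carrier G" and "g \<in> cnj h ` Stab x"
  then show "g \<in> Stab (act h x)" by (auto simp: Stab_def cnj_def act_mult)
qed

lemma Unip_act: "h \<in> carrier G \<Longrightarrow> Unip (act h x) = cnj h ` Unip x"
proof -
  assume h: "h \<in> carrier G"
  have "cnj h g = \<one> \<or> card (Fix (cnj h g)) = 1 \<longleftrightarrow> g = \<one> \<or> card (Fix g) = 1" if "g \<in> Stab x" for g
    using that h Stab_subset by (metis card_Fix_cnj cnj_eq_one_iff subsetD)
  then show ?thesis using h by (auto simp: Unip_def Stab_act)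
qed

lemma inj_on_cnj: "h \<in> carrier G \<Longrightarrow> A \<subseteq> carrier G \<Longrightarrow> inj_on (cnj h) A"
  by (meson cnj_eq_iff inj_on_def subsetD)

lemma card_Stab_act: "h \<in> carrier G \<Longrightarrow> card (Stab (act h x)) = card (Stab x)"
  using Stab_act inj_on_cnj Stab_subset by (metis card_image)

lemma card_Unip_act: "h \<in> carrier G \<Longrightarrow> card (Unip (act h x)) = card (Unip x)"
  using Unip_act inj_on_cnj Stab_subset Unip_subset by (metis card_image dual_order.trans)

lemma card_Stab_Orb: "y \<in> Orb x \<Longrightarrow> card (Stab y) = card (Stab x)"
  by (auto simp: Orb_def card_Stab_act)

lemma card_Unip_Orb: "y \<in> Orb x \<Longrightarrow> card (Unip y) = card (Unip x)"
  by (auto simp: Orb_def card_Unip_act)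

lemma Orb_refl [simp]: "x \<in> Orb x"
  unfolding Orb_def by (rule image_eqI[of _ _ \<one>]) auto

lemma Orb_sym: "y \<in> Orb x \<Longrightarrow> x \<in> Orb y"
proof -
  assume "y \<in> Orb x"
  then obtain g where "g \<in> carrier G" "y = act g x" by (auto simp: Orb_def)
  then show ?thesis unfolding Orb_def by (intro image_eqI[of _ _ "inv g"]) simp_all
qed

lemma Orb_trans: "y \<in> Orb x \<Longrightarrow> z \<in> Orb y \<Longrightarrow> z \<in> Orb x"
proof -
  assume "y \<in> Orb x" "z \<in> Orb y"
  then obtain g h where "g \<in> carrier G" "y = act g x" "h \<in> carrier G" "z = act h y"
    by (auto simp: Orb_def)
  then show ?thesis unfolding Orb_def by (intro image_eqI[of _ _ "h \<otimes> g"]) (simp_all add: act_mult)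
qed

lemma Orb_eq: "y \<in> Orb x \<Longrightarrow> Orb y = Orb x"
  using Orb_sym Orb_trans by blast

lemma act_Orb: "g \<in> carrier G \<Longrightarrow> act g x \<in> Orb y \<longleftrightarrow> x \<in> Orb y"
proof -
  assume "g \<in> carrier G"
  then have "act g x \<in> Orb x" by (auto simp: Orb_def)
  then show ?thesis using Orb_eq Orb_sym by blast
qed

lemma group_action_act: "group_action G UNIV act"
proof -
  have bij: "act g \<in> Bij UNIV" if "g \<in> carrier G" for g
  proof -
    have "bij (act g)" by (rule bijI') (use that act_eq_iff act_inv_cancel(2) in \<open>metis+\<close>)
    then show ?thesis by (simp add: Bij_def)
  qed
  have "act \<in> hom G (BijGroup UNIV)"
    using bij by (auto simp: hom_def BijGroup_def compose_def act_mult fun_eq_iff)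
  then show ?thesis
    by (simp add: group_action_def group_hom_def group_hom_axioms_def is_group group_BijGroup)
qed

lemma orbit_stab: "card (Orb x) * card (Stab x) = card (carrier G)"
proof -
  interpret ga: group_action G UNIV act by (rule group_action_act)
  have "orbit G act x = Orb x" by (auto simp: orbit_def Orb_def)
  moreover have "stabilizer G act x = Stab x" by (auto simp: stabilizer_def Stab_def)
  ultimately show ?thesis using ga.orbit_stabilizer_theorem[of x] by (simp add: Coset.order_def)
qed

lemma card_Stab_pos: "card (Stab x) > 0" and card_Unip_pos: "card (Unip x) > 0"
  using finite_Stab finite_Unip subgroup_Stab subgroup_Unip
  by (metis card_gt_0_iff empty_iff subgroup.one_closed)+

lemma Unip_dvd_Stab: "card (Unip x) dvd card (Stab x)"
  by (rule card_subgroup_dvd[OF subgroup_Unip subgroup_Stab Unip_subset])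

text \<open>As \<open>g\<close> permutes \<open>Fix u = {x}\<close>, it fixes \<open>x\<close>. A
  second fixed point \<open>y\<close> of \<open>g\<close> would be fixed by \<open>u\<close> as
  well, since \<open>u\<close> permutes \<open>Fix g = {x, y}\<close> and fixes
  \<open>x\<close>.\<close>

lemma fixes_of_commutes_unipotent:
  assumes u: "u \<in> Unip x" "u \<noteq> \<one>" and g: "g \<in> carrier G" "g \<otimes> u = u \<otimes> g"
  shows "g \<in> Unip x"
proof -
  have uG: "u \<in> carrier G" and ux: "act u x = x" and "card (Fix u) = 1"
    using u by (auto simp: Unip_def Stab_def)
  then have Fu: "Fix u = {x}" by (metis (mono_tags) Fix_def card_1_singletonE mem_Collect_eq singletonD)
  have "act u (act g x) = act g x" using g uG ux by (metis act_mult)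
  then have gx: "act g x = x" using Fu by (auto simp: Fix_def)
  show ?thesis
  proof (cases "g = \<one> \<or> card (Fix g) = 1")
    case True then show ?thesis using g gx by (auto simp: Unip_def Stab_def)
  next
    case False
    then have "card (Fix g) = 2" using card_Fix g by blast
    then obtain a b where "Fix g = {a, b}" "a \<noteq> b" by (auto simp: card_2_iff)
    moreover have "x \<in> Fix g" using gx by (simp add: Fix_def)
    ultimately obtain y where y: "Fix g = {x, y}" "y \<noteq> x" by auto
    have "y \<in> Fix g" using y by simp
    then have "act g y = y" by (simp add: Fix_def)
    moreover have "act g (act u y) = act u (act g y)" using g uG by (simp flip: act_mult)
    ultimately have "act u y \<in> Fix g" by (simp add: Fix_def)
    then have "act u y \<in> {x, y}" using y by simp
    moreover have "act u y \<noteq> x" using ux y uG by (metis act_eq_iff)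
    ultimately have "y \<in> Fix u" by (auto simp: Fix_def)
    then show ?thesis using Fu y by auto
  qed
qed

text \<open>For one nontrivial \<open>u\<close> in \<open>Unip x\<close>, conjugation sends
  \<open>Stab x\<close> into \<open>Unip x - {\<one>}\<close>. Each fibre is a translate of a part
  of the centraliser of \<open>u\<close>, which lies in \<open>Unip x\<close> by the previous
  lemma.\<close>

lemma card_Stab_le:
  assumes "card (Unip x) \<noteq> 1"
  shows "card (Stab x) \<le> card (Unip x) * (card (Unip x) - 1)"
proof -
  obtain u where u: "u \<in> Unip x" "u \<noteq> \<one>"
  proof (rule ccontr)
    assume "\<not> thesis"
    then have "Unip x = {\<one>}" using that subgroup.one_closed[OF subgroup_Unip] by blast
    then show False using assms by simp
  qed
  have uG: "u \<in> carrier G" using u by (auto simp: Unip_def Stab_def)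
  have cu: "cnj g u \<in> Unip x - {\<one>}" if "g \<in> Stab x" for g
  proof -
    have gG: "g \<in> carrier G" "act g x = x" using that by (auto simp: Stab_def)
    then have "cnj g u \<in> Unip x" using Unip_act[of g x] u by auto
    then show ?thesis using cnj_eq_one_iff uG u gG by auto
  qed
  define A where "A v = {g \<in> Stab x. cnj g u = v}" for v
  have "card (A v) \<le> card (Unip x)" for v
  proof (cases "A v = {}")
    case False
    then obtain g0 where g0: "g0 \<in> Stab x" "cnj g0 u = v" by (auto simp: A_def)
    have g0G: "g0 \<in> carrier G" using g0 by (auto simp: Stab_def)
    have "inv g0 \<otimes> g \<in> Unip x" if "g \<in> A v" for g
    proof -
      have gG: "g \<in> carrier G" "cnj g u = cnj g0 u" using that g0 by (auto simp: A_def Stab_def)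
      have "cnj (inv g0 \<otimes> g) u = u" using gG g0G uG by (simp add: cnj_cnj)
      then show ?thesis
        using fixes_of_commutes_unipotent[OF u] gG g0G uG by (simp add: cnj_eq_self_iff)
    qed
    moreover have "inj_on (\<lambda>g. inv g0 \<otimes> g) (A v)"
      using g0G by (auto simp: inj_on_def A_def Stab_def)
    ultimately show ?thesis using finite_Unip by (metis card_inj_on_le image_subsetI)
  qed simp
  then have "(\<Sum>v\<in>Unip x - {\<one>}. card (A v)) \<le> (\<Sum>v\<in>Unip x - {\<one>}. card (Unip x))"
    by (intro sum_mono)
  also have "\<dots> = card (Unip x) * (card (Unip x) - 1)"
    using finite_Unip subgroup.one_closed[OF subgroup_Unip] by simp
  finally have "(\<Sum>v\<in>Unip x - {\<one>}. card (A v)) \<le> card (Unip x) * (card (Unip x) - 1)" .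
  moreover have "Stab x = (\<Union>v\<in>Unip x - {\<one>}. A v)" using cu by (auto simp: A_def)
  then have "card (Stab x) \<le> (\<Sum>v\<in>Unip x - {\<one>}. card (A v))"
    using card_UN_le finite_Unip by (metis finite_Diff)
  ultimately show ?thesis by linarith
qed

text \<open>The generator of a group of order two would be an involution, which has two fixed
  points. Hence a nontrivial \<open>Unip x\<close> has order at least three, the bound behind all
  later estimates.\<close>

lemma card_Unip_neq_2: "card (Unip x) \<noteq> 2"
proof
  assume "card (Unip x) = 2"
  then obtain a b where ab: "Unip x = {a, b}" "a \<noteq> b" by (auto simp: card_2_iff)
  moreover have "\<one> \<in> Unip x" by (rule subgroup.one_closed[OF subgroup_Unip])
  ultimately obtain u where u: "Unip x = {\<one>, u}" "u \<noteq> \<one>" by auto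
  then have uG: "u \<in> carrier G" using Unip_subset Stab_subset by blast
  have "u \<otimes> u \<in> Unip x" using subgroup.m_closed[OF subgroup_Unip, of u x u] u by simp
  then have "u \<otimes> u = \<one>" using u uG by auto
  then have "card (Fix u) = 2" using invol_fix uG u by (simp add: Fix_def)
  moreover have "u \<in> Unip x" using u by simp
  ultimately show False using u by (simp add: Unip_def)
qed

text \<open>A nontrivial element of \<open>Unip x\<close> fixes nothing but \<open>x\<close>, so the
  action on the rest of the orbit is free.\<close>

lemma Unip_dvd_Orb: "card (Unip x) dvd card (Orb x) - 1"
proof -
  have "card (Unip x) dvd card (Orb x - {x})"
  proof (rule card_dvd_of_free_action[where act = act])
    show "subgroup (Unip x) G" "finite (Unip x)" "finite (Orb x - {x})"
      by (simp_all add: subgroup_Unip finite_Unip finite_Orb)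
    have sub: "Unip x \<subseteq> carrier G" using Unip_subset Stab_subset by blast
    show "act (g \<otimes> h) e = act g (act h e)" if "g \<in> Unip x" "h \<in> Unip x" for g h e
      using sub that act_mult by blast
    show "act g e \<in> Orb x - {x}" if "g \<in> Unip x" "e \<in> Orb x - {x}" for g e
    proof -
      have "g \<in> carrier G" "act g x = x" using that by (auto simp: Unip_def Stab_def)
      then show ?thesis using that act_Orb act_eq_iff by (metis DiffE DiffI singleton_iff)
    qed
    show "g = \<one>" if "g \<in> Unip x" "e \<in> Orb x - {x}" "act g e = e" for g e
    proof (rule ccontr)
      assume "g \<noteq> \<one>"
      then have "card (Fix g) = 1" "x \<in> Fix g" "e \<in> Fix g"
        using that by (auto simp: Unip_def Stab_def Fix_def)
      then show False using that(2) by (auto simp: card_1_singleton_iff)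
    qed
  qed auto
  then show ?thesis by (simp add: finite_Orb)
qed

section \<open>Weighted count of fixed points\<close>

definition Poles :: "'x set" where "Poles = {x. card (Stab x) > 1}"

text \<open>The number of nontrivial elements fixing \<open>x\<close>, those with no other fixed
  point counted twice. Both cardinalities are positive, so the subtraction of 2 is not
  truncated.\<close>

definition val :: "'x \<Rightarrow> nat" where "val x = card (Stab x) + card (Unip x) - 2"

lemma Poles_iff: "x \<in> Poles \<longleftrightarrow> (\<exists>g \<in> carrier G - {\<one>}. x \<in> Fix g)"
proof -
  have one: "\<one> \<in> Stab x" by (rule subgroup.one_closed[OF subgroup_Stab])
  have "card (Stab x) > 1 \<longleftrightarrow> Stab x \<noteq> {\<one>}"
  proof
    assume "Stab x \<noteq> {\<one>}"
    then have "{\<one>} \<subset> Stab x" using one by blast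
    then have "card {\<one>} < card (Stab x)" using finite_Stab psubset_card_mono by blast
    then show "card (Stab x) > 1" by simp
  qed auto
  then show ?thesis using one by (auto simp: Poles_def Fix_def Stab_def)
qed

lemma finite_Poles: "finite Poles"
proof -
  have "Poles = (\<Union>g\<in>carrier G - {\<one>}. Fix g)" using Poles_iff by auto
  then show ?thesis using fin finite_Fix by simp
qed

lemma Poles_Orb: "x \<in> Poles \<Longrightarrow> Orb x \<subseteq> Poles"
  by (auto simp: Poles_def card_Stab_Orb)

text \<open>Double counting of pairs (element, fixed point) with the weight \<open>w\<close>: two
  fixed points of weight 1 and one fixed point of weight 2 both add up to 2.\<close>

lemma sum_val_Poles: "(\<Sum>x\<in>Poles. val x) = 2 * (card (carrier G) - 1)"
proof -
  define w where "w g = (1::nat) + (if card (Fix g) = 1 then 1 else 0)" for g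
  let ?G = "carrier G - {\<one>}"
  have "(\<Sum>g\<in>?G. \<Sum>x\<in>Poles. if x \<in> Fix g then w g else 0) = (\<Sum>g\<in>?G. 2)"
  proof (rule sum.cong[OF refl])
    fix g assume g: "g \<in> ?G"
    then have "Poles \<inter> Fix g = Fix g" using Poles_iff by blast
    then have "(\<Sum>x\<in>Poles. if x \<in> Fix g then w g else 0) = card (Fix g) * w g"
      using finite_Poles by (simp add: sum.inter_restrict[symmetric])
    also have "\<dots> = 2" using card_Fix g by (auto simp: w_def)
    finally show "(\<Sum>x\<in>Poles. if x \<in> Fix g then w g else 0) = 2" .
  qed
  also have "\<dots> = 2 * (card (carrier G) - 1)" using fin by simp
  finally have "(\<Sum>x\<in>Poles. \<Sum>g\<in>?G. if x \<in> Fix g then w g else 0) = 2 * (card (carrier G) - 1)"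
    by (simp add: sum.swap[of _ Poles])
  moreover have "(\<Sum>g\<in>?G. if x \<in> Fix g then w g else 0) = val x" for x
  proof -
    have one: "\<one> \<in> Stab x" "\<one> \<in> Unip x"
      using subgroup.one_closed[OF subgroup_Stab] subgroup.one_closed[OF subgroup_Unip] by auto
    have "(\<Sum>g\<in>?G. if x \<in> Fix g then w g else 0) = (\<Sum>g\<in>{g\<in>?G. x \<in> Fix g}. w g)"
      by (rule sum.inter_filter[symmetric]) (simp add: fin)
    also have "{g\<in>?G. x \<in> Fix g} = Stab x - {\<one>}" by (auto simp: Stab_def Fix_def)
    also have "(\<Sum>g\<in>Stab x - {\<one>}. w g) = card (Stab x - {\<one>}) + card {g\<in>Stab x - {\<one>}. card (Fix g) = 1}"
    proof -
      have "(\<Sum>g\<in>Stab x - {\<one>}. w g) = card (Stab x - {\<one>})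
          + (\<Sum>g\<in>Stab x - {\<one>}. if card (Fix g) = 1 then 1 else 0)"
        unfolding w_def by (subst sum.distrib) (simp only: sum_constant of_nat_id mult_1_right)
      then show ?thesis
        using sum.inter_filter[of "Stab x - {\<one>}" "\<lambda>_. 1::nat" "\<lambda>g. card (Fix g) = 1"]
        by (simp only: finite_Stab finite_Diff simp_thms sum_constant of_nat_id mult_1_right)
    qed
    also have "{g\<in>Stab x - {\<one>}. card (Fix g) = 1} = Unip x - {\<one>}" by (auto simp: Unip_def)
    also have "card (Stab x - {\<one>}) + card (Unip x - {\<one>}) = val x"
      using one finite_Stab finite_Unip card_Stab_pos[of x] card_Unip_pos[of x] by (simp add: val_def)
    finally show ?thesis .
  qed
  ultimately show ?thesis by simp
qed

lemma sum_val_peel: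
  assumes "finite Y" "x \<in> Y" "Orb x \<subseteq> Y"
  shows "(\<Sum>y\<in>Y. val y) = card (Orb x) * val x + (\<Sum>y\<in>Y - Orb x. val y)"
proof -
  have "(\<Sum>y\<in>Orb x. val y) = (\<Sum>y\<in>Orb x. val x)"
    by (rule sum.cong) (simp_all add: val_def card_Stab_Orb card_Unip_Orb)
  then show ?thesis
    using sum.subset_diff[OF assms(3,1), of val] by simp
qed

end

text \<open>The case of two orbits of poles. The first has length \<open>s1\<close> and stabilisers
  of order \<open>m * k\<close> whose unipotent part has order \<open>m\<close>; the second has
  length \<open>s2\<close> and stabilisers of order \<open>n\<close> without unipotents. The
  alternative \<open>f = 1\<close> is the projective line over a field with \<open>m\<close>
  elements; the exception of order 60 is the alternating group in characteristic three.\<close>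

lemma two_orbit_arith:
  fixes m k n s1 s2 f h :: nat
  assumes m: "m \<ge> 3" and k: "1 \<le> k" "k \<le> m - 1"
    and h: "s1 * (m * k) = h" "s2 * n = h" and s1: "s1 = 1 + m * f" "f \<ge> 1" and n: "n \<ge> 2"
    and eq: "s1 * (m * k + m - 2) + s2 * (n - 1) = 2 * (h - 1)"
  shows "(f = 1 \<and> m \<le> 2 * k + 1) \<or> (m = 3 \<and> k = 2 \<and> n = 5 \<and> h = 60)"
proof -
  define m' n' where "m' = m - 2" "n' = n - 1"
  then have m': "m = m' + 2" "m' \<ge> 1" and n': "n = n' + 1" "n' \<ge> 1" using m n by auto
  have hpos: "h \<ge> 1" using h(1) m k s1 by (cases h) auto
  have "s1 * (m * k + m - 2) = h + s1 * m'" using h(1) m' by (simp add: algebra_simps)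
  moreover have "s2 * (n - 1) + s2 = h" using h(2) n' by (simp add: algebra_simps)
  ultimately have s2: "s2 = s1 * m' + 2" using eq hpos by linarith
  \<comment> \<open>\<open>D\<close> is \<open>s2 / m\<close>. It is coprime to \<open>f\<close> and
    divides \<open>2 * k * f\<close>, hence \<open>2 * k\<close>, while \<open>2 * k\<close> is at
    most \<open>2 * m' + 2\<close>; this leaves little room for \<open>f > 1\<close>.\<close>
  define D where "D = 1 + f * m'"
  have "s2 = m * D" using s2 s1 m' by (simp add: D_def algebra_simps)
  then have "m * (s1 * k) = m * (D * n)" using h by (simp add: algebra_simps)
  then have main: "s1 * k = D * n" using m by simp
  have s1D: "s1 = D + 2 * f" using s1 m' by (simp add: D_def algebra_simps)
  have "D * k + f * (2 * k) = D * n" using main s1D by (simp add: algebra_simps)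
  then have "D dvd f * (2 * k)" by (metis dvd_add_right_iff dvd_triv_left)
  moreover have "coprime D f" unfolding D_def by (metis coprime_iff_gcd_eq_1 gcd_add_mult gcd.commute mult.commute add.commute gcd_1_nat)
  ultimately obtain e where e: "2 * k = D * e" using coprime_dvd_mult_right_iff by (metis dvdE)
  have e1: "e \<ge> 1" using e k by (cases e) auto
  have "D * (k + f * e) = D * n" using \<open>D * k + f * (2 * k) = D * n\<close> e by (simp add: algebra_simps)
  moreover have "D > 0" by (simp add: D_def)
  ultimately have nk: "n = k + f * e" by simp
  have le: "D * e \<le> 2 * m' + 2" using e k m' by linarith
  show ?thesis
  proof (cases "f = 1")
    case True
    have "D \<le> D * e" using e1 by simp
    then show ?thesis using True e m' by (simp add: D_def)
  next
    case False
    then have f2: "f \<ge> 2" using s1 by simp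
    have "e = 1"
    proof (rule ccontr)
      assume "e \<noteq> 1"
      then have "D * 2 \<le> D * e" using e1 by (intro mult_left_mono) auto
      moreover have "2 * m' \<le> f * m'" using f2 by simp
      ultimately show False using le m' D_def by linarith
    qed
    then have kD: "2 * k = 1 + f * m'" using e D_def by simp
    have "f \<noteq> 2"
    proof
      assume "f = 2"
      then have "2 * k = 1 + 2 * m'" using kD by simp
      then show False by presburger
    qed
    then have f3: "f \<ge> 3" using f2 by simp
    then have "3 * m' \<le> f * m'" by simp
    moreover have "D \<le> 2 * m' + 2" using le \<open>e = 1\<close> by simp
    ultimately have "m' = 1" using m' D_def by linarith
    then have "f = 3" using le \<open>e = 1\<close> f3 by (simp add: D_def)
    then have "k = 2" "n = 5" "m = 3" using kD nk m' \<open>m' = 1\<close> \<open>e = 1\<close> by auto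
    moreover have "h = 60" using h(1) s1 \<open>f = 3\<close> calculation by simp
    ultimately show ?thesis by simp
  qed
qed

text \<open>Dividing by \<open>h\<close> gives 1/n1 + 1/n2 + 1/n3 = 1 + 2/h, the equation of the
  finite rotation groups. The dihedral solution (2, 2, n) would have \<open>s3 = 2\<close>.\<close>

lemma three_orbit_arith:
  fixes s1 s2 s3 n1 n2 n3 h :: nat
  assumes h: "s1 * n1 = h" "s2 * n2 = h" "s3 * n3 = h" and s: "s1 > 2" "s2 > 2" "s3 > 2"
    and n: "2 \<le> n1" "n1 \<le> n2" "n2 \<le> n3" and eq: "s1 + s2 + s3 = h + 2"
  shows "n1 = 2 \<and> n2 = 3 \<and> (n3 = 3 \<and> h = 12 \<or> n3 = 4 \<and> h = 24 \<or> n3 = 5 \<and> h = 60)"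
proof -
  have b: "s * c \<le> h" if "s * n' = h" "c \<le> n'" for s n' c using that by (metis mult_le_mono2)
  have "n1 = 2"
  proof (rule ccontr)
    assume "n1 \<noteq> 2"
    then have "s1 * 3 \<le> h" "s2 * 3 \<le> h" "s3 * 3 \<le> h" using b h n by auto
    then show False using eq by linarith
  qed
  then have s1: "s1 * 2 = h" using h by simp
  have "n2 < 4"
  proof (rule ccontr)
    assume "\<not> n2 < 4"
    then have "s2 * 4 \<le> h" "s3 * 4 \<le> h" using b h n by auto
    then show False using eq s1 by linarith
  qed
  moreover have "n2 \<noteq> 2"
  proof
    assume "n2 = 2"
    then have "s2 * 2 = h" using h by simp
    then show False using eq s1 s by linarith
  qed
  ultimately have "n2 = 3" using n by linarith
  then have s2: "s2 * 3 = h" using h by simp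
  have "n3 < 6"
  proof (rule ccontr)
    assume "\<not> n3 < 6"
    then have "s3 * 6 \<le> h" using b h n by auto
    then show False using eq s1 s2 by linarith
  qed
  then consider "n3 = 3" | "n3 = 4" | "n3 = 5" using n \<open>n2 = 3\<close> by linarith
  then show ?thesis
  proof cases
    case 1 then show ?thesis using h(3) \<open>n1 = 2\<close> \<open>n2 = 3\<close> s1 s2 eq by simp
  next
    case 2 then show ?thesis using h(3) \<open>n1 = 2\<close> \<open>n2 = 3\<close> s1 s2 eq by simp
  next
    case 3 then show ?thesis using h(3) \<open>n1 = 2\<close> \<open>n2 = 3\<close> s1 s2 eq by simp
  qed
qed

section \<open>Classification of the orbit patterns\<close>

context fix_action
begin

text \<open>The pattern of a rotation group with poles of orders 2, 3 and \<open>r\<close> when no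
  nontrivial unipotent elements occur.\<close>

definition polyhedral :: "nat \<Rightarrow> nat \<Rightarrow> bool" where
  "polyhedral r h \<longleftrightarrow> card (carrier G) = h \<and> (\<forall>y. card (Unip y) = 1) \<and>
     (\<exists>x1 x2 x3. card (Stab x1) = 2 \<and> card (Stab x2) = 3 \<and> card (Stab x3) = r \<and>
        Poles = Orb x1 \<union> Orb x2 \<union> Orb x3)"

text \<open>In characteristic three, \<open>A\<^sub>5\<close> has point stabilisers isomorphic to \<open>S\<^sub>3\<close>.\<close>

definition icosahedral3 :: bool where
  "icosahedral3 \<longleftrightarrow> card (carrier G) = 60 \<and>
     (\<exists>x1 x2. card (Stab x1) = 6 \<and> card (Unip x1) = 3 \<and> card (Stab x2) = 5 \<and>
        Poles = Orb x1 \<union> Orb x2)"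

text \<open>
  With \<open>m\<close> the order of \<open>Unip x\<close> and \<open>k\<close> its index in \<open>Stab x\<close>, the last condition reads
  \<open>m \<le> 2 k + 1\<close>; it covers both \<open>PSL\<^sub>2(m)\<close> and \<open>PGL\<^sub>2(m)\<close>.
\<close>

definition linear_type :: "'x \<Rightarrow> bool" where
  "linear_type x \<longleftrightarrow> card (Unip x) \<ge> 3 \<and> card (Orb x) = card (Unip x) + 1 \<and>
     card (Unip x) * card (Unip x) \<le> 2 * card (Stab x) + card (Unip x)"

text \<open>The term \<open>2 * card (Orb x)\<close> on the left avoids subtraction on natural
  numbers.\<close>

lemma weight:
  "card (Orb x) * val x + 2 * card (Orb x) = card (carrier G) + card (Orb x) * card (Unip x)"
proof -
  have "val x + 2 = card (Stab x) + card (Unip x)"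
    using card_Stab_pos[of x] card_Unip_pos[of x] by (simp add: val_def)
  then have "card (Orb x) * (val x + 2) = card (Orb x) * (card (Stab x) + card (Unip x))" by simp
  then show ?thesis using orbit_stab[of x] by (simp add: algebra_simps)
qed

text \<open>The total weight is below \<open>2 * card (carrier G)\<close>, so four orbits of poles
  cannot occur. Together with \<open>weight_unip\<close>, which gives more than the full group
  order, it leaves room for only one further orbit beside one with unipotents.\<close>

lemma weight_pole:
  assumes "x \<in> Poles"
  shows "card (carrier G) \<le> 2 * (card (Orb x) * val x)"
proof -
  have "card (Stab x) \<ge> 2" using assms by (simp add: Poles_def)
  then have "card (Orb x) * 2 \<le> card (Orb x) * card (Stab x)" by (rule mult_left_mono) simp
  moreover have "card (Orb x) * 1 \<le> card (Orb x) * card (Unip x)"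
    using card_Unip_pos[of x] by (intro mult_left_mono) auto
  ultimately show ?thesis using weight[of x] orbit_stab[of x] by linarith
qed

lemma weight_unip:
  assumes "card (Unip x) \<noteq> 1"
  shows "card (carrier G) < card (Orb x) * val x"
proof -
  have "card (Unip x) \<ge> 3" using assms card_Unip_pos[of x] card_Unip_neq_2[of x] by linarith
  then have "card (Orb x) * 3 \<le> card (Orb x) * card (Unip x)" by (rule mult_left_mono) simp
  moreover have "card (Orb x) > 0" using finite_Orb Orb_refl by (metis card_gt_0_iff empty_iff)
  ultimately show ?thesis using weight[of x] by linarith
qed

theorem orbit_cases:
  assumes prim: "\<And>x. card (Orb x) > 2"
  shows "polyhedral 3 12 \<or> polyhedral 4 24 \<or> polyhedral 5 60 \<or> icosahedral3 \<or> (\<exists>x. linear_type x)"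
proof -
  define h where "h = card (carrier G)"
  have total: "(\<Sum>x\<in>Poles. val x) = 2 * (h - 1)" using sum_val_Poles by (simp add: h_def)
  have hpos: "h > 2"
  proof -
    obtain x :: 'x where True by simp
    have "card (Orb x) \<le> h" unfolding Orb_def h_def by (rule card_image_le[OF fin])
    then show ?thesis using prim[of x] by linarith
  qed
  \<comment> \<open>Sets closed under orbits, so that orbits can be split off the sum one after
    another from what remains.\<close>
  define iv where "iv A \<longleftrightarrow> (\<forall>y\<in>A. Orb y \<subseteq> A)" for A
  have iv: "iv {}" "\<And>a. iv (Orb a)" "\<And>A B. iv A \<Longrightarrow> iv B \<Longrightarrow> iv (A \<union> B)"
    unfolding iv_def using Orb_trans by blast+
  have peel: "(\<Sum>y\<in>Poles - A. val y) = card (Orb x) * val x + (\<Sum>y\<in>Poles - (A \<union> Orb x). val y)"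
    if "x \<in> Poles" "x \<notin> A" "iv A" for x A
  proof -
    have "Orb x \<subseteq> Poles - A"
      using that Poles_Orb[OF that(1)] Orb_sym unfolding iv_def by blast
    moreover have "Poles - (A \<union> Orb x) = Poles - A - Orb x" by blast
    ultimately show ?thesis using sum_val_peel[of "Poles - A" x] finite_Poles that by simp
  qed
  show ?thesis
  proof (cases "\<exists>x. card (Unip x) \<noteq> 1")
    case True
    then obtain x where x: "card (Unip x) \<noteq> 1" by blast
    define m s where "m = card (Unip x)" "s = card (Orb x)"
    note md = m_s_def
    have m3: "m \<ge> 3" using x card_Unip_pos[of x] card_Unip_neq_2[of x] md by linarith
    obtain k where k: "card (Stab x) = m * k" using Unip_dvd_Stab[of x] md by auto
    have k1: "1 \<le> k" using k card_Stab_pos[of x] by (cases k) auto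
    have "m * k \<le> m * (m - 1)" using card_Stab_le[OF x] k md by simp
    then have km: "k \<le> m - 1" using m3 by simp
    have xP: "x \<in> Poles"
    proof -
      have "m * 1 \<le> m * k" using k1 by (intro mult_left_mono) auto
      then have "card (Stab x) > 1" using k m3 by linarith
      then show ?thesis by (simp add: Poles_def)
    qed
    obtain f where "s - 1 = m * f" using Unip_dvd_Orb[of x] md by auto
    then have f: "s = 1 + m * f" using prim[of x] md by simp
    have f1: "f \<ge> 1" using f prim[of x] md by (cases f) auto
    have sh: "s * (m * k) = h" using orbit_stab[of x] k md h_def by simp
    have vx: "val x = m * k + m - 2" using k md by (simp add: val_def)
    have W1: "h < s * val x" using weight_unip[OF x] h_def md by simp
    have t1: "2 * (h - 1) = s * val x + (\<Sum>y\<in>Poles - Orb x. val y)"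
      using peel[OF xP _ iv(1)] total md by simp
    \<comment> \<open>With a single orbit the count becomes
      \<open>s * (m * k + 2) = s * m + 2\<close>, so \<open>s\<close> divides 2, against
      \<open>s > 2\<close>.\<close>
    obtain y where y: "y \<in> Poles" "y \<notin> Orb x"
    proof (rule ccontr)
      assume "\<not> thesis"
      then have e: "Poles - Orb x = {}" using that by blast
      have "2 * (h - 1) = s * val x" using t1 unfolding e by simp
      moreover have "s * val x + 2 * s = h + s * m" using weight[of x] md h_def by simp
      ultimately have "h + 2 * s = s * m + 2" using hpos by linarith
      then have "s * (m * k + 2) = s * m + 2" using sh by (simp add: algebra_simps)
      then have "s dvd s * m + 2" by (metis dvd_triv_left)
      then have "s dvd 2" by (metis dvd_add_right_iff dvd_triv_left)
      then show False using prim[of x] md by (auto dest: dvd_imp_le)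
    qed
    define n s2 where "n = card (Stab y)" "s2 = card (Orb y)"
    note nd = n_s2_def
    have t2: "2 * (h - 1) = s * val x + s2 * val y + (\<Sum>z\<in>Poles - (Orb x \<union> Orb y). val z)"
      using peel[OF y iv(2)] t1 nd by simp
    \<comment> \<open>Two orbits with unipotents would each weigh more than
      \<open>h\<close>.\<close>
    have "card (Unip y) = 1"
      using weight_unip[of y] t2 W1 h_def nd by (cases "card (Unip y) = 1") auto
    then have vy: "val y = n - 1" using nd card_Stab_pos[of y] by (simp add: val_def)
    have W2: "h \<le> 2 * (s2 * val y)" using weight_pole[OF y(1)] nd h_def by simp
    \<comment> \<open>A third orbit would bring the weight above
      \<open>h + h/2 + h/2\<close>.\<close>
    have PO: "Poles = Orb x \<union> Orb y"
    proof (rule ccontr)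
      assume "Poles \<noteq> Orb x \<union> Orb y"
      then obtain z where z: "z \<in> Poles" "z \<notin> Orb x \<union> Orb y"
        using Poles_Orb[OF xP] Poles_Orb[OF y(1)] by blast
      have "2 * (h - 1) = s * val x + s2 * val y + (card (Orb z) * val z + (\<Sum>w\<in>Poles - (Orb x \<union> Orb y \<union> Orb z). val w))"
        using peel[OF z iv(3)[OF iv(2) iv(2)]] t2 by simp
      then show False using W1 W2 weight_pole[OF z(1)] h_def hpos by linarith
    qed
    then have "s * (m * k + m - 2) + s2 * (n - 1) = 2 * (h - 1)" using t2 vx vy by simp
    moreover have "s2 * n = h" using orbit_stab[of y] nd h_def by simp
    moreover have "n \<ge> 2" using y nd by (simp add: Poles_def)
    ultimately have "(f = 1 \<and> m \<le> 2 * k + 1) \<or> (m = 3 \<and> k = 2 \<and> n = 5 \<and> h = 60)"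
      using two_orbit_arith[OF m3 k1 km sh _ f f1] by blast
    then show ?thesis
    proof
      assume a: "f = 1 \<and> m \<le> 2 * k + 1"
      then have "m * m \<le> m * (2 * k + 1)" by (intro mult_left_mono) auto
      then have "linear_type x" unfolding linear_type_def using a f m3 k md by (simp add: algebra_simps)
      then show ?thesis by blast
    next
      assume "m = 3 \<and> k = 2 \<and> n = 5 \<and> h = 60"
      then have icosahedral3 unfolding icosahedral3_def using PO k md nd h_def by auto
      then show ?thesis by blast
    qed
  next
    case False
    then have U: "card (Unip x) = 1" for x by blast
    have W: "card (Orb x) * val x + card (Orb x) = h" for x using weight[of x] U h_def by simp
    have "Poles \<noteq> {}" using total hpos by auto
    then obtain x where x: "x \<in> Poles" by blast
    have t1: "2 * (h - 1) = card (Orb x) * val x + (\<Sum>y\<in>Poles - Orb x. val y)"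
      using peel[OF x _ iv(1)] total by simp
    have "Poles - Orb x \<noteq> {}"
    proof
      assume e: "Poles - Orb x = {}"
      have "2 * (h - 1) = card (Orb x) * val x" using t1 unfolding e by simp
      then show False using W[of x] hpos by linarith
    qed
    then obtain y where y: "y \<in> Poles" "y \<notin> Orb x" by blast
    have t2: "2 * (h - 1) = card (Orb x) * val x + card (Orb y) * val y + (\<Sum>z\<in>Poles - (Orb x \<union> Orb y). val z)"
      using peel[OF y iv(2)] t1 by simp
    \<comment> \<open>Without unipotents an orbit weighs \<open>h\<close> minus its length, so two
      orbits alone would have lengths adding up to 2.\<close>
    have "Poles - (Orb x \<union> Orb y) \<noteq> {}"
    proof
      assume e: "Poles - (Orb x \<union> Orb y) = {}"
      have "2 * (h - 1) = card (Orb x) * val x + card (Orb y) * val y"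
        using t2 unfolding e by simp
      then show False using W[of x] W[of y] prim[of x] prim[of y] hpos by linarith
    qed
    then obtain z where z: "z \<in> Poles" "z \<notin> Orb x \<union> Orb y" by blast
    have t3: "2 * (h - 1) = card (Orb x) * val x + card (Orb y) * val y + (card (Orb z) * val z + (\<Sum>w\<in>Poles - (Orb x \<union> Orb y \<union> Orb z). val w))"
      using peel[OF z iv(3)[OF iv(2) iv(2)]] t2 by simp
    \<comment> \<open>Four orbits of weight at least \<open>h/2\<close> exceed the total
      \<open>2 * (h - 1)\<close>.\<close>
    have PO: "Poles = Orb x \<union> Orb y \<union> Orb z"
    proof (rule ccontr)
      assume "Poles \<noteq> Orb x \<union> Orb y \<union> Orb z"
      moreover have "Orb x \<union> Orb y \<union> Orb z \<subseteq> Poles"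
        using Poles_Orb[OF x] Poles_Orb[OF y(1)] Poles_Orb[OF z(1)] by simp
      ultimately obtain w where w: "w \<in> Poles" "w \<notin> Orb x \<union> Orb y \<union> Orb z" by blast
      have "(\<Sum>w\<in>Poles - (Orb x \<union> Orb y \<union> Orb z). val w) \<ge> card (Orb w) * val w"
        using peel[OF w iv(3)[OF iv(3)[OF iv(2) iv(2)] iv(2)]] by simp
      then show False
        using t3 weight_pole[OF x] weight_pole[OF y(1)] weight_pole[OF z(1)] weight_pole[OF w(1)] h_def hpos
        by linarith
    qed
    then have "2 * (h - 1) = card (Orb x) * val x + card (Orb y) * val y + card (Orb z) * val z"
      using t3 by simp
    then have eq: "card (Orb x) + card (Orb y) + card (Orb z) = h + 2"
      using W[of x] W[of y] W[of z] hpos by linarith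
    have n2: "card (Stab v) \<ge> 2" if "v \<in> Poles" for v using that by (simp add: Poles_def)
    have oh: "card (Orb v) * card (Stab v) = h" for v using orbit_stab h_def by simp
    \<comment> \<open>The arithmetic wants the stabiliser orders sorted; the six orderings of
      \<open>x\<close>, \<open>y\<close>, \<open>z\<close> are then instances of this fact.\<close>
    have fin: ?thesis if v: "v1 \<in> Poles" "card (Stab v1) \<le> card (Stab v2)" "card (Stab v2) \<le> card (Stab v3)"
      "card (Orb v1) + card (Orb v2) + card (Orb v3) = h + 2" "Poles = Orb v1 \<union> Orb v2 \<union> Orb v3" for v1 v2 v3
    proof -
      note * = three_orbit_arith[OF oh oh oh prim prim prim n2[OF v(1)] v(2,3,4)]
      have "polyhedral (card (Stab v3)) h" unfolding polyhedral_def
        by (intro conjI exI[of _ v1] exI[of _ v2] exI[of _ v3] allI)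
          (simp_all add: * U h_def v(5)[symmetric])
      then show ?thesis using * by auto
    qed
    consider "card (Stab x) \<le> card (Stab y)" "card (Stab y) \<le> card (Stab z)"
      | "card (Stab x) \<le> card (Stab z)" "card (Stab z) \<le> card (Stab y)"
      | "card (Stab y) \<le> card (Stab x)" "card (Stab x) \<le> card (Stab z)"
      | "card (Stab y) \<le> card (Stab z)" "card (Stab z) \<le> card (Stab x)"
      | "card (Stab z) \<le> card (Stab x)" "card (Stab x) \<le> card (Stab y)"
      | "card (Stab z) \<le> card (Stab y)" "card (Stab y) \<le> card (Stab x)" by linarith
    then show ?thesis
    proof cases
      case 1 then show ?thesis using fin[of x y z] x eq PO by (simp add: ac_simps)
    next
      case 2 then show ?thesis using fin[of x z y] x eq PO by (simp add: ac_simps)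
    next
      case 3 then show ?thesis using fin[of y x z] y eq PO by (simp add: ac_simps)
    next
      case 4 then show ?thesis using fin[of y z x] y eq PO by (simp add: ac_simps)
    next
      case 5 then show ?thesis using fin[of z x y] z eq PO by (simp add: ac_simps)
    next
      case 6 then show ?thesis using fin[of z y x] z eq PO by (simp add: ac_simps)
    qed
  qed
qed

end

section \<open>Recognising the symmetric and alternating groups\<close>

lemma (in group) perm_rep_exists:
  fixes \<alpha> :: "'a \<Rightarrow> 'y \<Rightarrow> 'y"
  assumes fin: "finite \<Omega>" "card \<Omega> = n"
    and closed: "\<And>g e. g \<in> carrier G \<Longrightarrow> e \<in> \<Omega> \<Longrightarrow> \<alpha> g e \<in> \<Omega>"
    and mult: "\<And>g h e. g \<in> carrier G \<Longrightarrow> h \<in> carrier G \<Longrightarrow> e \<in> \<Omega> \<Longrightarrow> \<alpha> (g \<otimes> h) e = \<alpha> g (\<alpha> h e)"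
    and one: "\<And>e. e \<in> \<Omega> \<Longrightarrow> \<alpha> \<one> e = e"
    and faithful: "\<And>g. g \<in> carrier G \<Longrightarrow> (\<And>e. e \<in> \<Omega> \<Longrightarrow> \<alpha> g e = e) \<Longrightarrow> g = \<one>"
  shows "\<exists>\<phi> \<in> hom G (sym_group n). inj_on \<phi> (carrier G)"
proof -
  obtain b where b: "bij_betw b {1..n} \<Omega>"
    using ex_bij_betw_nat_finite_1[OF fin(1)] fin(2) by auto
  define c where "c = inv_into {1..n} b"
  have c: "bij_betw c \<Omega> {1..n}" unfolding c_def by (rule bij_betw_inv_into[OF b])
  have cb: "c (b i) = i" if "i \<in> {1..n}" for i
    using b that by (simp add: c_def bij_betw_inv_into_left)
  have bc: "b (c e) = e" if "e \<in> \<Omega>" for e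
    using b that by (simp add: c_def bij_betw_inv_into_right)
  have b\<Omega>: "b i \<in> \<Omega>" if "i \<in> {1..n}" for i using b that by (auto simp: bij_betw_def)
  have cn: "c e \<in> {1..n}" if "e \<in> \<Omega>" for e using c that by (auto simp: bij_betw_def)
  \<comment> \<open>Elements of \<open>sym_group n\<close> are permutations of all naturals
    supported on \<open>{1..n}\<close>, hence the identity elsewhere.\<close>
  define \<phi> where "\<phi> g = (\<lambda>i. if i \<in> {1..n} then c (\<alpha> g (b i)) else i)" for g
  have inv1: "\<alpha> (inv g) (\<alpha> g e) = e" if "g \<in> carrier G" "e \<in> \<Omega>" for g e
    using that by (simp flip: mult add: one)
  have perm: "\<phi> g permutes {1..n}" if g: "g \<in> carrier G" for g
  proof (rule bij_imp_permutes)
    have maps: "\<phi> g ` {1..n} \<subseteq> {1..n}" using g closed b\<Omega> cn by (auto simp: \<phi>_def)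
    have "inj_on (\<phi> g) {1..n}"
    proof (rule inj_onI)
      fix i j assume ij: "i \<in> {1..n}" "j \<in> {1..n}" "\<phi> g i = \<phi> g j"
      then have "c (\<alpha> g (b i)) = c (\<alpha> g (b j))" by (simp add: \<phi>_def)
      then have "\<alpha> g (b i) = \<alpha> g (b j)" using bc closed g b\<Omega> ij by metis
      then have "b i = b j" using inv1 g b\<Omega> ij by metis
      then show "i = j" using cb ij by metis
    qed
    then show "bij_betw (\<phi> g) {1..n} {1..n}" using maps by (simp add: bij_betw_def endo_inj_surj)
  qed (auto simp: \<phi>_def)
  have "\<phi> (g \<otimes> h) = \<phi> g \<circ> \<phi> h" if "g \<in> carrier G" "h \<in> carrier G" for g h
  proof
    fix i
    show "\<phi> (g \<otimes> h) i = (\<phi> g \<circ> \<phi> h) i"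
    proof (cases "i \<in> {1..n}")
      case True
      then have "\<phi> h i \<in> {1..n}" "b (\<phi> h i) = \<alpha> h (b i)"
        using cn bc closed b\<Omega> that by (simp_all add: \<phi>_def)
      then have "\<phi> g (\<phi> h i) = c (\<alpha> g (\<alpha> h (b i)))" unfolding \<phi>_def[of g] by simp
      then show ?thesis using True mult b\<Omega> that by (simp add: \<phi>_def)
    next
      case False then show ?thesis unfolding \<phi>_def by (simp only: comp_def if_False if_not_P)
    qed
  qed
  then have hom: "\<phi> \<in> hom G (sym_group n)"
    using perm by (auto simp: hom_def sym_group_carrier sym_group_mult)
  moreover have "inj_on \<phi> (carrier G)"
  proof (rule inj_onI)
    fix g h assume gh: "g \<in> carrier G" "h \<in> carrier G" "\<phi> g = \<phi> h"
    have "\<alpha> (inv h \<otimes> g) e = e" if e: "e \<in> \<Omega>" for e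
    proof -
      have "\<phi> g (c e) = \<phi> h (c e)" using gh by simp
      then have "c (\<alpha> g e) = c (\<alpha> h e)" using cn[OF e] bc[OF e] by (simp add: \<phi>_def)
      then have "\<alpha> g e = \<alpha> h e" using bc closed gh e by metis
      then show ?thesis using mult inv1 gh e by simp
    qed
    then have "inv h \<otimes> g = \<one>" using faithful gh by simp
    then show "g = h" using gh by (metis inv_closed inv_equality inv_inv)
  qed
  ultimately show ?thesis by blast
qed

section \<open>Involutions\<close>

context group
begin

definition invol :: "'a \<Rightarrow> bool" where
  "invol w \<longleftrightarrow> w \<in> carrier G \<and> w \<noteq> \<one> \<and> w \<otimes> w = \<one>"

lemma invol_inv: "invol w \<Longrightarrow> inv w = w"
  by (simp add: invol_def inv_equality)

lemma invol_cnj: "invol w \<Longrightarrow> g \<in> carrier G \<Longrightarrow> invol (cnj g w)"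
  by (simp add: invol_def cnj_eq_one_iff flip: cnj_mult)

lemma invol_mult:
  assumes "invol v" "invol w" "v \<noteq> w" "v \<otimes> w = w \<otimes> v"
  shows "invol (v \<otimes> w)"
proof -
  have c: "v \<in> carrier G" "w \<in> carrier G" "v \<otimes> v = \<one>" "w \<otimes> w = \<one>" using assms by (auto simp: invol_def)
  have "(v \<otimes> w) \<otimes> (v \<otimes> w) = v \<otimes> (w \<otimes> v) \<otimes> w" using c by (simp add: m_assoc)
  also have "\<dots> = (v \<otimes> v) \<otimes> (w \<otimes> w)" using c assms(4)[symmetric] by (simp add: m_assoc)
  finally have "(v \<otimes> w) \<otimes> (v \<otimes> w) = \<one>" using c by simp
  moreover have "v \<otimes> w \<noteq> \<one>" using c assms(3) by (metis inv_equality invol_inv assms(2))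
  ultimately show ?thesis using c by (simp add: invol_def)
qed

lemma no_invol_in_odd_subgroup:
  assumes "subgroup K G" "finite K" "odd (card K)" "w \<in> K" "w \<otimes> w = \<one>"
  shows "w = \<one>"
proof (rule ccontr)
  assume w: "w \<noteq> \<one>"
  have wG: "w \<in> carrier G" using assms subgroup.mem_carrier by metis
  have sub: "subgroup {\<one>, w} G"
    using wG assms(5) by (intro subgroupI) (auto simp: inv_equality)
  have "{\<one>, w} \<subseteq> K" using assms subgroup.one_closed by auto
  then have "card {\<one>, w} dvd card K" using card_subgroup_dvd sub assms(1) by blast
  moreover have "card {\<one>, w} = 2" using w by simp
  ultimately show False using assms(3) by simp
qed

end

section \<open>Polyhedral groups identified by their poles\<close>

context fix_action
begin

lemma card_Fix_invol: "invol w \<Longrightarrow> card (Fix w) = 2"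
  using invol_fix by (simp add: invol_def Fix_def)

lemma fixed_Poles: "g \<in> carrier G \<Longrightarrow> g \<noteq> \<one> \<Longrightarrow> x \<in> Fix g \<Longrightarrow> x \<in> Poles"
  using Poles_iff by blast

lemma even_Stab_of_invol:
  assumes "invol w" "x \<in> Fix w"
  shows "even (card (Stab x))"
proof (rule ccontr)
  assume "odd (card (Stab x))"
  then show False
    using no_invol_in_odd_subgroup[OF subgroup_Stab finite_Stab, of x w] assms
    by (auto simp: invol_def Fix_def Stab_def)
qed

text \<open>The tetrahedral group has too few involutions. Their fixed points lie in the orbit with
  stabilisers of order 2, which has six points, and distinct involutions have disjoint pairs;
  \<open>r0\<close>, \<open>r1\<close>, \<open>r2\<close> and \<open>r0 \<otimes> r2\<close> would
  need eight.\<close>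

lemma not_polyhedral_3:
  assumes p: "polyhedral 3 12" and r: "invol r0" "invol r1" "invol r2" "r0 \<otimes> r2 = r2 \<otimes> r0"
    "r0 \<noteq> r2" "r1 \<noteq> r0" "r1 \<noteq> r2" "r1 \<noteq> r0 \<otimes> r2"
  shows False
proof -
  obtain x1 x2 x3 where x: "card (Stab x1) = 2" "card (Stab x2) = 3" "card (Stab x3) = 3"
    "Poles = Orb x1 \<union> Orb x2 \<union> Orb x3" and h: "card (carrier G) = 12"
    using p unfolding polyhedral_def by blast
  have FO: "Fix w \<subseteq> Orb x1" if "invol w" for w
  proof
    fix y assume y: "y \<in> Fix w"
    then have "y \<in> Poles" using that fixed_Poles by (auto simp: invol_def)
    moreover have "even (card (Stab y))" using even_Stab_of_invol that y by blast
    ultimately show "y \<in> Orb x1" using x card_Stab_Orb by fastforce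
  qed
  have disj: "Fix v \<inter> Fix w = {}" if "invol v" "invol w" "v \<noteq> w" for v w
  proof (rule ccontr)
    assume "Fix v \<inter> Fix w \<noteq> {}"
    then obtain y where y: "y \<in> Fix v" "y \<in> Fix w" by blast
    have "{\<one>, v, w} \<subseteq> Stab y" using y that by (auto simp: invol_def Stab_def Fix_def)
    then have "card {\<one>, v, w} \<le> card (Stab y)" by (intro card_mono finite_Stab)
    moreover have "card {\<one>, v, w} = 3" using that by (auto simp: invol_def)
    moreover have "card (Stab y) = 2" using FO[OF that(1)] y x card_Stab_Orb by auto
    ultimately show False by simp
  qed
  have "invol (r0 \<otimes> r2)" using invol_mult r by blast
  moreover have "r0 \<otimes> r2 \<noteq> r0" "r0 \<otimes> r2 \<noteq> r2" using r by (auto simp: invol_def)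
  ultimately have S: "\<And>w. w \<in> {r0, r1, r2, r0 \<otimes> r2} \<Longrightarrow> invol w" "card {r0, r1, r2, r0 \<otimes> r2} = 4"
    using r by auto
  have "card (\<Union>w\<in>{r0, r1, r2, r0 \<otimes> r2}. Fix w) = (\<Sum>w\<in>{r0, r1, r2, r0 \<otimes> r2}. card (Fix w))"
  proof (rule card_UN_disjoint)
    show "\<forall>i\<in>{r0, r1, r2, r0 \<otimes> r2}. finite (Fix i)" using S(1) finite_Fix by (metis invol_def)
    show "\<forall>i\<in>{r0, r1, r2, r0 \<otimes> r2}. \<forall>j\<in>{r0, r1, r2, r0 \<otimes> r2}. i \<noteq> j \<longrightarrow> Fix i \<inter> Fix j = {}"
      using S(1) disj by blast
  qed simp
  also have "\<dots> = (\<Sum>w\<in>{r0, r1, r2, r0 \<otimes> r2}. 2)" using S(1) card_Fix_invol by (intro sum.cong) auto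
  also have "\<dots> = 8" using S(2) by simp
  finally have "card (\<Union>w\<in>{r0, r1, r2, r0 \<otimes> r2}. Fix w) = 8" .
  moreover have "card (\<Union>w\<in>{r0, r1, r2, r0 \<otimes> r2}. Fix w) \<le> card (Orb x1)"
    using FO S(1) by (intro card_mono finite_Orb) blast
  moreover have "card (Orb x1) = 6" using orbit_stab[of x1] x h by simp
  ultimately show False by simp
qed

text \<open>The two fixed points of an invariant involution would form an invariant set, hence
  contain an orbit of length at most two.\<close>

lemma no_normal_invol:
  assumes prim: "\<And>x. card (Orb x) > 2" and g: "invol g" and n: "\<And>h. h \<in> carrier G \<Longrightarrow> cnj h g = g"
  shows False
proof -
  obtain x where x: "x \<in> Fix g" using card_Fix_invol[OF g] by fastforce
  have "act h x \<in> Fix g" if "h \<in> carrier G" for h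
    using Fix_cnj[of h g] n[OF that] that x g by (auto simp: invol_def)
  then have "Orb x \<subseteq> Fix g" by (auto simp: Orb_def)
  then have "card (Orb x) \<le> card (Fix g)" using g finite_Fix by (intro card_mono) (auto simp: invol_def)
  then show False using prim[of x] card_Fix_invol[OF g] by simp
qed

lemma iso_of_inj_hom:
  assumes "\<phi> \<in> hom G K" "inj_on \<phi> (carrier G)" "finite (carrier K)" "card (carrier G) = card (carrier K)"
  shows "G \<cong> K"
proof -
  have sub: "\<phi> ` carrier G \<subseteq> carrier K" using assms(1) by (auto simp: hom_def)
  then have "\<phi> ` carrier G = carrier K"
    using assms by (intro card_subset_eq) (auto simp: card_image)
  then show ?thesis using assms by (intro is_isoI) (auto simp: iso_def bij_betw_def)
qed

text \<open>The model is the rotation group of the cube acting on its four long diagonals. The eight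
  vertices are the points with stabiliser of order 3, and opposite vertices share their stabiliser.
  A nontrivial element of the kernel would be the only one, hence an invariant involution.\<close>

theorem iso_sym_4:
  assumes p: "polyhedral 4 24" and prim: "\<And>x. card (Orb x) > 2"
  shows "G \<cong> sym_group 4"
proof -
  obtain x1 x2 x3 where x: "card (Stab x1) = 2" "card (Stab x2) = 3" "card (Stab x3) = 4"
    "Poles = Orb x1 \<union> Orb x2 \<union> Orb x3" and h: "card (carrier G) = 24" and U: "\<And>y. card (Unip y) = 1"
    using p unfolding polyhedral_def by blast
  \<comment> \<open>The pair of opposite vertices through \<open>y\<close>.\<close>
  define pr where "pr y = {z. Stab z = Stab y}" for y
  define \<Omega> where "\<Omega> = pr ` Orb x2"
  have O: "y \<in> Orb x2 \<longleftrightarrow> card (Stab y) = 3" for y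
  proof
    assume "card (Stab y) = 3"
    then have "y \<in> Poles" by (simp add: Poles_def)
    then show "y \<in> Orb x2" using x \<open>card (Stab y) = 3\<close> card_Stab_Orb by fastforce
  qed (use x card_Stab_Orb in auto)
  have Fix_pr: "Fix t = pr y" if y: "y \<in> Orb x2" and t: "t \<in> Stab y" "t \<noteq> \<one>" for y t
  proof (intro equalityI subsetI)
    have tG: "t \<in> carrier G" using t by (simp add: Stab_def)
    fix z assume z: "z \<in> Fix t"
    then have tz: "t \<in> Stab z" using tG by (simp add: Stab_def Fix_def)
    have zP: "z \<in> Poles" using fixed_Poles tG t z by blast
    have y3: "card (Stab y) = 3" using O y by simp
    \<comment> \<open>Its order divides 3 and is at least 2, so it is 3, and both stabilisers
      coincide with it because orders 2 and 4 are not divisible by 3.\<close>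
    define A where "A = Stab y \<inter> Stab z"
    have sA: "subgroup A G" unfolding A_def by (rule subgroups_Inter_pair[OF subgroup_Stab subgroup_Stab])
    have dvd: "card A dvd card (Stab y)" "card A dvd card (Stab z)"
      using card_subgroup_dvd[OF sA subgroup_Stab] by (auto simp: A_def)
    have "card {\<one>, t} \<le> card A"
      using t tz finite_Stab subgroup.one_closed[OF sA] by (intro card_mono) (auto simp: A_def)
    then have "card A \<ge> 2" using t by auto
    moreover have "card A dvd 3" using dvd y3 by simp
    then have "card A \<le> 3" "card A \<noteq> 2" by (auto dest: dvd_imp_le)
    ultimately have A3: "card A = 3" by linarith
    then have Ay: "A = Stab y" using y3 by (intro card_subset_eq finite_Stab) (auto simp: A_def)
    have "3 dvd card (Stab z)" using dvd A3 by simp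
    then have "card (Stab z) = 3" using zP x card_Stab_Orb by fastforce
    then have "A = Stab z" using A3 by (intro card_subset_eq finite_Stab) (auto simp: A_def)
    then show "z \<in> pr y" using Ay by (simp add: pr_def)
  next
    fix z assume "z \<in> pr y"
    then have "t \<in> Stab z" using t by (simp add: pr_def)
    then show "z \<in> Fix t" by (simp add: Stab_def Fix_def)
  qed
  have pr2: "card (pr y) = 2" if y: "y \<in> Orb x2" for y
  proof -
    have "card (Stab y) = 3" using O y by simp
    then have "\<not> Stab y \<subseteq> {\<one>}" by (metis One_nat_def card_mono finite.emptyI finite_insert is_singletonI is_singleton_altdef numeral_le_one_iff semiring_norm(70))
    then obtain t where t: "t \<in> Stab y" "t \<noteq> \<one>" by blast
    have tG: "t \<in> carrier G" using t by (simp add: Stab_def)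
    have "card (Fix t) \<noteq> 1"
    proof
      assume "card (Fix t) = 1"
      then have "{\<one>, t} \<subseteq> Unip y" using t subgroup.one_closed[OF subgroup_Unip, of y] by (auto simp: Unip_def)
      then have "card {\<one>, t} \<le> card (Unip y)" by (intro card_mono finite_Unip)
      then show False using t U[of y] by simp
    qed
    then show ?thesis using card_Fix[OF tG t(2)] Fix_pr[OF y t] by simp
  qed
  have pr_self: "y \<in> pr y" for y by (simp add: pr_def)
  have pr_sub: "pr y \<subseteq> Orb x2" if "y \<in> Orb x2" for y using that O by (auto simp: pr_def)
  have card\<Omega>: "card \<Omega> = 4"
  proof -
    have "\<Union> \<Omega> = Orb x2" using pr_self pr_sub by (auto simp: \<Omega>_def)
    moreover have "2 * card \<Omega> = card (\<Union> \<Omega>)"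
    proof (rule card_partition)
      show "finite \<Omega>" by (simp add: \<Omega>_def finite_Orb)
      show "finite (\<Union> \<Omega>)" using calculation finite_Orb by simp
      show "\<And>c. c \<in> \<Omega> \<Longrightarrow> card c = 2" using pr2 by (auto simp: \<Omega>_def)
      show "\<And>c1 c2. c1 \<in> \<Omega> \<Longrightarrow> c2 \<in> \<Omega> \<Longrightarrow> c1 \<noteq> c2 \<Longrightarrow> c1 \<inter> c2 = {}"
        by (auto simp: \<Omega>_def pr_def)
    qed
    moreover have "card (Orb x2) = 8" using orbit_stab[of x2] x h by simp
    ultimately show ?thesis by simp
  qed
  have act_pr: "act g ` pr y = pr (act g y)" if g: "g \<in> carrier G" for g y
  proof -
    have *: "act k ` pr y \<subseteq> pr (act k y)" if "k \<in> carrier G" for k y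
      using that by (auto simp: pr_def Stab_act)
    have "pr (act g y) \<subseteq> act g ` pr y"
    proof
      fix z assume "z \<in> pr (act g y)"
      then have "act (inv g) z \<in> pr (act (inv g) (act g y))" using * g by blast
      then have "act (inv g) z \<in> pr y" using g by simp
      then show "z \<in> act g ` pr y" using g by (intro image_eqI[of _ _ "act (inv g) z"]) auto
    qed
    then show ?thesis using * g by blast
  qed
  define K where "K = {g \<in> carrier G. \<forall>A\<in>\<Omega>. act g ` A = A}"
  have Kpr: "act g y \<in> pr y" if "g \<in> K" "y \<in> Orb x2" for g y
    using that pr_self by (auto simp: K_def \<Omega>_def)
  have two: "z = act g y" if a: "g \<in> K" "y \<in> Orb x2" "act g y \<noteq> y" "z \<in> pr y" "z \<noteq> y" for g y z
  proof -
    obtain c d where "pr y = {c, d}" using pr2[OF a(2)] by (auto simp: card_2_iff)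
    then show ?thesis using pr_self[of y] Kpr[OF a(1,2)] a(3-5) by auto
  qed
  have fix_all: "g = \<one>" if g: "g \<in> carrier G" "\<And>y. y \<in> Orb x2 \<Longrightarrow> act g y = y" for g
  proof (rule ccontr)
    assume "g \<noteq> \<one>"
    then have "card (Orb x2) \<le> card (Fix g)"
      using g finite_Fix by (intro card_mono) (auto simp: Fix_def)
    moreover have "card (Orb x2) = 8" using orbit_stab[of x2] x h by simp
    moreover have "card (Fix g) \<le> 2" using card_Fix[OF g(1) \<open>g \<noteq> \<one>\<close>] by auto
    ultimately show False by simp
  qed
  have swap: "act g (act k y) = y" if gk: "g \<in> K" "k \<in> K" "y \<in> Orb x2" "act g y \<noteq> y" "act k y \<noteq> y" for g k y
  proof -
    have ky: "act k y = act g y" using two[OF gk(1,3,4) Kpr[OF gk(2,3)] gk(5)] .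
    have gG: "g \<in> carrier G" using gk by (simp add: K_def)
    have "act g (act g y) \<in> pr (act g y)" using Kpr gk gG act_Orb by blast
    moreover have "pr (act g y) = pr y" using Kpr[OF gk(1,3)] by (simp add: pr_def)
    moreover have "act g (act g y) \<noteq> act g y" using gk gG by (simp add: act_eq_iff)
    ultimately have "act g (act g y) = y" using two[OF gk(1,3,4), of "act g (act g y)"] by auto
    then show ?thesis using ky by simp
  qed
  have sq: "g \<otimes> g = \<one>" if "g \<in> K" for g
  proof -
    have gG: "g \<in> carrier G" using that by (simp add: K_def)
    have "act (g \<otimes> g) y = y" if "y \<in> Orb x2" for y
      using swap[of g g y] that \<open>g \<in> K\<close> gG by (cases "act g y = y") (auto simp: act_mult)
    then show ?thesis using fix_all gG by simp
  qed
  \<comment> \<open>Elements of the kernel square to one, and a stabiliser of order 3 contains no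
    involution.\<close>
  have move: "act g y \<noteq> y" if "g \<in> K" "g \<noteq> \<one>" "y \<in> Orb x2" for g y
  proof
    assume "act g y = y"
    then have "g \<in> Stab y" using that by (simp add: K_def Stab_def)
    moreover have "odd (card (Stab y))" using O that by simp
    ultimately show False using no_invol_in_odd_subgroup[OF subgroup_Stab finite_Stab] sq that by blast
  qed
  \<comment> \<open>Two nontrivial kernel elements both swap every pair, so their product fixes all
    eight vertices.\<close>
  have unique: "g = k" if "g \<in> K" "k \<in> K" "g \<noteq> \<one>" "k \<noteq> \<one>" for g k
  proof -
    have c: "g \<in> carrier G" "k \<in> carrier G" using that by (auto simp: K_def)
    have "act (g \<otimes> k) y = y" if "y \<in> Orb x2" for y
      using swap[of g k y] move that \<open>g \<in> K\<close> \<open>k \<in> K\<close> \<open>g \<noteq> \<one>\<close> \<open>k \<noteq> \<one>\<close> c by (simp add: act_mult)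
    then have "g \<otimes> k = \<one>" using fix_all c by simp
    then show ?thesis using c sq[OF that(2)] by (metis inv_equality)
  qed
  have im: "act (g \<otimes> h) ` A = act g ` act h ` A" if "g \<in> carrier G" "h \<in> carrier G" for g h A
    using that by (auto simp: act_mult image_iff)
  have clos: "act g ` A \<in> \<Omega>" if "g \<in> carrier G" "A \<in> \<Omega>" for g A
    using that act_pr act_Orb by (auto simp: \<Omega>_def)
  have "\<exists>\<phi> \<in> hom G (sym_group 4). inj_on \<phi> (carrier G)"
  proof (rule perm_rep_exists[where \<alpha> = "\<lambda>g A. act g ` A" and \<Omega> = \<Omega>])
    show "finite \<Omega>" by (simp add: \<Omega>_def finite_Orb)
    fix g assume g: "g \<in> carrier G" "\<And>A. A \<in> \<Omega> \<Longrightarrow> act g ` A = A"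
    show "g = \<one>"
    proof (rule ccontr)
      assume g1: "g \<noteq> \<one>"
      have gK: "g \<in> K" using g by (simp add: K_def)
      have "cnj k g = g" if k: "k \<in> carrier G" for k
      proof -
        have "act (cnj k g) ` A = A" if A: "A \<in> \<Omega>" for A
        proof -
          have "act (inv k) ` A \<in> \<Omega>" using clos k A by simp
          then have "act g ` act (inv k) ` A = act (inv k) ` A" using g by blast
          then have "act (cnj k g) ` A = act k ` act (inv k) ` A"
            using k g by (simp add: cnj_def im)
          also have "\<dots> = A" using k by (simp flip: im)
          finally show ?thesis .
        qed
        then have "cnj k g \<in> K" using k g by (simp add: K_def)
        then show ?thesis using unique gK g1 k g by (simp add: cnj_eq_one_iff)
      qed
      then show False using no_normal_invol[OF prim, of g] g g1 sq[OF gK] by (simp add: invol_def)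
    qed
  qed (use card\<Omega> clos im in auto)
  then obtain \<phi> where \<phi>: "\<phi> \<in> hom G (sym_group 4)" "inj_on \<phi> (carrier G)" by blast
  have cs: "card (carrier (sym_group 4)) = 24" by (simp add: sym_group_card_carrier fact_numeral)
  then have "finite (carrier (sym_group 4))" by (metis card.infinite zero_neq_numeral)
  then show ?thesis using iso_of_inj_hom \<phi> cs h by metis
qed

text \<open>The hypotheses cover the pattern without unipotents, where \<open>Stab x\<close> has
  order 2, and the one of characteristic three, where it has order 6. In both, the involutions are
  conjugate with centralisers of order four, so the 15 involutions fall into five four-groups.
  Conjugation permutes these five faithfully and by even permutations.\<close>

theorem iso_alt_5:
  assumes h: "card (carrier G) = 60"
    and odd: "\<And>y. y \<notin> Orb x \<Longrightarrow> odd (card (Stab y))"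
    and Sx: "card (Stab x) = 2 * card (Unip x)" "card (Unip x) \<in> {1, 3}"
    and r: "invol r0" "invol r1" "invol r2" "r0 \<otimes> r2 = r2 \<otimes> r0" "r0 \<noteq> r2"
    and gen: "generate G {r0, r1, r2} = carrier G"
  shows "G \<cong> alt_group 5"
proof -
  define I where "I = {w. invol w}"
  have IG: "I \<subseteq> carrier G" by (auto simp: I_def invol_def)
  then have finI: "finite I" using fin finite_subset by blast
  have FO: "y \<in> Orb x" if "invol w" "y \<in> Fix w" for w y
    using even_Stab_of_invol[OF that] odd by blast
  have nU: "w \<notin> Unip y" if "invol w" for w y
    using card_Fix_invol[OF that] that by (auto simp: Unip_def invol_def)
  have S2: "card (Stab y) = 2 * card (Unip y)" "card (Unip y) \<in> {1, 3}" if "y \<in> Orb x" for y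
    using that Sx card_Stab_Orb card_Unip_Orb by auto
  have cube: "u \<otimes> (u \<otimes> u) = \<one>" if "u \<in> Unip y" "y \<in> Orb x" for u y
  proof -
    have uG: "u \<in> carrier G" using that Unip_subset Stab_subset by blast
    interpret U: group "G\<lparr>carrier := Unip y\<rparr>" by (rule subgroup_imp_group[OF subgroup_Unip])
    have "u [^]\<^bsub>G\<lparr>carrier := Unip y\<rparr>\<^esub> card (Unip y) = \<one>"
      using U.pow_order_eq_1[of u] that by (simp add: Coset.order_def)
    then have "u [^] card (Unip y) = \<one>" by (metis nat_pow_consistent)
    then show ?thesis using S2(2)[OF that(2)] uG by (auto simp: numeral_3_eq_3 m_assoc)
  qed
  \<comment> \<open>Both involutions are brought to a common fixed point \<open>y'\<close>. There
    \<open>Unip y'\<close> has index two in the stabiliser, so \<open>w' = w1 \<otimes> u\<close>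
    with \<open>u\<close> unipotent. Since \<open>w1\<close> inverts \<open>u\<close> and
    \<open>u\<close> has exponent 3, conjugating \<open>w1\<close> by \<open>u\<close> gives
    \<open>w1 \<otimes> inv u \<otimes> inv u = w1 \<otimes> u\<close>.\<close>
  have conj: "\<exists>g\<in>carrier G. w' = cnj g w" if w: "invol w" and w': "invol w'" for w w'
  proof -
    obtain y y' where y: "y \<in> Fix w" "y' \<in> Fix w'"
      using Fix_nonempty w w' by (metis ex_in_conv invol_def)
    have "y' \<in> Orb y" using FO[OF w y(1)] FO[OF w' y(2)] Orb_eq by blast
    then obtain k where k: "k \<in> carrier G" "y' = act k y" by (auto simp: Orb_def)
    have wG: "w \<in> carrier G" "w' \<in> carrier G" using w w' by (auto simp: invol_def)
    define w1 where "w1 = cnj k w"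
    have w1: "invol w1" "w1 \<in> carrier G" using w k wG by (simp_all add: w1_def invol_cnj)
    have "w \<in> Stab y" using y wG by (simp add: Stab_def Fix_def)
    then have w1S: "w1 \<in> Stab y'" using Stab_act[of k y] k by (simp add: w1_def)
    have w'S: "w' \<in> Stab y'" using y wG by (simp add: Stab_def Fix_def)
    have y'O: "y' \<in> Orb x" using FO[OF w' y(2)] .
    interpret U: subgroup "Unip y'" G by (rule subgroup_Unip)
    define W where "W = (\<lambda>u. w1 \<otimes> u) ` Unip y'"
    have UG: "Unip y' \<subseteq> carrier G" using Unip_subset Stab_subset by blast
    have cW: "card W = card (Unip y')" unfolding W_def
      using UG w1 by (intro card_image) (auto simp: inj_on_def)
    have disj: "Unip y' \<inter> W = {}"
    proof (rule ccontr)
      assume "Unip y' \<inter> W \<noteq> {}"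
      then obtain u where u: "u \<in> Unip y'" "w1 \<otimes> u \<in> Unip y'" by (auto simp: W_def)
      then have "(w1 \<otimes> u) \<otimes> inv u \<in> Unip y'" by simp
      moreover have "(w1 \<otimes> u) \<otimes> inv u = w1" using u UG w1 by (simp add: m_assoc subset_eq)
      ultimately show False using nU[OF w1(1)] by simp
    qed
    have "W \<subseteq> Stab y'" unfolding W_def using w1S Unip_subset subgroup.m_closed[OF subgroup_Stab] by blast
    then have "Unip y' \<union> W = Stab y'"
      using disj cW S2(1)[OF y'O] Unip_subset finite_Stab finite_Unip
      by (intro card_subset_eq) (auto simp: card_Un_disjoint W_def)
    then have "w' \<in> W" using w'S nU[OF w'] by blast
    then obtain u where u: "u \<in> Unip y'" "w' = w1 \<otimes> u" by (auto simp: W_def)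
    have uG: "u \<in> carrier G" using u UG by blast
    have "w1 \<otimes> u \<otimes> (w1 \<otimes> u) = \<one>" using w' u by (simp add: invol_def)
    then have wuw: "inv u = w1 \<otimes> (u \<otimes> w1)" using w1 uG by (simp add: m_assoc inv_equality)
    have u2: "inv u \<otimes> inv u = u"
      using cube[OF u(1) y'O] uG by (metis inv_equality inv_mult_group inv_inv m_closed)
    have ww: "w1 \<otimes> (w1 \<otimes> z) = z" if "z \<in> carrier G" for z
      using w1 that by (simp add: invol_def flip: m_assoc)
    have "cnj u w1 = w1 \<otimes> (w1 \<otimes> (u \<otimes> w1)) \<otimes> inv u"
      unfolding cnj_def using w1 uG ww by (simp add: m_assoc)
    also have "\<dots> = w1 \<otimes> (inv u \<otimes> inv u)" using w1 uG by (simp flip: wuw add: m_assoc)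
    finally have "cnj u w1 = w'" using u2 u by simp
    then have "w' = cnj (u \<otimes> k) w" using k wG uG by (simp add: w1_def cnj_cnj)
    then show ?thesis using k uG by blast
  qed
  define C where "C w = {g \<in> carrier G. g \<otimes> w = w \<otimes> g}" for w
  have subC: "subgroup (C w) G" if "w \<in> carrier G" for w
  proof -
    have "C w = {g \<in> carrier G. cnj g w = w}" using that by (auto simp: C_def cnj_eq_self_iff)
    then show ?thesis using subgroup_centralizer[OF that] by simp
  qed
  have finC: "finite (C w)" for w using fin by (simp add: C_def)
  \<comment> \<open>The centraliser of \<open>w\<close> permutes the two fixed points of
    \<open>w\<close>, so it is at most twice as large as the part \<open>D\<close> fixing one of
    them.\<close>
  have C4: "card (C w) \<le> 4" if w: "invol w" for w
  proof -
    have wG: "w \<in> carrier G" using w by (simp add: invol_def)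
    obtain y z where yz: "Fix w = {y, z}" using card_Fix_invol[OF w] by (auto simp: card_2_iff)
    have yO: "y \<in> Orb x" using FO[OF w] yz by simp
    define D where "D = C w \<inter> Stab y"
    have finD: "finite D" using finC by (simp add: D_def)
    \<comment> \<open>\<open>D\<close> meets \<open>Unip y\<close> trivially: a nontrivial unipotent
      element commuting with \<open>w\<close> would force \<open>w\<close> into
      \<open>Unip y\<close>. As \<open>Stab y\<close> is twice as large as \<open>Unip y\<close>,
      this gives \<open>card D \<le> 2\<close>.\<close>
    have "inj_on (\<lambda>(d, u). d \<otimes> u) (D \<times> Unip y)"
    proof (rule inj_onI, clarify)
      fix d u d' u' assume a: "d \<in> D" "u \<in> Unip y" "d' \<in> D" "u' \<in> Unip y" "d \<otimes> u = d' \<otimes> u'"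
      have c: "d \<in> carrier G" "d' \<in> carrier G" "u \<in> carrier G" "u' \<in> carrier G"
        using a Unip_subset Stab_subset by (auto simp: D_def C_def)
      have "d = d' \<otimes> u' \<otimes> inv u" using c by (simp add: inv_solve_right a(5))
      then have "inv d' \<otimes> d = inv d' \<otimes> (d' \<otimes> (u' \<otimes> inv u))" using c by (simp add: m_assoc)
      also have "\<dots> = u' \<otimes> inv u" using c by (simp flip: m_assoc)
      finally have eq: "inv d' \<otimes> d = u' \<otimes> inv u" .
      have m: "inv d' \<otimes> d \<in> C w"
        using a subgroup.m_closed[OF subC[OF wG]] subgroup.m_inv_closed[OF subC[OF wG]] by (auto simp: D_def)
      have "u' \<otimes> inv u \<in> Unip y"
        using a subgroup.m_closed[OF subgroup_Unip] subgroup.m_inv_closed[OF subgroup_Unip] by blast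
      then have one: "u' \<otimes> inv u = \<one>"
        using fixes_of_commutes_unipotent[of "u' \<otimes> inv u" y w] nU[OF w] m eq wG
        by (auto simp: C_def)
      then have "u = u'" using c by (metis inv_closed inv_equality inv_inv)
      moreover have "d = d'" using one eq c by (metis inv_closed inv_equality inv_inv)
      ultimately show "d = d' \<and> u = u'" by simp
    qed
    then have "card (D \<times> Unip y) \<le> card (Stab y)"
    proof (rule card_inj_on_le[OF _ _ finite_Stab])
      show "(\<lambda>(d, u). d \<otimes> u) ` (D \<times> Unip y) \<subseteq> Stab y"
        using Unip_subset[of y] subgroup.m_closed[OF subgroup_Stab[of y]] by (auto simp: D_def)
    qed
    then have "card D * card (Unip y) \<le> 2 * card (Unip y)"
      using S2(1)[OF yO] by (simp add: card_cartesian_product)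
    then have D2: "card D \<le> 2" using card_Unip_pos[of y] by simp
    have inFix: "act g y \<in> {y, z}" if "g \<in> C w" for g
    proof -
      have gG: "g \<in> carrier G" "g \<otimes> w = w \<otimes> g" using that by (auto simp: C_def)
      have "act w (act g y) = act g (act w y)" using gG wG by (metis act_mult)
      also have "act w y = y" using yz by (simp add: Fix_def set_eq_iff)
      finally have "act g y \<in> Fix w" by (simp add: Fix_def)
      then show ?thesis using yz by simp
    qed
    show ?thesis
    proof (cases "C w \<subseteq> D")
      case True
      then have "card (C w) \<le> card D" using finD card_mono by blast
      then show ?thesis using D2 by simp
    next
      case False
      then obtain g0 where g0: "g0 \<in> C w" "g0 \<notin> D" by blast
      have g0G: "g0 \<in> carrier G" using g0 by (simp add: C_def)
      have g0z: "act g0 y = z" using inFix[OF g0(1)] g0 by (auto simp: D_def Stab_def C_def)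
      have "C w \<subseteq> D \<union> (\<lambda>d. g0 \<otimes> d) ` D"
      proof
        fix g assume g: "g \<in> C w"
        have gG: "g \<in> carrier G" using g by (simp add: C_def)
        show "g \<in> D \<union> (\<lambda>d. g0 \<otimes> d) ` D"
        proof (cases "act g y = y")
          case True then show ?thesis using g gG by (simp add: D_def Stab_def)
        next
          case False
          then have "act g y = act g0 y" using inFix[OF g] g0z by simp
          then have "act (inv g0 \<otimes> g) y = y" using gG g0G by (simp add: act_mult)
          moreover have "inv g0 \<otimes> g \<in> C w"
            using g g0 subgroup.m_closed[OF subC[OF wG]] subgroup.m_inv_closed[OF subC[OF wG]] by blast
          ultimately have "inv g0 \<otimes> g \<in> D" using gG g0G by (simp add: D_def Stab_def)
          moreover have "g = g0 \<otimes> (inv g0 \<otimes> g)" using gG g0G by (simp flip: m_assoc)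
          ultimately show ?thesis by blast
        qed
      qed
      then have "card (C w) \<le> card (D \<union> (\<lambda>d. g0 \<otimes> d) ` D)" using finD by (intro card_mono) auto
      also have "\<dots> \<le> card D + card ((\<lambda>d. g0 \<otimes> d) ` D)" by (rule card_Un_le)
      also have "\<dots> \<le> card D + card D" using card_image_le[OF finD] by simp
      finally show ?thesis using D2 by linarith
    qed
  qed
  have rG: "r0 \<in> carrier G" "r1 \<in> carrier G" "r2 \<in> carrier G" using r by (auto simp: invol_def)
  have r02: "invol (r0 \<otimes> r2)" using invol_mult r by blast
  define V where "V = {\<one>, r0, r2, r0 \<otimes> r2}"
  have V4: "card V = 4" using r r02 by (auto simp: V_def invol_def)
  have comm: "r2 \<otimes> (r0 \<otimes> r2) = r0 \<otimes> r2 \<otimes> r2" "r0 \<otimes> (r0 \<otimes> r2) = r0 \<otimes> r2 \<otimes> r0"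
  proof -
    have "r2 \<otimes> (r0 \<otimes> r2) = r2 \<otimes> r0 \<otimes> r2" using rG by (simp add: m_assoc)
    then show "r2 \<otimes> (r0 \<otimes> r2) = r0 \<otimes> r2 \<otimes> r2" by (simp add: r(4))
    have "r0 \<otimes> (r2 \<otimes> r0) = r0 \<otimes> r2 \<otimes> r0" using rG by (simp only: m_assoc)
    then show "r0 \<otimes> (r0 \<otimes> r2) = r0 \<otimes> r2 \<otimes> r0" by (simp only: r(4)[symmetric])
  qed
  \<comment> \<open>The four-group of \<open>r0\<close> and \<open>r2\<close> attains the bound 4,
    so it is the whole centraliser; conjugation carries this to every involution.\<close>
  have VC: "V \<subseteq> C r0" using rG by (auto simp: V_def C_def comm r(4)[symmetric])
  have CV: "C r0 = V"
    using card_subset_eq[OF finC VC] card_mono[OF finC VC] V4 C4[OF r(1)] by simp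
  have Vinv: "a = \<one> \<or> invol a" if "a \<in> V" for a using that r r02 by (auto simp: V_def)
  have Vcomm: "a \<otimes> b = b \<otimes> a" if "a \<in> V" "b \<in> V" for a b
    using that rG by (auto simp: V_def comm r(4)[symmetric])
  have C_cnj: "C (cnj g w) = cnj g ` C w" if g: "g \<in> carrier G" and wG: "w \<in> carrier G" for g w
  proof -
    have *: "cnj k c \<in> C (cnj k v)" if "k \<in> carrier G" "v \<in> carrier G" "c \<in> C v" for k v c
      using that by (auto simp: C_def simp flip: cnj_mult)
    show ?thesis
    proof (intro equalityI subsetI)
      fix c assume c: "c \<in> C (cnj g w)"
      then have "cnj (inv g) c \<in> C w" using *[of "inv g" "cnj g w" c] g wG by simp
      moreover have "c \<in> carrier G" using c by (simp add: C_def)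
      ultimately show "c \<in> cnj g ` C w" using g by (intro image_eqI[of _ _ "cnj (inv g) c"]) auto
    qed (use * g wG in auto)
  qed
  have CI: "card (C w) = 4 \<and> (\<forall>a\<in>C w. a = \<one> \<or> invol a) \<and> (\<forall>a\<in>C w. \<forall>b\<in>C w. a \<otimes> b = b \<otimes> a)"
    if w: "invol w" for w
  proof -
    obtain g where g: "g \<in> carrier G" "w = cnj g r0" using conj[OF r(1) w] by blast
    have CW: "C w = cnj g ` V" using C_cnj g rG CV by simp
    have VG: "V \<subseteq> carrier G" using VC by (auto simp: C_def)
    have "card (C w) = 4" unfolding CW using g VG V4 by (simp add: card_image inj_on_cnj)
    moreover have "cnj g a = \<one> \<or> invol (cnj g a)" if "a \<in> V" for a
      using Vinv[OF that] invol_cnj g(1) cnj_one by metis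
    moreover have "cnj g a \<otimes> cnj g b = cnj g b \<otimes> cnj g a" if "a \<in> V" "b \<in> V" for a b
      using Vcomm[OF that] that VG g(1) by (simp add: subset_eq flip: cnj_mult)
    ultimately show ?thesis unfolding CW by blast
  qed
  \<comment> \<open>The three involutions of the four-group around \<open>w\<close>. Because that
    group is abelian and is the centraliser of each of its involutions, these triples partition
    \<open>I\<close>.\<close>
  define N where "N w = C w - {\<one>}" for w
  have Nw: "w \<in> N w" if "invol w" for w using that by (auto simp: N_def C_def invol_def)
  have NI: "invol v \<and> N v = N w" if w: "invol w" and v: "v \<in> N w" for w v
  proof -
    have vi: "invol v" using CI[OF w] v by (auto simp: N_def)
    have "C w \<subseteq> C v"
    proof
      fix a assume a: "a \<in> C w"
      then have "a \<otimes> v = v \<otimes> a" using CI[OF w] v by (simp add: N_def)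
      then show "a \<in> C v" using a by (simp add: C_def)
    qed
    then have "C w = C v" using CI[OF w] CI[OF vi] by (intro card_subset_eq finC) auto
    then show ?thesis using vi by (simp add: N_def)
  qed
  have cardN: "card (N w) = 3" if "invol w" for w
  proof -
    have "\<one> \<in> C w" using that by (simp add: C_def invol_def)
    then show ?thesis using CI[OF that] finC by (simp add: N_def)
  qed
  have I15: "card I = 15"
  proof -
    interpret ga: group_action G "carrier G" "\<lambda>g. \<lambda>k\<in>carrier G. g \<otimes> k \<otimes> inv g"
      by (rule action_by_conjugation)
    have "orbit G (\<lambda>g. \<lambda>k\<in>carrier G. g \<otimes> k \<otimes> inv g) r0 = I"
      using conj[OF r(1)] invol_cnj[OF r(1)] rG by (auto simp: orbit_def I_def cnj_def)
    moreover have "stabilizer G (\<lambda>g. \<lambda>k\<in>carrier G. g \<otimes> k \<otimes> inv g) r0 = C r0"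
      using rG cnj_eq_self_iff[of _ r0] by (auto simp: stabilizer_def C_def cnj_def)
    ultimately have "card I * card (C r0) = 60"
      using ga.orbit_stabilizer_theorem[OF rG(1)] h by (simp add: Coset.order_def)
    then show ?thesis using CI[OF r(1)] by simp
  qed
  define \<Omega> where "\<Omega> = N ` I"
  have card\<Omega>: "card \<Omega> = 5"
  proof -
    have U: "\<Union> \<Omega> = I"
    proof
      show "\<Union> \<Omega> \<subseteq> I" using NI unfolding \<Omega>_def I_def by blast
      show "I \<subseteq> \<Union> \<Omega>" using Nw unfolding \<Omega>_def I_def by blast
    qed
    have "3 * card \<Omega> = card (\<Union> \<Omega>)"
    proof (rule card_partition)
      show "finite \<Omega>" using finI by (simp add: \<Omega>_def)
      show "finite (\<Union> \<Omega>)" using U finI by simp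
      show "\<And>c. c \<in> \<Omega> \<Longrightarrow> card c = 3" using cardN by (auto simp: \<Omega>_def I_def)
      show "c1 \<inter> c2 = {}" if c: "c1 \<in> \<Omega>" "c2 \<in> \<Omega>" "c1 \<noteq> c2" for c1 c2
      proof (rule ccontr)
        assume "c1 \<inter> c2 \<noteq> {}"
        then obtain v where v: "v \<in> c1" "v \<in> c2" by blast
        obtain a b where ab: "invol a" "c1 = N a" "invol b" "c2 = N b"
          using c unfolding \<Omega>_def I_def by blast
        then show False using c(3) v NI[OF ab(1), of v] NI[OF ab(3), of v] by simp
      qed
    qed
    then show ?thesis using U I15 by simp
  qed
  have N_cnj: "cnj g ` N w = N (cnj g w)" if "g \<in> carrier G" "invol w" for g w
  proof -
    have wG: "w \<in> carrier G" using that by (simp add: invol_def)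
    have "cnj g ` (C w - {\<one>}) = cnj g ` C w - cnj g ` {\<one>}"
      using that wG by (intro inj_on_image_set_diff[OF inj_on_cnj[OF that(1), of "carrier G"]]) (auto simp: C_def)
    then show ?thesis using C_cnj[OF that(1) wG] that by (simp add: N_def)
  qed
  have im: "cnj (g \<otimes> k) ` A = cnj g ` cnj k ` A" if "g \<in> carrier G" "k \<in> carrier G" "A \<subseteq> carrier G" for g k A
    using that by (auto simp: cnj_cnj image_iff subset_eq)
  have im_inv: "cnj k ` cnj (inv k) ` A = A" "cnj (inv k) ` cnj k ` A = A"
    if "k \<in> carrier G" "A \<subseteq> carrier G" for k A
    using that by (simp_all add: image_image subset_eq cong: image_cong)
  have clos: "cnj g ` A \<in> \<Omega>" if "g \<in> carrier G" "A \<in> \<Omega>" for g A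
    using that N_cnj invol_cnj by (auto simp: \<Omega>_def I_def)
  have \<Omega>G: "A \<subseteq> carrier G" if "A \<in> \<Omega>" for A
    using that by (auto simp: \<Omega>_def N_def C_def)
  have one_im: "cnj \<one> ` A = A" if "A \<in> \<Omega>" for A
    using \<Omega>G[OF that] by (force simp: subset_eq)
  define K where "K = {g \<in> carrier G. \<forall>A\<in>\<Omega>. cnj g ` A = A}"
  have subK: "subgroup K G"
  proof (rule subgroupI)
    show "K \<noteq> {}" using one_im by (auto simp: K_def intro!: exI[of _ \<one>])
    fix a b assume a: "a \<in> K" and b: "b \<in> K"
    show "a \<otimes> b \<in> K" using a b by (simp add: K_def im \<Omega>G)
    have "cnj (inv a) ` A = A" if "A \<in> \<Omega>" for A
    proof -
      have "cnj (inv a) ` A = cnj (inv a) ` cnj a ` A" using a that by (simp add: K_def)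
      also have "\<dots> = A" using a that by (intro im_inv \<Omega>G) (simp add: K_def)
      finally show ?thesis .
    qed
    then show "inv a \<in> K" using a by (simp add: K_def)
  qed (auto simp: K_def)
  have normK: "cnj k g \<in> K" if k: "k \<in> carrier G" and g: "g \<in> K" for k g
  proof -
    have gG: "g \<in> carrier G" using g by (simp add: K_def)
    have "cnj (cnj k g) ` A = A" if A: "A \<in> \<Omega>" for A
    proof -
      have A': "cnj (inv k) ` A \<in> \<Omega>" using clos k A by simp
      have "cnj (cnj k g) ` A = cnj k ` cnj g ` cnj (inv k) ` A"
        using k gG A A' \<Omega>G by (simp add: cnj_def[of k g] im)
      also have "cnj g ` cnj (inv k) ` A = cnj (inv k) ` A" using A' g by (simp add: K_def)
      also have "cnj k ` cnj (inv k) ` A = A" using k A by (intro im_inv \<Omega>G)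
      finally show ?thesis .
    qed
    then show ?thesis using k gG by (simp add: K_def)
  qed
  \<comment> \<open>The kernel is normal and the involutions are conjugate, so one involution in it
    brings in all generators. Then every four-group would be invariant and there would be only one
    of them.\<close>
  have KI: "w \<notin> K" if w: "invol w" for w
  proof
    assume wK: "w \<in> K"
    have "v \<in> K" if v: "invol v" for v using conj[OF w v] normK wK by auto
    then have "{r0, r1, r2} \<subseteq> K" using r by blast
    then have "carrier G \<subseteq> K" using generate_subgroup_incl[OF _ subK] gen by blast
    then have "N (cnj g r0) = N r0" if "g \<in> carrier G" for g
      using that N_cnj[OF that r(1)] r(1) by (auto simp: K_def \<Omega>_def I_def)
    then have "N v = N r0" if "invol v" for v using conj[OF r(1) that] by auto
    then have "\<Omega> \<subseteq> {N r0}" by (auto simp: \<Omega>_def I_def)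
    then have "card \<Omega> \<le> card {N r0}" by (intro card_mono) auto
    then show False using card\<Omega> by simp
  qed
  have "\<exists>\<phi> \<in> hom G (sym_group 5). inj_on \<phi> (carrier G)"
  proof (rule perm_rep_exists[where \<alpha> = "\<lambda>g A. cnj g ` A" and \<Omega> = \<Omega>])
    show "finite \<Omega>" using finI by (simp add: \<Omega>_def)
    fix g assume g: "g \<in> carrier G" "\<And>A. A \<in> \<Omega> \<Longrightarrow> cnj g ` A = A"
    have gK: "g \<in> K" using g by (simp add: K_def)
    \<comment> \<open>The commutator of \<open>g\<close> with \<open>r0\<close> lies in the kernel and in the four-group around \<open>r0\<close>, so it is trivial.\<close>
    have "cnj g r0 \<in> N r0"
      using g(2)[of "N r0"] Nw[OF r(1)] r(1) by (auto simp: \<Omega>_def I_def)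
    then have "cnj g r0 \<in> C r0" by (simp add: N_def)
    then have cC: "cnj g r0 \<otimes> inv r0 \<in> C r0"
      using subgroup.m_closed[OF subC[OF rG(1)]] subgroup.m_inv_closed[OF subC[OF rG(1)]] Nw[OF r(1)]
      by (simp add: N_def)
    have "cnj g r0 \<otimes> inv r0 = g \<otimes> cnj r0 (inv g)" using g rG by (simp add: cnj_def m_assoc)
    also have "\<dots> \<in> K"
      using gK normK[OF rG(1)] subgroup.m_closed[OF subK] subgroup.m_inv_closed[OF subK] by blast
    finally have "cnj g r0 \<otimes> inv r0 = \<one>" using cC KI CI[OF r(1)] by blast
    then have "cnj g r0 = r0" using g rG by (metis cnj_closed inv_closed inv_equality inv_inv)
    then have "g \<in> C r0" using g rG by (simp add: C_def cnj_eq_self_iff)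
    then show "g = \<one>" using CI[OF r(1)] KI gK by blast
  qed (use card\<Omega> clos im one_im \<Omega>G in auto)
  then obtain \<phi> where \<phi>: "\<phi> \<in> hom G (sym_group 5)" "inj_on \<phi> (carrier G)" by blast
  have perm: "permutation (\<phi> g)" if "g \<in> carrier G" for g
    using \<phi>(1) that sym_group_carrier' by (auto simp: hom_def)
  have mult: "\<phi> (g \<otimes> k) = \<phi> g \<circ> \<phi> k" if "g \<in> carrier G" "k \<in> carrier G" for g k
    using \<phi>(1) that by (auto simp: hom_def sym_group_mult)
  have sgn: "sign (\<phi> (g \<otimes> k)) = sign (\<phi> g) * sign (\<phi> k)" if "g \<in> carrier G" "k \<in> carrier G" for g k
    using mult perm that by (simp add: sign_compose)
  have sgn_sq: "sign (\<phi> g) * sign (\<phi> g) = 1" for g by (simp add: sign_def)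
  have "\<phi> \<one> = id"
  proof -
    interpret gh: group_hom G "sym_group 5" \<phi>
      by (simp add: group_hom_def group_hom_axioms_def is_group sym_group_is_group \<phi>(1))
    show ?thesis using gh.hom_one by (simp add: sym_group_one)
  qed
  then have s1: "sign (\<phi> \<one>) = 1" by (simp add: sign_id)
  have sinv: "sign (\<phi> (inv g)) = sign (\<phi> g)" if "g \<in> carrier G" for g
  proof -
    have "sign (\<phi> g) * sign (\<phi> (inv g)) = 1" using sgn[of g "inv g"] that s1 by simp
    then show ?thesis using sgn_sq[of g] by (metis mult_cancel_left zero_neq_one mult_zero_left)
  qed
  have sI: "sign (\<phi> w) = 1" if w: "invol w" for w
  proof -
    \<comment> \<open>All involutions are conjugate, and one of them is a product of two others.\<close>
    have sc: "sign (\<phi> v) = sign (\<phi> r0)" if v: "invol v" for v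
    proof -
      obtain g where g: "g \<in> carrier G" "v = cnj g r0" using conj[OF r(1) v] by blast
      then have "sign (\<phi> v) = sign (\<phi> g) * sign (\<phi> r0) * sign (\<phi> g)"
        using rG by (simp add: cnj_def sgn sinv)
      then show ?thesis using sgn_sq[of g] by (simp add: mult.assoc mult.left_commute)
    qed
    have "sign (\<phi> (r0 \<otimes> r2)) = sign (\<phi> r0) * sign (\<phi> r0)" using sgn rG sc[OF r(3)] by simp
    then show ?thesis using sgn_sq[of r0] sc[OF r02] sc[OF w] by simp
  qed
  define E where "E = {g \<in> carrier G. sign (\<phi> g) = 1}"
  have subE: "subgroup E G"
    by (rule subgroupI) (use s1 sgn sinv in \<open>auto simp: E_def\<close>)
  have "{r0, r1, r2} \<subseteq> E" using sI r rG by (auto simp: E_def)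
  then have "carrier G \<subseteq> E" using generate_subgroup_incl[OF _ subE] gen by blast
  then have even: "evenperm (\<phi> g)" if "g \<in> carrier G" for g
    using that by (auto simp: E_def sign_def split: if_splits)
  have "\<phi> \<in> hom G (alt_group 5)"
    using \<phi>(1) even by (auto simp: hom_def alt_group_carrier sym_group_carrier alt_group_mult sym_group_mult)
  moreover have ca: "card (carrier (alt_group 5)) = 60"
    using alt_group_card_carrier[of 5] by (simp add: fact_numeral)
  moreover have "finite (carrier (alt_group 5))" using ca by (metis card.infinite zero_neq_numeral)
  ultimately show ?thesis using iso_of_inj_hom \<phi>(2) h by metis
qed

end

section \<open>Projective representations by two by two matrices\<close>

text \<open>A matrix is the quadruple of its entries, row by row, so that matrix identities reduce
  to polynomial identities for the simplifier.\<close>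

type_synonym 'l mat2 = "'l \<times> 'l \<times> 'l \<times> 'l"

fun mdet :: "'l::field mat2 \<Rightarrow> 'l" where "mdet (a, b, c, d) = a * d - b * c"
fun mtr :: "'l::field mat2 \<Rightarrow> 'l" where "mtr (a, b, c, d) = a + d"
fun mneg :: "'l::field mat2 \<Rightarrow> 'l mat2" where "mneg (a, b, c, d) = (-a, -b, -c, -d)"
fun mmul :: "'l::field mat2 \<Rightarrow> 'l mat2 \<Rightarrow> 'l mat2" where
  "mmul (a, b, c, d) (a', b', c', d') = (a*a' + b*c', a*b' + b*d', c*a' + d*c', c*b' + d*d')"
fun minv :: "'l::field mat2 \<Rightarrow> 'l mat2" where
  "minv (a, b, c, d) = (d / (a*d - b*c), - b / (a*d - b*c), - c / (a*d - b*c), a / (a*d - b*c))"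

definition mone :: "'l::field mat2" where "mone = (1, 0, 0, 1)"

text \<open>For matrices of determinant one this is equality in PSL_2.\<close>

definition msim :: "'l::field mat2 \<Rightarrow> 'l mat2 \<Rightarrow> bool" where
  "msim A Y \<longleftrightarrow> A = Y \<or> A = mneg Y"

text \<open>\<open>None\<close> is the point at infinity of the projective line.\<close>

fun mob :: "'l::field mat2 \<Rightarrow> 'l option \<Rightarrow> 'l option" where
  "mob (a, b, c, d) None = (if c = 0 then None else Some (a / c))"
| "mob (a, b, c, d) (Some z) = (if c * z + d = 0 then None else Some ((a * z + b) / (c * z + d)))"

text \<open>The eigenvalue of a matrix on the line given by a fixed point.\<close>

fun eig :: "'l::field mat2 \<Rightarrow> 'l option \<Rightarrow> 'l" where
  "eig (a, b, c, d) None = a"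
| "eig (a, b, c, d) (Some z) = c * z + d"

section \<open>Matrices, fractional linear maps and fixed points\<close>

lemma mmul_assoc: "mmul (mmul A Y) Z = mmul A (mmul Y Z)"
  by (cases A; cases Y; cases Z) (simp add: algebra_simps)

lemma mmul_mone [simp]: "mmul mone A = A" "mmul A mone = A"
  by (cases A; simp add: mone_def)+

lemma mdet_mmul [simp]: "mdet (mmul A Y) = mdet A * mdet Y"
  by (cases A; cases Y) (simp add: algebra_simps)

lemma mneg_mneg [simp]: "mneg (mneg A) = A"
  by (cases A) simp

lemma mmul_mneg [simp]: "mmul (mneg A) Y = mneg (mmul A Y)" "mmul A (mneg Y) = mneg (mmul A Y)"
  by (cases A; cases Y; simp add: algebra_simps)+

lemma mdet_mneg [simp]: "mdet (mneg A) = mdet A"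
  by (cases A) simp

lemma mtr_mneg [simp]: "mtr (mneg A) = - mtr A"
  by (cases A) simp

lemma mdet_mone [simp]: "mdet mone = 1"
  by (simp add: mone_def)

lemma mmul_minv: "mdet A \<noteq> 0 \<Longrightarrow> mmul A (minv A) = mone" "mdet A \<noteq> 0 \<Longrightarrow> mmul (minv A) A = mone"
  by (cases A; simp add: mone_def field_simps diff_divide_distrib[symmetric])+

lemma mdet_minv: "mdet A \<noteq> 0 \<Longrightarrow> mdet (minv A) = inverse (mdet A)"
  by (metis mdet_mmul mmul_minv(1) mdet_mone inverse_unique)

lemma msim_refl [simp]: "msim A A" by (simp add: msim_def)
lemma msim_sym: "msim A Y \<Longrightarrow> msim Y A" by (auto simp: msim_def)
lemma msim_trans: "msim A Y \<Longrightarrow> msim Y Z \<Longrightarrow> msim A Z" by (auto simp: msim_def)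
lemma msim_mmul: "msim A A' \<Longrightarrow> msim Y Y' \<Longrightarrow> msim (mmul A Y) (mmul A' Y')"
  by (auto simp: msim_def)

lemma mob_mneg [simp]: "mob (mneg A) x = mob A x"
proof -
  obtain a b c d where A: "A = (a, b, c, d)" by (cases A)
  show ?thesis
  proof (cases x)
    case None then show ?thesis by (simp add: A)
  next
    case (Some z)
    have 1: "- c * z + - d = - (c * z + d)" "- a * z + - b = - (a * z + b)" by simp_all
    show ?thesis
      by (simp only: A Some mneg.simps mob.simps 1 neg_equal_0_iff_equal minus_divide_divide)
  qed
qed

lemma mob_msim: "msim A Y \<Longrightarrow> mob A x = mob Y x"
  by (auto simp: msim_def)

lemma mob_mone [simp]: "mob mone x = x"
  by (cases x) (auto simp: mone_def)

lemma mob_mmul: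
  assumes "mdet A \<noteq> 0" "mdet Y \<noteq> 0"
  shows "mob (mmul A Y) x = mob A (mob Y x)"
proof -
  obtain a b c d where A: "A = (a, b, c, d)" by (cases A)
  obtain a' b' c' d' where Y: "Y = (a', b', c', d')" by (cases Y)
  \<comment> \<open>Homogeneous coordinates: \<open>(p, s)\<close> stands for the point
    \<open>p / s\<close>, or infinity when \<open>s = 0\<close>, and \<open>(q, r)\<close> is its
    image under the matrix \<open>A\<close>.\<close>
  have main: "(if r = 0 then None else Some (q / r)) =
      mob (a, b, c, d) (if s = 0 then None else Some (p / s))"
    if "q = a * p + b * s" "r = c * p + d * s" "p \<noteq> 0 \<or> s \<noteq> 0" for p s q r
  proof (cases "s = 0")
    case True
    then show ?thesis using that assms(1) A by auto
  next
    case False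
    have "c * (p / s) + d = r / s" "a * (p / s) + b = q / s" using False that by (simp_all add: field_simps)
    then show ?thesis using False by simp
  qed
  show ?thesis
  proof (cases x)
    case None
    have "a' \<noteq> 0 \<or> c' \<noteq> 0" using assms(2) Y by auto
    then show ?thesis using main[of _ a' c'] by (simp add: A Y None)
  next
    case (Some z)
    have "a' * z + b' \<noteq> 0 \<or> c' * z + d' \<noteq> 0"
    proof (rule ccontr)
      assume "\<not> ?thesis"
      then have "b' = - (a' * z)" "d' = - (c' * z)" by (auto simp: eq_neg_iff_add_eq_0 add.commute)
      then show False using assms(2) Y by simp
    qed
    moreover have "(a * a' + b * c') * z + (a * b' + b * d') = a * (a' * z + b') + b * (c' * z + d')"
      "(c * a' + d * c') * z + (c * b' + d * d') = c * (a' * z + b') + d * (c' * z + d')"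
      by (simp_all add: algebra_simps)
    ultimately show ?thesis using main[of _ "a' * z + b'" "c' * z + d'"]
      by (simp add: A Y Some del: mob.simps(1))
  qed
qed

lemma eig_mmul:
  assumes "mdet Y \<noteq> 0" "mob Y x = x"
  shows "eig (mmul A Y) x = eig A x * eig Y x"
proof -
  obtain a b c d where A: "A = (a, b, c, d)" by (cases A)
  obtain a' b' c' d' where Y: "Y = (a', b', c', d')" by (cases Y)
  show ?thesis
  proof (cases x)
    case None then show ?thesis using assms by (auto simp: A Y split: if_splits)
  next
    case (Some z)
    then have "a' * z + b' = z * (c' * z + d')" using assms by (auto simp: A Y field_simps split: if_splits)
    moreover have "(c * a' + d * c') * z + (c * b' + d * d') = c * (a' * z + b') + d * (c' * z + d')"
      by (simp add: algebra_simps)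
    ultimately show ?thesis by (simp add: A Y Some algebra_simps)
  qed
qed

lemma eig_mneg [simp]: "eig (mneg A) x = - eig A x"
  by (cases A; cases x) auto

text \<open>The eigenvalues add up to the trace and multiply to the determinant, so the second
  factor is the other eigenvalue.\<close>

lemma eig_trace:
  assumes "mdet A = 1" "mob A x = x"
  shows "eig A x * (mtr A - eig A x) = 1"
proof -
  obtain a b c d where A: "A = (a, b, c, d)" by (cases A)
  show ?thesis
  proof (cases x)
    case None then show ?thesis using assms by (auto simp: A split: if_splits)
  next
    case (Some z)
    then have "a * z + b = z * (c * z + d)" using assms by (auto simp: A field_simps split: if_splits)
    then have b: "b = z * (c * z + d) - a * z" by (simp add: algebra_simps)
    have "a * d - b * c = 1" using assms A by simp
    then show ?thesis by (simp add: A Some b algebra_simps)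
  qed
qed

text \<open>The discriminant \<open>t^2 - 4\<close> is the square of \<open>t - 2 * e\<close>, the
  difference of the two eigenvalues; these are mutually inverse, so they agree exactly when
  \<open>e^2 = 1\<close>.\<close>

lemma trace_sq_eq_4_iff:
  fixes e t :: "'l::field"
  assumes "e * (t - e) = 1"
  shows "t^2 = 4 \<longleftrightarrow> e^2 = 1"
proof -
  have et: "e * t = 1 + e * e" using assms by (simp add: algebra_simps)
  have "(t - 2 * e)^2 = t^2 - 4 * (e * t) + 4 * (e * e)" by (simp add: power2_eq_square algebra_simps)
  also have "\<dots> = t^2 - 4" by (simp add: et algebra_simps)
  finally have "t^2 - 4 = (t - 2 * e)^2" by simp
  moreover have "t - 2 * e = 0 \<longleftrightarrow> e^2 = 1"
  proof
    assume "t - 2 * e = 0"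
    then show "e^2 = 1" using assms by (simp add: power2_eq_square)
  next
    assume "e^2 = 1"
    then have "e * (t - 2 * e) = 0" using et by (simp add: power2_eq_square algebra_simps)
    moreover have "e \<noteq> 0" using assms by auto
    ultimately show "t - 2 * e = 0" by simp
  qed
  ultimately show ?thesis by (metis eq_iff_diff_eq_0 zero_eq_power2)
qed

text \<open>Fixed points are roots of a quadratic with discriminant \<open>(mtr A)^2 - 4\<close>.
  When \<open>c = 0\<close> the quadratic degenerates and infinity becomes a fixed point.\<close>

lemma card_fix_mob:
  fixes A :: "'l::field mat2"
  assumes sqrt: "\<And>x::'l. \<exists>y. y^2 = x" and two: "(2::'l) \<noteq> 0"
    and det: "mdet A = 1" and ns: "\<not> msim A mone"
  shows "card {x. mob A x = x} = (if (mtr A)^2 = 4 then 1 else 2)"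
proof -
  obtain a b c d where A: "A = (a, b, c, d)" by (cases A)
  have d1: "a * d - b * c = 1" using det A by simp
  show ?thesis
  proof (cases "c = 0")
    case True
    have ad: "a * d = 1" using d1 True by simp
    then have d0: "d \<noteq> 0" by auto
    have fixz: "mob A (Some z) = Some z \<longleftrightarrow> (d - a) * z = b" for z
      using d0 by (auto simp: A True field_simps)
    have tr: "(mtr A)^2 = 4 \<longleftrightarrow> a = d"
    proof -
      have "(a + d)^2 = (a - d)^2 + 4 * (a * d)" by (simp add: power2_eq_square algebra_simps)
      then have "(mtr A)^2 - 4 = (a - d)^2" by (simp add: A ad)
      then show ?thesis by (metis eq_iff_diff_eq_0 zero_eq_power2)
    qed
    show ?thesis
    proof (cases "a = d")
      case ad': True
      have "b \<noteq> 0"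
      proof
        assume "b = 0"
        have "(a - 1) * (a + 1) = 0" using ad ad' by (simp add: algebra_simps)
        then have "a = 1 \<or> a = - 1" by (auto simp: eq_neg_iff_add_eq_0)
        then show False using ns A True \<open>b = 0\<close> ad' by (auto simp: msim_def mone_def)
      qed
      then have "{x. mob A x = x} = {None}"
      proof -
        have "mob A x = x \<longleftrightarrow> x = None" for x
          using fixz \<open>b \<noteq> 0\<close> ad' by (cases x) (auto simp: A True)
        then show ?thesis by auto
      qed
      then show ?thesis using tr ad' by simp
    next
      case False
      have "mob A x = x \<longleftrightarrow> x = None \<or> x = Some (b / (d - a))" for x
        using fixz False by (cases x) (auto simp: A True field_simps)
      then have "{x. mob A x = x} = {None, Some (b / (d - a))}" by auto
      then show ?thesis using tr False by simp
    qed
  next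
    case False
    obtain s where s: "s^2 = (mtr A)^2 - 4" using sqrt by blast
    have "(a + d)^2 = (a - d)^2 + 4 * (a * d)" by (simp add: power2_eq_square algebra_simps)
    moreover have "a * d = 1 + b * c" using d1 by (simp add: algebra_simps)
    ultimately have s2: "s^2 = (a - d)^2 + 4 * (b * c)" using s by (simp add: A distrib_left)
    have w: "2 * c \<noteq> 0" using False two by simp
    have fixz: "mob A (Some z) = Some z \<longleftrightarrow> z = (a - d + s) / (2 * c) \<or> z = (a - d - s) / (2 * c)" for z
    proof -
      have "mob A (Some z) = Some z \<longleftrightarrow> a * z + b = z * (c * z + d)"
      proof (cases "c * z + d = 0")
        case True
        have "a * z + b \<noteq> 0"
        proof
          assume "a * z + b = 0"
          then have "c * (a * z + b) = a * (c * z + d)" using True by simp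
          then have "a * d - b * c = 0" by (simp add: algebra_simps)
          then show False using d1 by simp
        qed
        then show ?thesis using True by (simp add: A)
      qed (auto simp: A field_simps)
      \<comment> \<open>The factor \<open>4 * c\<close> completes the square.\<close>
      also have "\<dots> \<longleftrightarrow> 4 * c * (a * z + b - z * (c * z + d)) = 0"
        using False two by (metis (no_types, lifting) eq_iff_diff_eq_0 mult_2 mult_eq_0_iff numeral_Bit0 one_add_one)
      also have "4 * c * (a * z + b - z * (c * z + d)) = s^2 - (2 * c * z - (a - d))^2"
        unfolding s2 by (simp add: power2_eq_square algebra_simps)
      also have "s^2 - (2 * c * z - (a - d))^2 = 0 \<longleftrightarrow> s^2 = (2 * c * z - (a - d))^2"
        by (rule right_minus_eq)
      also have "\<dots> \<longleftrightarrow> (2 * c * z - (a - d))^2 = s^2" by (rule eq_commute)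
      also have "\<dots> \<longleftrightarrow> 2 * c * z - (a - d) = s \<or> 2 * c * z - (a - d) = - s"
        by (rule power2_eq_iff)
      also have "\<dots> \<longleftrightarrow> z = (a - d + s) / (2 * c) \<or> z = (a - d - s) / (2 * c)"
        by (simp only: nonzero_eq_divide_eq[OF w]) (auto simp: algebra_simps)
      finally show ?thesis .
    qed
    have "mob A x = x \<longleftrightarrow> x = Some ((a - d + s) / (2 * c)) \<or> x = Some ((a - d - s) / (2 * c))" for x
    proof (cases x)
      case None then show ?thesis using False by (simp add: A)
    next
      case (Some z) then show ?thesis using fixz[of z] by simp
    qed
    then have F: "{x. mob A x = x} = {Some ((a - d + s) / (2 * c)), Some ((a - d - s) / (2 * c))}" by auto
    have e1: "(a - d + s) / (2 * c) = (a - d - s) / (2 * c) \<longleftrightarrow> s = 0"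
    proof
      assume "(a - d + s) / (2 * c) = (a - d - s) / (2 * c)"
      then have e: "a - d + s = a - d - s" using w by (simp only: divide_cancel_right) blast
      have "2 * s = (a - d + s) - (a - d - s)" by simp
      also have "\<dots> = 0" by (simp only: e diff_self)
      finally have "2 * s = 0" .
      then show "s = 0" using two by simp
    qed simp
    have e2: "s = 0 \<longleftrightarrow> (mtr A)^2 = 4" using s by auto
    have "card {Some u, Some v} = (if u = v then 1 else 2)" for u v :: 'l by simp
    then show ?thesis by (simp only: F e1 e2)
  qed
qed

text \<open>The off-diagonal entries of the square are \<open>b\<close> and \<open>c\<close> times
  the trace, so a nonzero trace leaves only scalar matrices. The argument is valid in characteristic
  two as well.\<close>

lemma trace_zero_of_square:
  assumes "mdet A = 1" "msim (mmul A A) mone" "\<not> msim A mone"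
  shows "mtr A = 0"
proof (rule ccontr)
  obtain a b c d where A: "A = (a, b, c, d)" by (cases A)
  assume "mtr A \<noteq> 0"
  then have ad: "a + d \<noteq> 0" by (simp add: A)
  have *: "b * (a + d) = 0" "c * (a + d) = 0"
    using assms(2) by (auto simp: A msim_def mone_def algebra_simps)
  have "a * a + b * c = 1 \<and> c * b + d * d = 1 \<or> a * a + b * c = -1 \<and> c * b + d * d = -1"
    using assms(2) by (auto simp: A msim_def mone_def)
  then have "a * a + b * c = c * b + d * d" by metis
  then have "a * a = d * d" by (simp add: algebra_simps)
  then have "(a - d) * (a + d) = 0" by (simp add: algebra_simps)
  moreover have bc: "b = 0" "c = 0" using ad * by simp_all
  ultimately have "a = d" using ad by simp
  then have "(a - 1) * (a + 1) = 0" using assms(1) bc by (simp add: A algebra_simps)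
  then have "a = 1 \<or> a = - 1" by (auto simp: eq_neg_iff_add_eq_0)
  then show False using assms(3) \<open>a = d\<close> bc by (auto simp: A msim_def mone_def)
qed

lemma square_of_trace_zero:
  assumes "mdet A = 1" "mtr A = 0"
  shows "mmul A A = mneg mone"
proof -
  obtain a b c d where A: "A = (a, b, c, d)" by (cases A)
  have "d = - a" using assms by (simp add: A eq_neg_iff_add_eq_0 add.commute)
  moreover have "- (a * a + b * c) = 1" using assms calculation by (simp add: A)
  then have "a * a + b * c = - 1" by (metis minus_minus)
  ultimately show ?thesis by (simp add: A mone_def algebra_simps)
qed

text \<open>A group embedded into \<open>PSL\<^sub>2\<close>, by way of matrices that are determined up to sign.\<close>

locale psl_rep = group G for G :: "('a, 'b) monoid_scheme" (structure) +
  fixes M :: "'a \<Rightarrow> 'l::field mat2"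
  assumes finite_G: "finite (carrier G)"
    and det_M: "g \<in> carrier G \<Longrightarrow> mdet (M g) = 1"
    and M_mult: "g \<in> carrier G \<Longrightarrow> h \<in> carrier G \<Longrightarrow> msim (M (g \<otimes> h)) (mmul (M g) (M h))"
    and M_one_iff: "g \<in> carrier G \<Longrightarrow> msim (M g) mone \<longleftrightarrow> g = \<one>"
begin

lemma M_inj: "g \<in> carrier G \<Longrightarrow> h \<in> carrier G \<Longrightarrow> msim (M g) (M h) \<Longrightarrow> g = h"
proof -
  assume gh: "g \<in> carrier G" "h \<in> carrier G" "msim (M g) (M h)"
  have "msim (M (g \<otimes> inv h)) (mmul (M g) (M (inv h)))" using gh M_mult by simp
  also have "msim \<dots> (mmul (M h) (M (inv h)))" using gh(3) by (intro msim_mmul) simp_all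
  also (msim_trans) have "msim \<dots> (M (h \<otimes> inv h))" using msim_sym[OF M_mult[of h "inv h"]] gh by (simp del: r_inv)
  also (msim_trans) have "msim \<dots> mone" using gh M_one_iff by simp
  finally (msim_trans) show "g = h" using gh M_one_iff by (metis inv_closed inv_equality inv_inv m_closed)
qed

lemma commute_iff:
  assumes "g \<in> carrier G" "h \<in> carrier G"
  shows "g \<otimes> h = h \<otimes> g \<longleftrightarrow> msim (mmul (M g) (M h)) (mmul (M h) (M g))"
proof
  note a = M_mult[OF assms] and b = M_mult[OF assms(2,1)]
  {
    assume eq: "g \<otimes> h = h \<otimes> g"
    show "msim (mmul (M g) (M h)) (mmul (M h) (M g))"
      using msim_trans[OF msim_sym[OF a]] b unfolding eq by blast
  next
    assume "msim (mmul (M g) (M h)) (mmul (M h) (M g))"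
    then have "msim (M (g \<otimes> h)) (M (h \<otimes> g))"
      using msim_trans[OF msim_trans[OF a] msim_sym[OF b]] by blast
    then show "g \<otimes> h = h \<otimes> g" using M_inj assms by simp
  }
qed

lemma M_inv: "g \<in> carrier G \<Longrightarrow> msim (M (inv g)) (minv (M g))"
proof -
  assume g: "g \<in> carrier G"
  have "msim (mmul (M g) (M (inv g))) mone"
    using msim_trans[OF msim_sym[OF M_mult[of g "inv g"]], of mone] M_one_iff[of \<one>] g by simp
  then have "msim (mmul (minv (M g)) (mmul (M g) (M (inv g)))) (mmul (minv (M g)) mone)"
    using msim_mmul msim_refl by blast
  then show ?thesis using det_M[OF g] by (simp add: mmul_minv flip: mmul_assoc)
qed

lemma psl_rep_subgroup: "subgroup H G \<Longrightarrow> psl_rep (G\<lparr>carrier := H\<rparr>) M"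
proof -
  assume H: "subgroup H G"
  interpret H: group "G\<lparr>carrier := H\<rparr>" by (rule subgroup_imp_group[OF H])
  show ?thesis
    using finite_G det_M M_mult M_one_iff subgroup.subset[OF H] finite_subset
    by unfold_locales (auto simp: subset_eq)
qed

text \<open>A change of coordinates on the projective line, used to move chosen points to infinity,
  0 and 1.\<close>

lemma psl_rep_conj:
  assumes "mdet P \<noteq> 0"
  shows "psl_rep G (\<lambda>g. mmul P (mmul (M g) (minv P)))"
proof unfold_locales
  fix g h assume g: "g \<in> carrier G" and h: "h \<in> carrier G"
  show "mdet (mmul P (mmul (M g) (minv P))) = 1" using assms g by (simp add: mdet_minv det_M)
  have "msim (mmul P (mmul (M (g \<otimes> h)) (minv P))) (mmul P (mmul (mmul (M g) (M h)) (minv P)))"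
    using M_mult[OF g h] msim_mmul msim_refl by blast
  also have "mmul P (mmul (mmul (M g) (M h)) (minv P)) =
      mmul P (mmul (M g) (mmul (mmul (minv P) P) (mmul (M h) (minv P))))"
    using assms by (simp add: mmul_minv mmul_assoc)
  also have "\<dots> = mmul (mmul P (mmul (M g) (minv P))) (mmul P (mmul (M h) (minv P)))"
    by (simp only: mmul_assoc)
  finally show "msim (mmul P (mmul (M (g \<otimes> h)) (minv P)))
      (mmul (mmul P (mmul (M g) (minv P))) (mmul P (mmul (M h) (minv P))))" .
next
  fix g assume g: "g \<in> carrier G"
  have *: "mmul (minv P) (mmul (mmul P (mmul A (minv P))) P) = A" for A
  proof -
    have "mmul (minv P) (mmul (mmul P (mmul A (minv P))) P) = mmul (mmul (minv P) P) (mmul A (mmul (minv P) P))"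
      by (simp only: mmul_assoc)
    then show ?thesis using assms by (simp add: mmul_minv)
  qed
  have "msim (mmul P (mmul (M g) (minv P))) mone \<longleftrightarrow> msim (M g) mone"
  proof
    assume "msim (mmul P (mmul (M g) (minv P))) mone"
    then have "msim (mmul (minv P) (mmul (mmul P (mmul (M g) (minv P))) P)) (mmul (minv P) (mmul mone P))"
      using msim_mmul msim_refl by blast
    then show "msim (M g) mone" using assms by (simp add: * mmul_minv)
  next
    assume "msim (M g) mone"
    then have "msim (mmul P (mmul (M g) (minv P))) (mmul P (mmul mone (minv P)))"
      using msim_mmul msim_refl by blast
    then show "msim (mmul P (mmul (M g) (minv P))) mone" using assms by (simp add: mmul_minv)
  qed
  then show "msim (mmul P (mmul (M g) (minv P))) mone \<longleftrightarrow> g = \<one>" using M_one_iff g by simp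
qed (rule finite_G)

end

text \<open>Square roots make every matrix of determinant one have an eigenvector, so each group
  element has a fixed point.\<close>

locale split_rep = psl_rep G M for G :: "('a, 'b) monoid_scheme" (structure) and M :: "'a \<Rightarrow> 'l::field mat2" +
  assumes sqrt_ex: "\<And>x::'l. \<exists>y. y^2 = x" and two: "(2::'l) \<noteq> 0"
begin

lemma split_rep_subgroup: "subgroup H G \<Longrightarrow> split_rep (G\<lparr>carrier := H\<rparr>) M"
  using psl_rep_subgroup sqrt_ex two by (simp add: split_rep_def split_rep_axioms_def)

lemma split_rep_conj: "mdet P \<noteq> 0 \<Longrightarrow> split_rep G (\<lambda>g. mmul P (mmul (M g) (minv P)))"
  using psl_rep_conj sqrt_ex two by (simp add: split_rep_def split_rep_axioms_def)

text \<open>Squaring removes the sign left open by the choice of \<open>M\<close>. On the stabiliser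
  of \<open>x\<close> this is a homomorphism, and its kernel is the unipotent subgroup; at infinity
  it is the factor by which conjugation scales translations.\<close>

definition eig2 :: "'a \<Rightarrow> 'l option \<Rightarrow> 'l" where "eig2 g x = (eig (M g) x)^2"

lemma eig2_mult:
  assumes "g \<in> carrier G" "h \<in> carrier G" "mob (M h) x = x"
  shows "eig2 (g \<otimes> h) x = eig2 g x * eig2 h x"
proof -
  have "eig2 (g \<otimes> h) x = (eig (mmul (M g) (M h)) x)^2"
    using M_mult[OF assms(1,2)] by (auto simp: eig2_def msim_def)
  then show ?thesis using assms det_M by (simp add: eig_mmul eig2_def power_mult_distrib)
qed

lemma eig2_one: "eig2 \<one> x = 1"
proof -
  have "eig mone x = (1::'l)" by (cases x) (auto simp: mone_def)
  then show ?thesis using M_one_iff[of \<one>] by (auto simp: eig2_def msim_def)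
qed

lemma mob_mult: "g \<in> carrier G \<Longrightarrow> h \<in> carrier G \<Longrightarrow> mob (M (g \<otimes> h)) x = mob (M g) (mob (M h) x)"
  using mob_msim[OF M_mult] det_M by (simp add: mob_mmul)

lemma mob_one: "mob (M \<one>) x = x"
  using M_one_iff[of \<one>] mob_msim[of "M \<one>" mone] by simp

lemma card_fix_M: "g \<in> carrier G \<Longrightarrow> g \<noteq> \<one> \<Longrightarrow>
    card {x. mob (M g) x = x} = (if (mtr (M g))^2 = 4 then 1 else 2)"
  using card_fix_mob[OF sqrt_ex two] det_M M_one_iff by blast

lemma unip_iff:
  assumes "g \<in> carrier G" "mob (M g) x = x"
  shows "g = \<one> \<or> card {x. mob (M g) x = x} = 1 \<longleftrightarrow> eig2 g x = 1"
proof (cases "g = \<one>")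
  case False
  then show ?thesis
    using card_fix_M[OF assms(1) False] trace_sq_eq_4_iff[OF eig_trace[OF det_M[OF assms(1)] assms(2)]]
    by (simp add: eig2_def)
qed (simp add: eig2_one)

lemma mtr_square_one:
  assumes "g \<in> carrier G" "g \<noteq> \<one>" "g \<otimes> g = \<one>"
  shows "mtr (M g) = 0"
proof (rule trace_zero_of_square[OF det_M[OF assms(1)]])
  show "msim (mmul (M g) (M g)) mone"
    using msim_trans[OF msim_sym[OF M_mult[of g g]], of mone] M_one_iff[of \<one>] assms by simp
  show "\<not> msim (M g) mone" using M_one_iff assms by simp
qed

sublocale fix_action G "\<lambda>g. mob (M g)"
proof (intro fix_action.intro fix_action_axioms.intro)
  show "group G" by (rule is_group)
  show "finite (carrier G)" by (rule finite_G)
  have four: "(4::'l) \<noteq> 0" using two by (metis mult_2 mult_eq_0_iff numeral_Bit0 one_add_one)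
  show "mob (M \<one>) x = x" for x by (rule mob_one)
  show "mob (M (g \<otimes> h)) x = mob (M g) (mob (M h) x)" if "g \<in> carrier G" "h \<in> carrier G" for g h x
    using that by (rule mob_mult)
  show "card {x. mob (M g) x = x} \<in> {1, 2}" if "g \<in> carrier G" "g \<noteq> \<one>" for g
    using card_fix_M[OF that] by auto
  show "card {x. mob (M g) x = x} = 2" if "g \<in> carrier G" "g \<noteq> \<one>" "g \<otimes> g = \<one>" for g
    using card_fix_M[OF that(1,2)] mtr_square_one[OF that] four by auto
  fix x
  have "{g \<in> carrier G. mob (M g) x = x \<and> (g = \<one> \<or> card {x. mob (M g) x = x} = 1)}
      = {g \<in> carrier G. mob (M g) x = x \<and> eig2 g x = 1}"
    using unip_iff by blast
  also have "subgroup \<dots> G"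
  proof (rule subgroupI)
    show "{g \<in> carrier G. mob (M g) x = x \<and> eig2 g x = 1} \<noteq> {}"
      using eig2_one mob_one by (auto intro!: exI[of _ \<one>])
    fix g assume "g \<in> {g \<in> carrier G. mob (M g) x = x \<and> eig2 g x = 1}"
    then have g: "g \<in> carrier G" "mob (M g) x = x" "eig2 g x = 1" by auto
    have "mob (M (inv g)) (mob (M g) x) = x" using g(1) mob_one by (simp flip: mob_mult)
    then have "mob (M (inv g)) x = x" by (simp add: g(2))
    moreover have "eig2 (inv g) x = 1" using eig2_mult[of "inv g" g x] g eig2_one by simp
    ultimately show "inv g \<in> {g \<in> carrier G. mob (M g) x = x \<and> eig2 g x = 1}" using g by simp
  qed (auto simp: mob_mult eig2_mult)
  finally show "subgroup {g \<in> carrier G. mob (M g) x = x \<and> (g = \<one> \<or> card {x. mob (M g) x = x} = 1)} G" .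
qed

lemma invol_iff_trace: "invol g \<longleftrightarrow> g \<in> carrier G \<and> mtr (M g) = 0"
proof
  assume "invol g" then show "g \<in> carrier G \<and> mtr (M g) = 0" using mtr_square_one by (simp add: invol_def)
next
  assume g: "g \<in> carrier G \<and> mtr (M g) = 0"
  then have "msim (mmul (M g) (M g)) mone"
    using square_of_trace_zero[of "M g"] det_M[of g] unfolding msim_def by blast
  then have "g \<otimes> g = \<one>" using M_mult[of g g] M_one_iff[of "g \<otimes> g"] msim_trans g by blast
  moreover have "g \<noteq> \<one>"
  proof
    assume "g = \<one>"
    then have "msim (M g) mone" using M_one_iff g by simp
    then show False using g two by (auto simp: msim_def mone_def)
  qed
  ultimately show "invol g" using g by (simp add: invol_def)
qed

lemma invol_form:
  assumes "invol r"
  obtains a b c where "M r = (a, b, c, - a)" "- (a * a) - b * c = 1"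
proof -
  obtain a b c d where Mr: "M r = (a, b, c, d)" by (cases "M r")
  have "d = - a" using assms invol_iff_trace Mr by (simp add: eq_neg_iff_add_eq_0 add.commute)
  moreover have "mdet (M r) = 1" using assms det_M by (simp add: invol_def)
  ultimately show thesis using Mr that by simp
qed

lemma mtr_commuting_invol:
  assumes "invol g" "invol h" "g \<noteq> h" "g \<otimes> h = h \<otimes> g"
  shows "mtr (mmul (M g) (M h)) = 0"
proof -
  have "mtr (M (g \<otimes> h)) = 0" using invol_mult[OF assms] invol_iff_trace by blast
  then show ?thesis using M_mult[of g h] assms by (auto simp: msim_def invol_def)
qed

end

text \<open>The map is the cross ratio; for finite points it sends w to (c - a)(w - b) / ((c - b)(w
  - a)), and the other matrices are its limits when one point is infinity.\<close>

lemma exists_mob: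
  assumes "x \<noteq> y" "x \<noteq> z" "y \<noteq> z"
  shows "\<exists>P. mdet P \<noteq> 0 \<and> mob P x = None \<and> mob P y = Some 0 \<and> mob P z = Some (1::'l::field)"
proof (cases x)
  case None
  then obtain b c where "y = Some b" "z = Some c" "b \<noteq> c" using assms by (cases y; cases z) auto
  then show ?thesis using None by (intro exI[of _ "(1, - b, 0, c - b)"]) auto
next
  case x: (Some a)
  show ?thesis
  proof (cases y)
    case None
    then obtain c where "z = Some c" "a \<noteq> c" using assms x by (cases z) auto
    then show ?thesis using x None by (intro exI[of _ "(0, c - a, 1, - a)"]) auto
  next
    case y: (Some b)
    show ?thesis
    proof (cases z)
      case None
      then show ?thesis using x y assms by (intro exI[of _ "(1, - b, 1, - a)"]) auto
    next
      case (Some c)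
      then have n: "a \<noteq> b" "a \<noteq> c" "b \<noteq> c" using x y assms by auto
      let ?P = "(c - a, (a - c) * b, c - b, (b - c) * a)"
      have "(c - a) * ((b - c) * a) - (a - c) * b * (c - b) = (c - a) * (c - b) * (b - a)"
        by (simp add: algebra_simps)
      then have "mdet ?P \<noteq> 0" using n by simp
      moreover have "mob ?P x = None" by (simp add: x algebra_simps)
      moreover have "(c - b) * b + (b - c) * a = (c - b) * (b - a)" "(c - a) * b + (a - c) * b = 0"
        by (simp_all add: algebra_simps)
      then have "mob ?P y = Some 0" using n by (simp add: y)
      moreover have "(c - b) * c + (b - c) * a = (c - b) * (c - a)"
        "(c - a) * c + (a - c) * b = (c - b) * (c - a)" by (simp_all add: algebra_simps)
      then have "mob ?P z = Some 1" using n by (simp add: Some)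
      ultimately show ?thesis by blast
    qed
  qed
qed

lemma mob_inverse: "mdet P \<noteq> 0 \<Longrightarrow> mob (minv P) (mob P x) = x" "mdet P \<noteq> 0 \<Longrightarrow> mob P (mob (minv P) x) = x"
  by (simp_all flip: mob_mmul add: mdet_minv mmul_minv)

text \<open>An equivariant bijection carries fixed points to fixed points, so everything defined
  from them moves along.\<close>

lemma fix_action_transport:
  assumes "fix_action G act" "fix_action G act'" "inj p" "surj p"
    and eq: "\<And>g x. g \<in> carrier G \<Longrightarrow> act' g (p x) = p (act g x)"
  shows "fix_action.Stab G act' (p x) = fix_action.Stab G act x"
    "fix_action.Unip G act' (p x) = fix_action.Unip G act x"
    "fix_action.Orb G act' (p x) = p ` fix_action.Orb G act x"
proof -
  interpret A: fix_action G act by fact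
  interpret B: fix_action G act' by fact
  show S: "B.Stab (p x) = A.Stab x"
    using eq inj_eq[OF assms(3)] by (auto simp: A.Stab_def B.Stab_def)
  have "B.Fix g = p ` A.Fix g" if g: "g \<in> carrier G" for g
  proof -
    have "act' g (p y) = p y \<longleftrightarrow> act g y = y" for y using eq[OF g] inj_eq[OF assms(3)] by simp
    then show ?thesis unfolding A.Fix_def B.Fix_def using assms(4) by (auto simp: image_iff) (metis surjD)
  qed
  then have "card (B.Fix g) = card (A.Fix g)" if "g \<in> carrier G" for g
    using that assms(3) by (metis card_image inj_on_subset subset_UNIV)
  then show "B.Unip (p x) = A.Unip x"
    unfolding A.Unip_def B.Unip_def S using A.Stab_subset[of x] by (auto simp: subset_eq)
  show "B.Orb (p x) = p ` A.Orb x" using eq by (auto simp: A.Orb_def B.Orb_def image_image)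
qed

section \<open>Exclusion of orbits of length one and two\<close>

context split_rep
begin

abbreviation conj_rep :: "'l mat2 \<Rightarrow> 'a \<Rightarrow> 'l mat2" where
  "conj_rep P g \<equiv> mmul P (mmul (M g) (minv P))"

lemma mob_conj_rep:
  assumes "mdet P \<noteq> 0" "g \<in> carrier G"
  shows "mob (conj_rep P g) (mob P x) = mob P (mob (M g) x)"
proof -
  have "mob (conj_rep P g) (mob P x) = mob (mmul P (mmul (M g) (mmul (minv P) P))) x"
    using assms det_M by (simp flip: mob_mmul add: mdet_minv mmul_assoc)
  then show ?thesis using assms det_M by (simp add: mmul_minv mob_mmul)
qed

text \<open>An involution has \<open>eig2\<close> equal to -1 at each of its fixed points. The
  product is again an involution fixing \<open>x\<close>, and multiplicativity would give -1 =
  1.\<close>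

lemma no_common_fixpoint:
  assumes "invol v" "invol w" "v \<noteq> w" "v \<otimes> w = w \<otimes> v" "mob (M v) x = x" "mob (M w) x = x"
  shows False
proof -
  have e: "eig2 u x = - 1" if "invol u" "mob (M u) x = x" for u
  proof -
    have u: "u \<in> carrier G" "mtr (M u) = 0" using that invol_iff_trace by auto
    then have "- (eig (M u) x * eig (M u) x) = 1" using eig_trace[OF det_M that(2)] by simp
    then show ?thesis by (simp add: eig2_def power2_eq_square) (metis minus_minus)
  qed
  have c: "v \<in> carrier G" "w \<in> carrier G" using assms by (auto simp: invol_def)
  have "eig2 (v \<otimes> w) x = - 1" using e invol_mult[OF assms(1-4)] mob_mult assms c by simp
  moreover have "eig2 (v \<otimes> w) x = 1" using eig2_mult e assms c by simp
  ultimately have "(2::'l) = 0" by (metis add.right_inverse one_add_one)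
  then show False using two by simp
qed

text \<open>Matrices preserving the pair are diagonal or antidiagonal, and a traceless diagonal one
  commutes up to sign with both kinds. If \<open>r0\<close> or \<open>r1\<close> were diagonal it
  would commute with all generators; if both are antidiagonal, \<open>r3\<close> is forced to be
  diagonal and does so itself.\<close>

lemma no_invariant_pair_at_0:
  assumes r: "invol r0" "invol r1" "invol r2" "invol r3" "r0 \<noteq> r1" "r0 \<noteq> r3" "r1 \<noteq> r3"
    and comm: "r0 \<otimes> r2 = r2 \<otimes> r0" "r0 \<otimes> r3 = r3 \<otimes> r0" "r1 \<otimes> r3 = r3 \<otimes> r1"
    and nocentral: "\<And>w. invol w \<Longrightarrow> (\<And>r. r \<in> {r0, r1, r2, r3} \<Longrightarrow> w \<otimes> r = r \<otimes> w) \<Longrightarrow> False"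
    and pair: "\<And>r x. r \<in> {r0, r1, r2} \<Longrightarrow> x \<in> {None, Some 0} \<Longrightarrow> mob (M r) x \<in> {None, Some 0}"
  shows False
proof -
  define D where "D r \<longleftrightarrow> (\<exists>a. M r = (a, 0, 0, - a))" for r
  define N where "N r \<longleftrightarrow> (\<exists>b c. M r = (0, b, c, 0))" for r
  have DN: "D r \<or> N r" if r': "r \<in> {r0, r1, r2}" for r
  proof -
    have "invol r" using r r' by auto
    then obtain a b c where Mr: "M r = (a, b, c, - a)" "- (a * a) - b * c = 1" by (rule invol_form)
    have *: "c = 0 \<or> a = 0" using pair[OF r', of None] Mr by (auto split: if_splits)
    have "c \<noteq> 0 \<or> b = 0" using pair[OF r', of "Some 0"] Mr by (auto split: if_splits)
    then show ?thesis using * Mr by (auto simp: D_def N_def)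
  qed
  have commD: "w \<otimes> r = r \<otimes> w" if "D w" "D r \<or> N r" "invol w" "invol r" for w r
  proof -
    have "msim (mmul (M w) (M r)) (mmul (M r) (M w))"
      using that(1,2) by (auto simp: D_def N_def msim_def)
    then show ?thesis using commute_iff that by (simp add: invol_def)
  qed
  have n0: "\<not> D r0" using nocentral[OF r(1)] commD[of r0] DN r comm by auto
  have n1: "\<not> D r1" using nocentral[OF r(2)] commD[of r1] DN r comm by auto
  obtain b c where M0: "M r0 = (0, b, c, 0)" using n0 DN[of r0] by (auto simp: N_def)
  obtain b' c' where M1: "M r1 = (0, b', c', 0)" using n1 DN[of r1] by (auto simp: N_def)
  have d0: "b * c = - 1" "b' * c' = - 1"
    using det_M[of r0] det_M[of r1] r M0 M1 by (auto simp: invol_def) (metis minus_minus)+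
  obtain p q s where M3: "M r3 = (p, q, s, - p)" by (rule invol_form[OF r(4)])
  have t: "q * c + s * b = 0" "q * c' + s * b' = 0"
    using mtr_commuting_invol[OF r(1,4,6) comm(2)] mtr_commuting_invol[OF r(2,4,7) comm(3)]
    by (simp_all add: M0 M1 M3 algebra_simps)
  \<comment> \<open>The trace equations multiplied by \<open>b\<close> and \<open>b'\<close>, with
    \<open>b * c = b' * c' = - 1\<close>. A nonzero \<open>s\<close> would make \<open>b\<close> and
    \<open>b'\<close> agree up to sign, and so \<open>r0 = r1\<close>.\<close>
  have q: "q = s * b^2" "q = s * b'^2"
  proof -
    have "q * (b * c) + s * b^2 = b * (q * c + s * b)" "q * (b' * c') + s * b'^2 = b' * (q * c' + s * b')"
      by (simp_all add: algebra_simps power2_eq_square)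
    then show "q = s * b^2" "q = s * b'^2" by (simp_all add: t d0)
  qed
  have "s = 0"
  proof (rule ccontr)
    assume "s \<noteq> 0"
    then have "b^2 = b'^2" using q by simp
    then consider "b = b'" | "b = - b'" by (auto simp: power2_eq_iff)
    then have "msim (M r0) (M r1)"
    proof cases
      case 1
      then have "b' * c = b' * c'" using d0 by simp
      moreover have "b' \<noteq> 0" using d0 by auto
      ultimately have "c = c'" using mult_left_cancel by blast
      then show ?thesis using 1 M0 M1 by simp
    next
      case 2
      then have "b' * (- c) = b' * c'" using d0 by simp
      moreover have "b' \<noteq> 0" using d0 by auto
      ultimately have "- c = c'" using mult_left_cancel by blast
      then have "c = - c'" by (metis minus_minus)
      then show ?thesis using 2 M0 M1 by (simp add: msim_def)
    qed
    then show False using M_inj r by (simp add: invol_def)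
  qed
  then have "D r3" using M3 q by (simp add: D_def)
  then show False using nocentral[OF r(4)] commD[of r3] DN r by auto
qed

text \<open>A fixed point would be shared by the commuting involutions \<open>r0\<close> and
  \<open>r2\<close>; an orbit of two points is moved to infinity and 0.\<close>

lemma orbit_card_gt_2:
  assumes r: "invol r0" "invol r1" "invol r2" "invol r3" "r0 \<noteq> r1" "r0 \<noteq> r2" "r0 \<noteq> r3" "r1 \<noteq> r3"
    and comm: "r0 \<otimes> r2 = r2 \<otimes> r0" "r0 \<otimes> r3 = r3 \<otimes> r0" "r1 \<otimes> r3 = r3 \<otimes> r1"
    and nocentral: "\<And>w. invol w \<Longrightarrow> (\<And>r. r \<in> {r0, r1, r2, r3} \<Longrightarrow> w \<otimes> r = r \<otimes> w) \<Longrightarrow> False"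
    and H: "subgroup H G" "{r0, r1, r2} \<subseteq> H"
  shows "card ((\<lambda>g. mob (M g) x) ` H) > 2"
proof (rule ccontr)
  interpret H: subgroup H G by (rule H(1))
  define B where "B = (\<lambda>g. mob (M g) x) ` H"
  assume "\<not> ?thesis"
  then have le: "card B \<le> 2" by (simp add: B_def)
  have finB: "finite B" unfolding B_def using H.subset finite_G finite_subset by blast
  have xB: "x \<in> B" unfolding B_def by (rule image_eqI[of _ _ \<one>]) (simp_all add: mob_one)
  have inv: "mob (M g) y \<in> B" if "g \<in> H" "y \<in> B" for g y
  proof -
    obtain h where h: "h \<in> H" "y = mob (M h) x" using \<open>y \<in> B\<close> by (auto simp: B_def)
    then show ?thesis unfolding B_def
      using that H.subset by (intro image_eqI[of _ _ "g \<otimes> h"]) (auto simp: mob_mult)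
  qed
  show False
  proof (cases "B = {x}")
    case True
    then show False
      using no_common_fixpoint[OF r(1,3,6) comm(1), of x] inv[OF _ xB, of r0] inv[OF _ xB, of r2] H(2)
      by simp
  next
    case False
    then obtain y where y: "y \<in> B" "y \<noteq> x" using xB by blast
    have "card {x, y} = 2" using y by simp
    then have Bxy: "B = {x, y}" using le xB y finB by (metis card_seteq empty_subsetI insert_subset)
    \<comment> \<open>A third point, needed only because coordinate changes are given for
      triples.\<close>
    have "\<not> {None, Some 0, Some 1} \<subseteq> {x, y}"
    proof
      assume "{None, Some 0, Some (1::'l)} \<subseteq> {x, y}"
      then have "card {None, Some 0, Some (1::'l)} \<le> card {x, y}" by (intro card_mono) auto
      then show False using y by simp
    qed
    then obtain z where "z \<noteq> x" "z \<noteq> y" by blast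
    then obtain P where P: "mdet P \<noteq> 0" "mob P x = None" "mob P y = Some 0"
      using exists_mob[of x y z] y by blast
    interpret C: split_rep G "conj_rep P" by (rule split_rep_conj[OF P(1)])
    have pres: "mob (conj_rep P r) v \<in> {None, Some 0}"
      if rv: "r \<in> {r0, r1, r2}" "v \<in> {None, Some 0}" for r v
    proof -
      have "v = mob P x \<or> v = mob P y" using rv(2) P by auto
      then obtain u where u: "u \<in> B" "v = mob P u" using Bxy by blast
      have "mob (M r) u \<in> {x, y}" using inv[of r u] u rv H(2) Bxy by blast
      moreover have "r \<in> carrier G" using rv r by (auto simp: invol_def)
      ultimately show ?thesis using mob_conj_rep[OF P(1)] u P by auto
    qed
    show False
    proof (rule C.no_invariant_pair_at_0[OF r(1-5,7,8) comm])
      show False if "invol w" "\<And>r. r \<in> {r0, r1, r2, r3} \<Longrightarrow> w \<otimes> r = r \<otimes> w" for w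
        using that by (rule nocentral)
      show "mob (conj_rep P r) v \<in> {None, Some 0}" if "r \<in> {r0, r1, r2}" "v \<in> {None, Some 0}" for r v
        using that by (rule pres)
    qed
  qed
qed

end

section \<open>Subfields and matrices rational up to a scalar\<close>

definition subfield_set :: "'l::field set \<Rightarrow> bool" where
  "subfield_set F \<longleftrightarrow> 0 \<in> F \<and> 1 \<in> F \<and> (\<forall>x\<in>F. \<forall>y\<in>F. x + y \<in> F \<and> x * y \<in> F) \<and>
     (\<forall>x\<in>F. - x \<in> F \<and> inverse x \<in> F)"

lemma subfield_setD:
  assumes "subfield_set F"
  shows "0 \<in> F" "1 \<in> F" "x \<in> F \<Longrightarrow> y \<in> F \<Longrightarrow> x + y \<in> F" "x \<in> F \<Longrightarrow> y \<in> F \<Longrightarrow> x * y \<in> F"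
    "x \<in> F \<Longrightarrow> - x \<in> F" "x \<in> F \<Longrightarrow> inverse x \<in> F"
    "x \<in> F \<Longrightarrow> y \<in> F \<Longrightarrow> x - y \<in> F" "x \<in> F \<Longrightarrow> y \<in> F \<Longrightarrow> x / y \<in> F"
proof -
  show "0 \<in> F" "1 \<in> F" "x \<in> F \<Longrightarrow> y \<in> F \<Longrightarrow> x + y \<in> F" "x \<in> F \<Longrightarrow> y \<in> F \<Longrightarrow> x * y \<in> F"
    "x \<in> F \<Longrightarrow> - x \<in> F" "x \<in> F \<Longrightarrow> inverse x \<in> F"
    using assms by (auto simp: subfield_set_def)
  show "x - y \<in> F" if "x \<in> F" "y \<in> F"
    using assms that by (metis diff_conv_add_uminus subfield_set_def)
  show "x / y \<in> F" if "x \<in> F" "y \<in> F"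
    using assms that by (metis divide_inverse subfield_set_def)
qed

text \<open>The multipliers of \<open>T\<close> form an additive subgroup of \<open>T\<close> with more than half of its elements.\<close>

lemma subfield_of_multipliers:
  fixes T \<Lambda> :: "'l::field set"
  assumes fin: "finite T" and T: "0 \<in> T" "1 \<in> T" "\<And>s t. s \<in> T \<Longrightarrow> t \<in> T \<Longrightarrow> s + t \<in> T" "\<And>t. t \<in> T \<Longrightarrow> - t \<in> T"
    and \<Lambda>: "0 \<notin> \<Lambda>" "\<And>l t. l \<in> \<Lambda> \<Longrightarrow> t \<in> T \<Longrightarrow> l * t \<in> T" and card: "card T \<le> 2 * card \<Lambda> + 1"
  shows "subfield_set T"
proof -
  define R where "R = {r. \<forall>t\<in>T. r * t \<in> T}"
  have RT: "R \<subseteq> T"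
  proof
    fix r assume "r \<in> R"
    then have "r * 1 \<in> T" using T(2) unfolding R_def by blast
    then show "r \<in> T" by simp
  qed
  have finR: "finite R" by (rule finite_subset[OF RT fin])
  have sub: "insert 0 \<Lambda> \<subseteq> R" using \<Lambda>(2) T(1) by (auto simp: R_def)
  have finL: "finite \<Lambda>" using finite_subset[OF sub finR] by simp
  have "card \<Lambda> + 1 \<le> card R" using card_mono[OF finR sub] finL \<Lambda>(1) by simp
  then have R2: "card T < 2 * card R" using card by linarith
  have Rneg: "- r \<in> R" if "r \<in> R" for r using that T(4) by (auto simp: R_def)
  have Radd: "r + s \<in> R" if "r \<in> R" "s \<in> R" for r s using that T(3) by (auto simp: R_def distrib_right)
  have "T \<subseteq> R"
  proof (rule ccontr)
    assume "\<not> T \<subseteq> R"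
    then obtain t where t: "t \<in> T" "t \<notin> R" by blast
    have disj: "R \<inter> (\<lambda>r. t + r) ` R = {}"
    proof (rule ccontr)
      assume "R \<inter> (\<lambda>r. t + r) ` R \<noteq> {}"
      then obtain r where "r \<in> R" "t + r \<in> R" by blast
      then have "(t + r) + - r \<in> R" using Radd Rneg by blast
      then show False using t by simp
    qed
    have "R \<union> (\<lambda>r. t + r) ` R \<subseteq> T" using RT T(3) t by blast
    then have "card (R \<union> (\<lambda>r. t + r) ` R) \<le> card T" using fin by (rule card_mono[rotated])
    moreover have "card (R \<union> (\<lambda>r. t + r) ` R) = card R + card R"
      using disj finR by (simp add: card_Un_disjoint card_image)
    ultimately show False using R2 by linarith
  qed
  then have mult: "s * t \<in> T" if "s \<in> T" "t \<in> T" for s t using that by (auto simp: R_def)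
  \<comment> \<open>Multiplication by a nonzero \<open>t\<close> is injective on the finite set
    \<open>T\<close>, hence reaches 1.\<close>
  have "inverse t \<in> T" if t: "t \<in> T" for t
  proof (cases "t = 0")
    case False
    have "(\<lambda>s. t * s) ` T = T"
      using mult t fin False by (intro endo_inj_surj) (auto simp: inj_on_def)
    then obtain s where "s \<in> T" "t * s = 1" using T(2) by (metis imageE)
    then show ?thesis by (metis inverse_unique)
  qed (use T in simp)
  then show ?thesis using T mult by (auto simp: subfield_set_def)
qed

lemma mob_preserves_rational:
  assumes F: "subfield_set F" and k: "k \<noteq> 0" "k * a \<in> F" "k * b \<in> F" "k * c \<in> F" "k * d \<in> F"
    and x: "x \<in> insert None (Some ` F)"
  shows "mob (a, b, c, d) x \<in> insert None (Some ` F)"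
proof (cases x)
  case None
  have "a / c = (k * a) / (k * c)" using k by simp
  then show ?thesis using None subfield_setD(8)[OF F k(2,4)] by auto
next
  case (Some z)
  then have z: "z \<in> F" using x by auto
  have "(a * z + b) / (c * z + d) = (k * (a * z + b)) / (k * (c * z + d))" using k(1) by simp
  also have "\<dots> = (k * a * z + k * b) / (k * c * z + k * d)" by (simp add: algebra_simps)
  also have "\<dots> \<in> F" using subfield_setD[OF F] k z by simp
  finally show ?thesis using Some by auto
qed

text \<open>The images of infinity and 0 reveal the ratios of the entries. If \<open>a = 0\<close>
  these two points are swapped and the image of 1 is used instead.\<close>

lemma rational_of_mob_preserves:
  assumes F: "subfield_set F" and det: "- (a * a) - b * c = 1"
    and pres: "\<And>x. x \<in> insert None (Some ` F) \<Longrightarrow> mob (a, b, c, - a) x \<in> insert None (Some ` F)"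
  shows "\<exists>k. k \<noteq> 0 \<and> k * a \<in> F \<and> k * b \<in> F \<and> k * c \<in> F"
proof (cases "c = 0")
  case True
  then have a: "a \<noteq> 0" using det by auto
  have "b / - a \<in> F" using pres[of "Some 0"] subfield_setD(1)[OF F] True a by auto
  then have "b / a \<in> F" using subfield_setD(5)[OF F] by fastforce
  then show ?thesis using a True subfield_setD(1,2)[OF F]
    by (intro exI[of _ "1 / a"]) (simp add: field_simps)
next
  case c: False
  have ac: "a / c \<in> F" using pres[of None] c by auto
  have "b / c \<in> F"
  proof (cases "a = 0")
    case True
    then show ?thesis using pres[of "Some 1"] subfield_setD(2)[OF F] c by auto
  next
    case False
    then have "b / - a \<in> F" using pres[of "Some 0"] subfield_setD(1)[OF F] by auto
    then have "- ((b / - a) * (a / c)) \<in> F" using ac subfield_setD[OF F] by blast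
    then show ?thesis using False by simp
  qed
  then show ?thesis using ac c subfield_setD(2)[OF F]
    by (intro exI[of _ "1 / c"]) (simp add: field_simps)
qed

text \<open>The equations \<open>e\<close> say that the cross product vanishes, so A = k A'. Because
  A' squares to -1, the product A A' is -k, which is where \<open>k\<close> comes from; comparing
  determinants gives \<open>k * k = 1\<close>.\<close>

lemma proportional_traceless:
  fixes a b c a' b' c' :: "'l::field"
  assumes d: "- (a * a) - b * c = 1" "- (a' * a') - b' * c' = 1"
    and e: "c * b' = b * c'" "b * a' = a * b'" "a * c' = c * a'"
  shows "msim (a, b, c, - a) (a', b', c', - a')"
proof -
  define k where "k = - (a * a' + b * c')"
  have n: "a' * a' + b' * c' = - 1" using d(2) by (metis minus_add_distrib minus_minus uminus_add_conv_diff add.commute diff_conv_add_uminus)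
  have "k * a' = - (a * (a' * a')) - (b * a') * c'" by (simp add: k_def algebra_simps)
  also have "\<dots> = - a * (a' * a' + b' * c')" unfolding e by (simp add: algebra_simps)
  finally have ka: "k * a' = a" unfolding n by simp
  have "k * b' = - (a * b') * a' - b * (b' * c')" by (simp add: k_def algebra_simps)
  also have "\<dots> = - b * (a' * a' + b' * c')" unfolding e(2)[symmetric] by (simp add: algebra_simps)
  finally have kb: "k * b' = b" unfolding n by simp
  have "k * c' = - (a * c') * a' - (b * c') * c'" by (simp add: k_def algebra_simps)
  also have "\<dots> = - c * (a' * a' + b' * c')" unfolding e(3) e(1)[symmetric] by (simp add: algebra_simps)
  finally have kc: "k * c' = c" unfolding n by simp
  have "k * k * (a' * a' + b' * c') = (k * a') * (k * a') + (k * b') * (k * c')" by (simp add: algebra_simps)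
  also have "\<dots> = a * a + b * c" by (simp add: ka kb kc)
  also have "\<dots> = - 1" using d(1) by (metis minus_add_distrib minus_minus uminus_add_conv_diff add.commute diff_conv_add_uminus)
  finally have "k * k = 1" unfolding n by simp
  then have "k = 1 \<or> k = - 1" by (metis mult_1_right power2_eq_iff power2_eq_square)
  then show ?thesis using ka kb kc by (auto simp: msim_def)
qed

text \<open>A traceless matrix orthogonal to two independent ones is proportional to their cross product.\<close>

lemma rational_cross_product:
  fixes a b c a' b' c' p q s :: "'l::field"
  assumes F: "subfield_set F" and two: "(2::'l) \<noteq> 0"
    and d: "- (a * a) - b * c = 1" "- (a' * a') - b' * c' = 1" "- (p * p) - q * s = 1"
    and ns: "\<not> msim (a, b, c, - a) (a', b', c', - a')"
    and o: "2 * a * p + c * q + b * s = 0" "2 * a' * p + c' * q + b' * s = 0"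
    and k: "k \<noteq> 0" "k * a \<in> F" "k * b \<in> F" "k * c \<in> F"
    and l: "l \<noteq> 0" "l * a' \<in> F" "l * b' \<in> F" "l * c' \<in> F"
  shows "\<exists>m. m \<noteq> 0 \<and> m * p \<in> F \<and> m * q \<in> F \<and> m * s \<in> F"
proof -
  \<comment> \<open>The cross product of the coefficient vectors \<open>(2 * a, c, b)\<close> and
    \<open>(2 * a', c', b')\<close> of the equations \<open>o\<close>; the facts \<open>z\<close>
    say that \<open>(p, q, s)\<close> is parallel to it.\<close>
  define u1 u2 u3 where "u1 = c * b' - b * c'" and "u2 = 2 * (b * a' - a * b')" and "u3 = 2 * (a * c' - c * a')"
  have z: "p * u2 = q * u1" "p * u3 = s * u1" "s * u2 = q * u3"
  proof -
    have "q * u1 - p * u2 = b' * (2 * a * p + c * q + b * s) - b * (2 * a' * p + c' * q + b' * s)"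
      by (simp add: u1_def u2_def algebra_simps)
    then show "p * u2 = q * u1" by (simp add: o)
    have "p * u3 - s * u1 = c' * (2 * a * p + c * q + b * s) - c * (2 * a' * p + c' * q + b' * s)"
      by (simp add: u1_def u3_def algebra_simps)
    then show "p * u3 = s * u1" by (simp add: o)
    have "s * u2 - q * u3 = 2 * a' * (2 * a * p + c * q + b * s) - 2 * a * (2 * a' * p + c' * q + b' * s)"
      by (simp add: u2_def u3_def algebra_simps)
    then show "s * u2 = q * u3" by (simp add: o)
  qed
  have u0: "u1 \<noteq> 0 \<or> u2 \<noteq> 0 \<or> u3 \<noteq> 0"
    using proportional_traceless[OF d(1,2)] ns two by (auto simp: u1_def u2_def u3_def)
  have twoF: "2 \<in> F" using subfield_setD(3)[OF F subfield_setD(2)[OF F] subfield_setD(2)[OF F]] by simp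
  have uF: "k * l * u1 \<in> F" "k * l * u2 \<in> F" "k * l * u3 \<in> F"
  proof -
    have "k * l * u1 = (k * c) * (l * b') - (k * b) * (l * c')"
      "k * l * u2 = 2 * ((k * b) * (l * a') - (k * a) * (l * b'))"
      "k * l * u3 = 2 * ((k * a) * (l * c') - (k * c) * (l * a'))"
      by (simp_all add: u1_def u2_def u3_def algebra_simps)
    then show "k * l * u1 \<in> F" "k * l * u2 \<in> F" "k * l * u3 \<in> F"
      using subfield_setD[OF F] k l twoF by simp_all
  qed
  \<comment> \<open>\<open>k * l\<close> makes the cross product rational, since it is bilinear in
    the two matrices; \<open>v / w\<close> passes from it to \<open>(p, q, s)\<close>.\<close>
  have main: ?thesis if "v \<noteq> 0" "w \<noteq> 0" "v * p = w * u1" "v * q = w * u2" "v * s = w * u3" for v w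
  proof (intro exI[of _ "k * l * v / w"] conjI)
    show "k * l * v / w \<noteq> 0" using that k l by simp
    have "k * l * v / w * p = k * l * u1" "k * l * v / w * q = k * l * u2" "k * l * v / w * s = k * l * u3"
      using that by (simp_all add: field_simps)
    then show "k * l * v / w * p \<in> F" "k * l * v / w * q \<in> F" "k * l * v / w * s \<in> F"
      using uF by simp_all
  qed
  have p0: "p \<noteq> 0 \<or> q \<noteq> 0" using d(3) by auto
  consider "u1 \<noteq> 0" | "u1 = 0" "u2 \<noteq> 0" | "u1 = 0" "u2 = 0" "u3 \<noteq> 0" using u0 by blast
  then show ?thesis
  proof cases
    case 1
    have "p \<noteq> 0"
    proof
      assume "p = 0"
      then have "q = 0" "s = 0" using z 1 by auto
      then show False using d(3) \<open>p = 0\<close> by simp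
    qed
    then show ?thesis using main[of u1 p] 1 z by (simp add: mult.commute)
  next
    case 2
    then have "p = 0" using z by simp
    then have "q \<noteq> 0" using p0 by simp
    then show ?thesis using main[of u2 q] 2 z \<open>p = 0\<close> by (simp add: mult.commute)
  next
    case 3
    then have "q = 0" "p = 0" using z by auto
    then show ?thesis using p0 by simp
  qed
qed

lemma card_distinct_triples:
  assumes "finite S" "card S = n"
  shows "card {(a, b, c). a \<in> S \<and> b \<in> S \<and> c \<in> S \<and> a \<noteq> b \<and> a \<noteq> c \<and> b \<noteq> c} = n * ((n - 1) * (n - 2))"
proof -
  have "{(a, b, c). a \<in> S \<and> b \<in> S \<and> c \<in> S \<and> a \<noteq> b \<and> a \<noteq> c \<and> b \<noteq> c} =
      (SIGMA a:S. SIGMA b:S - {a}. S - {a, b})" by auto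
  moreover have "card (SIGMA a:S. SIGMA b:S - {a}. S - {a, b}) = (\<Sum>a\<in>S. \<Sum>b\<in>S - {a}. card (S - {a, b}))"
    using assms by (simp add: card_SigmaI)
  moreover have "card (S - {a, b}) = n - 2" if "a \<in> S" "b \<in> S - {a}" for a b
  proof -
    have "card (S - {a, b}) = card S - card {a, b}" using that by (intro card_Diff_subset) auto
    then show ?thesis using that assms by auto
  qed
  ultimately show ?thesis using assms by simp
qed

section \<open>Orbits that are projective lines over a subfield\<close>

context split_rep
begin

text \<open>In these coordinates \<open>Unip\<close> at infinity consists of translations by a set
  \<open>T\<close>, and the orbit is infinity together with \<open>T\<close>. Enough scalings make
  \<open>T\<close> a subfield, over which \<open>r0\<close>, \<open>r1\<close> and then
  \<open>r3\<close> are rational up to a scalar. The index bound compares the number of triples of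
  distinct orbit points with the order of \<open>H\<close>.\<close>

lemma card_le_of_linear_type_at_0:
  assumes H: "subgroup H G" and r: "invol r0" "invol r1" "invol r3" "r0 \<in> H" "r1 \<in> H"
    "r0 \<noteq> r1" "r0 \<noteq> r3" "r1 \<noteq> r3"
    and comm: "r0 \<otimes> r3 = r3 \<otimes> r0" "r1 \<otimes> r3 = r3 \<otimes> r1"
    and gen: "\<And>K. subgroup K G \<Longrightarrow> H \<subseteq> K \<Longrightarrow> r3 \<in> K \<Longrightarrow> carrier G \<subseteq> K"
    and lin: "fix_action.linear_type (G\<lparr>carrier := H\<rparr>) (\<lambda>g. mob (M g)) None"
    and pts: "{Some 0, Some 1} \<subseteq> fix_action.Orb (G\<lparr>carrier := H\<rparr>) (\<lambda>g. mob (M g)) None"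
  shows "card (carrier G) \<le> 2 * card H"
proof -
  interpret S: subgroup H G by (rule H)
  interpret H: split_rep "G\<lparr>carrier := H\<rparr>" M by (rule split_rep_subgroup[OF H])
  define Om where "Om = H.Orb None"
  define U where "U = H.Unip None"
  define m where "m = card U"
  have lin': "m \<ge> 3" "card Om = m + 1" "m * m \<le> 2 * card (H.Stab None) + m"
    using lin by (simp_all add: H.linear_type_def m_def U_def Om_def)
  have finOm: "finite Om" by (simp add: Om_def H.finite_Orb)
  have OmI: "mob (M g) x \<in> Om" if "g \<in> H" "x \<in> Om" for g x
    using H.act_Orb[of g x None] that by (simp add: Om_def)
  have NOm: "None \<in> Om" by (simp add: Om_def)
  have SH: "g \<in> H.Stab None \<longleftrightarrow> g \<in> H \<and> mob (M g) None = None" for g by (simp add: H.Stab_def)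
  have Umem: "g \<in> U \<longleftrightarrow> g \<in> H \<and> mob (M g) None = None \<and> eig2 g None = 1" for g
  proof -
    have "g \<in> U \<longleftrightarrow> g \<in> H \<and> mob (M g) None = None \<and> (g = \<one> \<or> card (H.Fix g) = 1)"
      by (auto simp: U_def H.Unip_def H.Stab_def)
    also have "\<dots> \<longleftrightarrow> g \<in> H \<and> mob (M g) None = None \<and> eig2 g None = 1"
      using unip_iff[of g None] S.subset by (auto simp: H.Fix_def)
    finally show ?thesis .
  qed
  have Utri: "g \<in> U \<longleftrightarrow> g \<in> H \<and> (\<exists>t. msim (M g) (1, t, 0, 1))" for g
  proof -
    obtain a b c d where Mg: "M g = (a, b, c, d)" by (cases "M g")
    show ?thesis
    proof
      assume g: "g \<in> U"
      then have gH: "g \<in> H" and c: "c = 0" and a2: "a^2 = 1"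
        using Umem Mg by (auto simp: eig2_def split: if_splits)
      have ad: "a * d = 1" using det_M[of g] gH S.subset Mg c by auto
      have "a = 1 \<or> a = - 1" using a2 by (simp add: power2_eq_1_iff)
      then show "g \<in> H \<and> (\<exists>t. msim (M g) (1, t, 0, 1))"
      proof
        assume "a = 1"
        then show ?thesis using gH Mg c ad by (auto simp: msim_def)
      next
        assume "a = - 1"
        then have "d = - 1" using ad by (metis minus_minus mult_minus1)
        then have "msim (M g) (1, - b, 0, 1)" using \<open>a = - 1\<close> Mg c by (simp add: msim_def)
        then show ?thesis using gH by blast
      qed
    next
      assume "g \<in> H \<and> (\<exists>t. msim (M g) (1, t, 0, 1))"
      then obtain t where g: "g \<in> H" and t: "msim (M g) (1, t, 0, 1)" by blast
      have "mob (M g) None = None" using mob_msim[OF t] by simp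
      moreover have "eig2 g None = 1" using t by (auto simp: msim_def eig2_def)
      ultimately show "g \<in> U" using Umem g by blast
    qed
  qed
  define T where "T = {t. \<exists>g\<in>H. msim (M g) (1, t, 0, 1)}"
  \<comment> \<open>The translation length. The factor \<open>a\<close>, which is 1 or -1, undoes
    the sign of the chosen matrix.\<close>
  define tau where "tau g = (case M g of (a, b, c, d) \<Rightarrow> b * a)" for g
  have tau: "tau g = t" if "msim (M g) (1, t, 0, 1)" for g t
    using that by (auto simp: tau_def msim_def)
  have tauT: "tau ` U = T"
  proof (intro equalityI subsetI)
    fix t assume "t \<in> T"
    then obtain g where "g \<in> H" "msim (M g) (1, t, 0, 1)" by (auto simp: T_def)
    then show "t \<in> tau ` U" using tau Utri by (intro image_eqI[of _ _ g]) auto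
  next
    fix t assume "t \<in> tau ` U"
    then obtain g where "g \<in> U" "t = tau g" by blast
    then show "t \<in> T" using tau Utri by (auto simp: T_def)
  qed
  have "inj_on tau U"
  proof (rule inj_onI)
    fix g h assume gh: "g \<in> U" "h \<in> U" "tau g = tau h"
    obtain t where t: "msim (M g) (1, t, 0, 1)" using Utri gh by blast
    obtain t' where t': "msim (M h) (1, t', 0, 1)" using Utri gh by blast
    have tt: "t' = t" using tau[OF t] tau[OF t'] gh by simp
    have "msim (M g) (M h)" by (rule msim_trans[OF t msim_sym[OF t'[unfolded tt]]])
    moreover have "g \<in> carrier G" "h \<in> carrier G" using Umem gh S.subset by auto
    ultimately show "g = h" using M_inj by blast
  qed
  then have cardT: "card T = m" using card_image[of tau U] by (simp add: tauT m_def)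
  then have finT: "finite T" using lin'(1) by (intro card_ge_0_finite) simp
  have "insert None (Some ` T) \<subseteq> Om"
  proof -
    have "Some t \<in> Om" if "t \<in> T" for t
    proof -
      obtain g where g: "g \<in> H" "msim (M g) (1, t, 0, 1)" using \<open>t \<in> T\<close> by (auto simp: T_def)
      have "mob (M g) (Some 0) = Some t" using mob_msim[OF g(2)] by simp
      moreover have "Some 0 \<in> Om" using pts by (simp add: Om_def)
      ultimately show ?thesis using OmI[OF g(1), of "Some 0"] by simp
    qed
    then show ?thesis using NOm by blast
  qed
  \<comment> \<open>These points already number \<open>m + 1\<close>, the length of the
    orbit.\<close>
  moreover have "card (insert None (Some ` T)) = m + 1" using finT cardT by (simp add: card_image)
  ultimately have Om: "Om = insert None (Some ` T)"
    using card_subset_eq[OF finOm, of "insert None (Some ` T)"] lin'(2) by simp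
  have T01: "0 \<in> T" "1 \<in> T" using pts Om by (auto simp: Om_def[symmetric])
  have Tadd: "s + t \<in> T" if "s \<in> T" "t \<in> T" for s t
  proof -
    obtain g h where g: "g \<in> H" "msim (M g) (1, s, 0, 1)" and h: "h \<in> H" "msim (M h) (1, t, 0, 1)"
      using \<open>s \<in> T\<close> \<open>t \<in> T\<close> by (auto simp: T_def)
    have "msim (M (g \<otimes> h)) (mmul (1, s, 0, 1) (1, t, 0, 1))"
      using msim_trans[OF M_mult msim_mmul[OF g(2) h(2)]] g h S.subset by blast
    then have "msim (M (g \<otimes> h)) (1, s + t, 0, 1)" by (simp add: add.commute)
    then show ?thesis using g h S.m_closed unfolding T_def by blast
  qed
  have Tneg: "- t \<in> T" if "t \<in> T" for t
  proof -
    obtain g where g: "g \<in> H" "msim (M g) (1, t, 0, 1)" using \<open>t \<in> T\<close> by (auto simp: T_def)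
    have "msim (M (inv g)) (minv (M g))" using M_inv g S.subset by blast
    also have "msim (minv (M g)) (1, - t, 0, 1)" using g(2) by (auto simp: msim_def)
    finally (msim_trans) show ?thesis using g S.m_inv_closed unfolding T_def by blast
  qed
  \<comment> \<open>The scaling factors: conjugating the translation by \<open>t\<close> with an
    element of \<open>Stab None\<close> gives the translation by \<open>eig2\<close> times
    \<open>t\<close>.\<close>
  define \<Lambda> where "\<Lambda> = (\<lambda>g. eig2 g None) ` H.Stab None"
  have tri: "\<exists>a b d. M g = (a, b, 0, d) \<and> a * d = 1" if "g \<in> H.Stab None" for g
  proof -
    obtain a b c d where Mg: "M g = (a, b, c, d)" by (cases "M g")
    have gH: "g \<in> H" "mob (M g) None = None" using that SH by auto
    then have "c = 0" using Mg by (simp split: if_splits)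
    then show ?thesis using det_M[of g] gH S.subset Mg by auto
  qed
  have \<Lambda>0: "0 \<notin> \<Lambda>"
  proof
    assume "0 \<in> \<Lambda>"
    then obtain g where "g \<in> H.Stab None" "eig2 g None = 0" by (auto simp: \<Lambda>_def)
    then show False using tri[of g] by (auto simp: eig2_def)
  qed
  have \<Lambda>T: "l * t \<in> T" if "l \<in> \<Lambda>" "t \<in> T" for l t
  proof -
    obtain g where g: "g \<in> H.Stab None" "l = eig2 g None" using \<open>l \<in> \<Lambda>\<close> by (auto simp: \<Lambda>_def)
    obtain u where u: "u \<in> H" "msim (M u) (1, t, 0, 1)" using \<open>t \<in> T\<close> by (auto simp: T_def)
    obtain a b d where Mg: "M g = (a, b, 0, d)" "a * d = 1" using tri[OF g(1)] by blast
    have gH: "g \<in> H" using g SH by blast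
    have c: "g \<in> carrier G" "u \<in> carrier G" using gH u S.subset by auto
    have "msim (M (g \<otimes> u)) (mmul (M g) (1, t, 0, 1))"
      using msim_trans[OF M_mult[OF c] msim_mmul[OF msim_refl u(2)]] .
    then have "msim (M (g \<otimes> u \<otimes> inv g)) (mmul (mmul (M g) (1, t, 0, 1)) (minv (M g)))"
      using msim_trans[OF M_mult msim_mmul[OF _ M_inv[OF c(1)]]] c by simp
    also have "mmul (mmul (M g) (1, t, 0, 1)) (minv (M g)) = (1, l * t, 0, 1)"
      using Mg by (simp add: g(2) eig2_def power2_eq_square algebra_simps)
    finally show ?thesis using u gH unfolding T_def by blast
  qed
  \<comment> \<open>The fibres of \<open>eig2\<close> on the stabiliser are translates of parts of
    its kernel \<open>U\<close>.\<close>
  have "card (H.Stab None) \<le> card \<Lambda> * m"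
  proof -
    define A where "A l = {g \<in> H.Stab None. eig2 g None = l}" for l
    have A: "card (A l) \<le> m" if "l \<in> \<Lambda>" for l
    proof -
      obtain g0 where g0: "g0 \<in> H" "mob (M g0) None = None" "eig2 g0 None = l"
        using \<open>l \<in> \<Lambda>\<close> SH by (auto simp: \<Lambda>_def)
      have g0G: "g0 \<in> carrier G" using g0 S.subset by blast
      have fx: "mob (M (inv g0)) None = None" using g0 g0G by (metis act_inv_cancel(1))
      have l: "eig2 (inv g0) None * l = 1"
        using eig2_mult[of "inv g0" g0 None] g0 g0G eig2_one by simp
      have "inv g0 \<otimes> g \<in> U" if "g \<in> A l" for g
      proof -
        have g: "g \<in> H" "mob (M g) None = None" "eig2 g None = l" using that SH by (auto simp: A_def)
        then have "g \<in> carrier G" using S.subset by blast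
        then show ?thesis using Umem g g0 g0G l fx by (simp add: mob_mult eig2_mult)
      qed
      moreover have "inj_on (\<lambda>g. inv g0 \<otimes> g) (A l)"
        using g0G S.subset SH by (auto simp: inj_on_def A_def)
      ultimately show ?thesis unfolding m_def U_def by (intro card_inj_on_le[OF _ _ H.finite_Unip]) auto
    qed
    have "H.Stab None = (\<Union>l\<in>\<Lambda>. A l)" by (auto simp: A_def \<Lambda>_def)
    moreover have "finite \<Lambda>" by (simp add: \<Lambda>_def H.finite_Stab)
    ultimately have "card (H.Stab None) \<le> (\<Sum>l\<in>\<Lambda>. card (A l))" using card_UN_le by metis
    also have "\<dots> \<le> (\<Sum>l\<in>\<Lambda>. m)" by (rule sum_mono[OF A])
    finally show ?thesis by simp
  qed
  \<comment> \<open>Here the inequality in \<open>linear_type\<close> becomes the requirement that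
    the scalings, together with 0, make up more than half of \<open>T\<close>.\<close>
  then have "m * m \<le> m * (2 * card \<Lambda> + 1)" using lin'(3) by (simp add: algebra_simps)
  then have "m \<le> 2 * card \<Lambda> + 1" using lin'(1) by (subst (asm) nat_mult_le_cancel1) simp_all
  then have cT: "card T \<le> 2 * card \<Lambda> + 1" using cardT by simp
  have F: "subfield_set T"
    by (rule subfield_of_multipliers[OF finT T01], rule Tadd, assumption+, rule Tneg, assumption,
        rule \<Lambda>0, rule \<Lambda>T, assumption+, rule cT)
  obtain a b c where M0: "M r0 = (a, b, c, - a)" "- (a * a) - b * c = 1"
    by (rule invol_form[OF r(1)])
  obtain a' b' c' where M1: "M r1 = (a', b', c', - a')" "- (a' * a') - b' * c' = 1"
    by (rule invol_form[OF r(2)])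
  obtain p q s where M3: "M r3 = (p, q, s, - p)" "- (p * p) - q * s = 1"
    by (rule invol_form[OF r(3)])
  have "\<exists>k. k \<noteq> 0 \<and> k * a \<in> T \<and> k * b \<in> T \<and> k * c \<in> T"
  proof (rule rational_of_mob_preserves[OF F M0(2)])
    show "mob (a, b, c, - a) x \<in> insert None (Some ` T)" if "x \<in> insert None (Some ` T)" for x
      using OmI[OF r(4), of x] that by (simp only: M0(1) Om)
  qed
  then obtain k where k: "k \<noteq> 0" "k * a \<in> T" "k * b \<in> T" "k * c \<in> T" by blast
  have "\<exists>k. k \<noteq> 0 \<and> k * a' \<in> T \<and> k * b' \<in> T \<and> k * c' \<in> T"
  proof (rule rational_of_mob_preserves[OF F M1(2)])
    show "mob (a', b', c', - a') x \<in> insert None (Some ` T)" if "x \<in> insert None (Some ` T)" for x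
      using OmI[OF r(5), of x] that by (simp only: M1(1) Om)
  qed
  then obtain l where l: "l \<noteq> 0" "l * a' \<in> T" "l * b' \<in> T" "l * c' \<in> T" by blast
  have ns: "\<not> msim (a, b, c, - a) (a', b', c', - a')"
    using M_inj[of r0 r1] r M0 M1 by (auto simp: invol_def)
  have o: "2 * a * p + c * q + b * s = 0" "2 * a' * p + c' * q + b' * s = 0"
    using mtr_commuting_invol[OF r(1,3,7) comm(1)] mtr_commuting_invol[OF r(2,3,8) comm(2)]
    by (simp_all add: M0 M1 M3 algebra_simps)
  obtain v where v: "v \<noteq> 0" "v * p \<in> T" "v * q \<in> T" "v * s \<in> T"
    using rational_cross_product[OF F two M0(2) M1(2) M3(2) ns o k l] by blast
  have v': "v * - p \<in> T" using subfield_setD(5)[OF F v(2)] by simp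
  have r3Om: "mob (M r3) x \<in> Om" if "x \<in> Om" for x
    using mob_preserves_rational[OF F v v'] that by (simp only: M3(1) Om)
  define K where "K = {g \<in> carrier G. \<forall>x\<in>Om. mob (M g) x \<in> Om}"
  have "subgroup K G"
  proof (rule subgroupI)
    show "K \<noteq> {}" using mob_one by (auto simp: K_def intro!: exI[of _ \<one>])
    fix g assume g: "g \<in> K"
    have gG: "g \<in> carrier G" using g by (simp add: K_def)
    have "(\<lambda>x. mob (M g) x) ` Om = Om"
      using g finOm act_eq_iff[OF gG] by (intro endo_inj_surj) (auto simp: K_def inj_on_def)
    then have "mob (M (inv g)) y \<in> Om" if "y \<in> Om" for y
      using that gG by (metis act_inv_cancel(1) imageE)
    then show "inv g \<in> K" using gG by (simp add: K_def)
  qed (auto simp: K_def mob_mult)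
  moreover have "H \<subseteq> K" using OmI S.subset by (auto simp: K_def)
  moreover have "r3 \<in> K" using r3Om r(3) by (simp add: K_def invol_def)
  ultimately have GK: "carrier G \<subseteq> K" by (rule gen)
  \<comment> \<open>A nontrivial element fixes at most two points, so an element is determined by
    the images of infinity, 0 and 1, which lie in \<open>Om\<close>.\<close>
  have "card (carrier G) \<le> card {(a, b, c). a \<in> Om \<and> b \<in> Om \<and> c \<in> Om \<and> a \<noteq> b \<and> a \<noteq> c \<and> b \<noteq> c}"
  proof (rule card_inj_on_le)
    define tr where "tr g = (mob (M g) None, mob (M g) (Some 0), mob (M g) (Some 1))" for g
    show "inj_on tr (carrier G)"
    proof (rule inj_onI)
      fix g h assume gh: "g \<in> carrier G" "h \<in> carrier G" "tr g = tr h"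
      then have "mob (M (inv h \<otimes> g)) y = y" if "y \<in> {None, Some 0, Some 1}" for y
        using that by (auto simp: mob_mult tr_def)
      then have "inv h \<otimes> g = \<one>"
        using eq_one_of_fixes_three[of "inv h \<otimes> g" None "Some 0" "Some 1"] gh by simp
      then show "g = h" using gh by (metis inv_closed inv_equality inv_inv)
    qed
    have "Some 0 \<in> Om" "Some 1 \<in> Om" using Om T01 by auto
    then show "tr ` carrier G \<subseteq> {(a, b, c). a \<in> Om \<and> b \<in> Om \<and> c \<in> Om \<and> a \<noteq> b \<and> a \<noteq> c \<and> b \<noteq> c}"
      using GK NOm act_eq_iff by (auto simp: tr_def K_def subset_eq)
    have "{(a, b, c). a \<in> Om \<and> b \<in> Om \<and> c \<in> Om \<and> a \<noteq> b \<and> a \<noteq> c \<and> b \<noteq> c} \<subseteq> Om \<times> Om \<times> Om" by auto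
    then show "finite {(a, b, c). a \<in> Om \<and> b \<in> Om \<and> c \<in> Om \<and> a \<noteq> b \<and> a \<noteq> c \<and> b \<noteq> c}"
      using finOm by (meson finite_SigmaI finite_subset)
  qed
  also have "\<dots> = (m + 1) * (m * (m - 1))"
    using card_distinct_triples[OF finOm lin'(2)] by simp
  \<comment> \<open>\<open>m * (m - 1) \<le> 2 * card (H.Stab None)\<close> is the inequality in
    \<open>linear_type\<close> once more.\<close>
  also have "\<dots> \<le> (m + 1) * (2 * card (H.Stab None))"
    using lin'(3) by (intro mult_left_mono) (simp_all add: diff_mult_distrib2)
  also have "\<dots> = 2 * card H" using H.orbit_stab[of None] lin'(2) by (simp add: Om_def)
  finally show ?thesis .
qed

text \<open>The orbit has at least four points, so three of them can be moved to infinity, 0 and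
  1.\<close>

lemma card_le_of_linear_type:
  assumes H: "subgroup H G" and r: "invol r0" "invol r1" "invol r3" "r0 \<in> H" "r1 \<in> H"
    "r0 \<noteq> r1" "r0 \<noteq> r3" "r1 \<noteq> r3"
    and comm: "r0 \<otimes> r3 = r3 \<otimes> r0" "r1 \<otimes> r3 = r3 \<otimes> r1"
    and gen: "\<And>K. subgroup K G \<Longrightarrow> H \<subseteq> K \<Longrightarrow> r3 \<in> K \<Longrightarrow> carrier G \<subseteq> K"
    and lin: "fix_action.linear_type (G\<lparr>carrier := H\<rparr>) (\<lambda>g. mob (M g)) x"
  shows "card (carrier G) \<le> 2 * card H"
proof -
  interpret H: split_rep "G\<lparr>carrier := H\<rparr>" M by (rule split_rep_subgroup[OF H])
  have c4: "card (H.Orb x) \<ge> 4" using lin by (simp add: H.linear_type_def)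
  have "\<not> H.Orb x \<subseteq> {x}"
  proof
    assume "H.Orb x \<subseteq> {x}"
    then have "card (H.Orb x) \<le> card {x}" by (intro card_mono) auto
    then show False using c4 by simp
  qed
  then obtain y where y: "y \<in> H.Orb x" "y \<noteq> x" by blast
  have "\<not> H.Orb x \<subseteq> {x, y}"
  proof
    assume "H.Orb x \<subseteq> {x, y}"
    then have "card (H.Orb x) \<le> card {x, y}" by (intro card_mono) auto
    then show False using c4 y by simp
  qed
  then obtain z where z: "z \<in> H.Orb x" "z \<noteq> x" "z \<noteq> y" by blast
  obtain P where P: "mdet P \<noteq> 0" "mob P x = None" "mob P y = Some 0" "mob P z = Some 1"
    using exists_mob[of x y z] y z by blast
  interpret C: split_rep G "conj_rep P" by (rule split_rep_conj[OF P(1)])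
  interpret CH: split_rep "G\<lparr>carrier := H\<rparr>" "conj_rep P" by (rule C.split_rep_subgroup[OF H])
  have inj: "inj (mob P)" by (rule inj_on_inverseI[of _ "mob (minv P)"]) (simp add: mob_inverse P)
  have surj: "surj (mob P)" by (rule surjI[of _ "mob (minv P)"]) (simp add: mob_inverse P)
  have HG: "g \<in> carrier G" if "g \<in> H" for g using subgroup.subset[OF H] that by blast
  have eq: "mob (conj_rep P g) (mob P v) = mob P (mob (M g) v)" if "g \<in> carrier (G\<lparr>carrier := H\<rparr>)" for g v
    using mob_conj_rep[OF P(1)] HG that by simp
  note t = fix_action_transport[where p = "mob P" and x = x,
      OF H.fix_action_axioms CH.fix_action_axioms inj surj]
  have tr: "CH.Stab None = H.Stab x" "CH.Unip None = H.Unip x" "CH.Orb None = mob P ` H.Orb x"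
    unfolding P(2)[symmetric] by (rule t, erule eq)+
  have ci: "card (mob P ` A) = card A" for A by (rule card_image[OF inj_on_subset[OF inj]]) simp
  show ?thesis
  proof (rule C.card_le_of_linear_type_at_0[OF H r comm])
    show "CH.linear_type None"
      using lin unfolding CH.linear_type_def H.linear_type_def by (simp only: tr ci)
    have "{mob P y, mob P z} \<subseteq> mob P ` H.Orb x" using y(1) z(1) by blast
    then show "{Some 0, Some 1} \<subseteq> CH.Orb None" by (simp only: tr P)
  qed (rule gen)
qed

theorem three_generator_cases:
  fixes r0 r1 r2 r3
  defines "H \<equiv> generate G {r0, r1, r2}"
  assumes r: "invol r0" "invol r1" "invol r2" "invol r3" "r0 \<noteq> r1" "r0 \<noteq> r2" "r0 \<noteq> r3" "r1 \<noteq> r2" "r1 \<noteq> r3"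
    and comm: "r0 \<otimes> r2 = r2 \<otimes> r0" "r0 \<otimes> r3 = r3 \<otimes> r0" "r1 \<otimes> r3 = r3 \<otimes> r1"
    and gen: "generate G {r0, r1, r2, r3} = carrier G"
    and nocentral: "\<And>w. invol w \<Longrightarrow> (\<And>r. r \<in> {r0, r1, r2, r3} \<Longrightarrow> w \<otimes> r = r \<otimes> w) \<Longrightarrow> False"
  shows "G\<lparr>carrier := H\<rparr> \<cong> sym_group 4 \<or> G\<lparr>carrier := H\<rparr> \<cong> alt_group 5 \<or> card (carrier G) \<le> 2 * card H"
proof -
  have rG: "{r0, r1, r2} \<subseteq> carrier G" using r by (auto simp: invol_def)
  have H: "subgroup H G" unfolding H_def by (rule generate_is_subgroup[OF rG])
  have rH: "{r0, r1, r2} \<subseteq> H" unfolding H_def using generate.incl[of _ "{r0, r1, r2}" G] by blast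
  interpret H: split_rep "G\<lparr>carrier := H\<rparr>" M by (rule split_rep_subgroup[OF H])
  have ri: "H.invol r0" "H.invol r1" "H.invol r2"
    using r rH by (auto simp: H.invol_def invol_def)
  have comm': "r0 \<otimes>\<^bsub>G\<lparr>carrier := H\<rparr>\<^esub> r2 = r2 \<otimes>\<^bsub>G\<lparr>carrier := H\<rparr>\<^esub> r0" using comm by simp
  have genH: "generate (G\<lparr>carrier := H\<rparr>) {r0, r1, r2} = carrier (G\<lparr>carrier := H\<rparr>)"
    using generate_consistent[OF rH H] by (simp add: H_def)
  have prim: "card (H.Orb x) > 2" for x
  proof -
    have "card ((\<lambda>g. mob (M g) x) ` H) > 2"
    proof (rule orbit_card_gt_2[OF r(1-7,9) comm _ H rH])
      show False if "invol w" "\<And>r. r \<in> {r0, r1, r2, r3} \<Longrightarrow> w \<otimes> r = r \<otimes> w" for w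
        using that by (rule nocentral)
    qed
    then show ?thesis by (simp add: H.Orb_def)
  qed
  have gen': "carrier G \<subseteq> K" if K: "subgroup K G" "H \<subseteq> K" "r3 \<in> K" for K
  proof -
    have "{r0, r1, r2, r3} \<subseteq> K" using K rH by blast
    then show ?thesis using generate_subgroup_incl[OF _ K(1)] gen by blast
  qed
  \<comment> \<open>\<open>iso_alt_5\<close> asks for odd stabilisers at all points outside one
    orbit, including points with trivial stabiliser.\<close>
  have nonpole: "odd (card (H.Stab y))" if "y \<notin> H.Poles" for y
  proof -
    have "card (H.Stab y) = 1" using that H.card_Stab_pos[of y] by (simp add: H.Poles_def)
    then show ?thesis by simp
  qed
  consider "H.polyhedral 3 12" | "H.polyhedral 4 24" | "H.polyhedral 5 60" | "H.icosahedral3"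
    | x where "H.linear_type x" using H.orbit_cases[OF prim] by blast
  then show ?thesis
  proof cases
    case 1
    \<comment> \<open>Otherwise \<open>r0\<close> would commute with \<open>r1\<close>, hence with
      all four generators.\<close>
    have "r1 \<noteq> r0 \<otimes> r2"
    proof
      assume r1: "r1 = r0 \<otimes> r2"
      have c: "r0 \<in> carrier G" "r2 \<in> carrier G" using r by (auto simp: invol_def)
      have "r0 \<otimes> r1 = r0 \<otimes> (r2 \<otimes> r0)" by (simp only: r1 comm(1))
      also have "\<dots> = r1 \<otimes> r0" unfolding r1 using c by (simp only: m_assoc)
      finally have "r0 \<otimes> r1 = r1 \<otimes> r0" .
      then show False using nocentral[OF r(1)] comm by auto
    qed
    then show ?thesis using H.not_polyhedral_3[OF 1 ri comm'] r by simp
  next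
    case 2
    then show ?thesis using H.iso_sym_4 prim by blast
  next
    case 3
    then obtain x1 x2 x3 where x: "card (H.Stab x1) = 2" "card (H.Stab x2) = 3" "card (H.Stab x3) = 5"
      "H.Poles = H.Orb x1 \<union> H.Orb x2 \<union> H.Orb x3" and h: "card (carrier (G\<lparr>carrier := H\<rparr>)) = 60"
      and U: "\<And>y. card (H.Unip y) = 1"
      unfolding H.polyhedral_def by blast
    have odd: "odd (card (H.Stab y))" if "y \<notin> H.Orb x1" for y
      using nonpole[of y] that x H.card_Stab_Orb by (cases "y \<in> H.Poles") fastforce+
    show ?thesis using H.iso_alt_5[OF h odd _ _ ri comm' r(6) genH, of x1] x U by simp
  next
    case 4
    then obtain x1 x2 where x: "card (H.Stab x1) = 6" "card (H.Unip x1) = 3" "card (H.Stab x2) = 5"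
      "H.Poles = H.Orb x1 \<union> H.Orb x2" and h: "card (carrier (G\<lparr>carrier := H\<rparr>)) = 60"
      unfolding H.icosahedral3_def by blast
    have odd: "odd (card (H.Stab y))" if "y \<notin> H.Orb x1" for y
      using nonpole[of y] that x H.card_Stab_Orb by (cases "y \<in> H.Poles") fastforce+
    show ?thesis using H.iso_alt_5[OF h odd _ _ ri comm' r(6) genH, of x1] x by simp
  next
    case 5
    have "card (carrier G) \<le> 2 * card H"
    proof (rule card_le_of_linear_type[OF H r(1,2,4) _ _ r(5,7,9) comm(2,3) _ 5])
      show "r0 \<in> H" "r1 \<in> H" using rH by auto
    qed (rule gen')
    then show ?thesis by blast
  qed
qed

end

section \<open>Projective special linear groups\<close>

lemma msim_char_2:
  fixes A B :: "'l::field mat2"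
  assumes "(2::'l) = 0"
  shows "msim A B \<longleftrightarrow> A = B"
proof -
  have "- x = x" for x :: 'l
  proof (rule minus_unique)
    have "x + x = 2 * x" by (rule mult_2[symmetric])
    then show "x + x = 0" using assms by simp
  qed
  then have "mneg B = B" by (cases B) simp
  then show ?thesis by (simp add: msim_def)
qed

text \<open>Comparing entries with the upper transvection gives \<open>c = 0\<close> and
  \<open>a = d\<close>, with the lower one \<open>b = 0\<close>. The sign -1 is impossible in odd
  characteristic, as it would make a diagonal entry vanish along with an off-diagonal one. The lemma
  yields the centre of \<open>SL\<close> and, thanks to the sign, that of
  \<open>PSL\<close>.\<close>

lemma msim_mone_of_commutes_transvections:
  fixes A :: "'l::field mat2"
  assumes det: "mdet A = 1"
    and up: "msim (mmul A (1, 1, 0, 1)) (mmul (1, 1, 0, 1) A)"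
    and lo: "msim (mmul A (1, 0, 1, 1)) (mmul (1, 0, 1, 1) A)"
  shows "msim A mone"
proof -
  obtain a b c d where A: "A = (a, b, c, d)" by (cases A)
  have ad: "a * d - b * c = 1" using det A by simp
  have "c = 0 \<and> a = d"
  proof (cases "(2::'l) = 0")
    case True
    then have "mmul A (1, 1, 0, 1) = mmul (1, 1, 0, 1) A" using up msim_char_2 by blast
    then show ?thesis by (simp add: A)
  next
    case False
    have "\<not> (c = - c \<and> a = - (a + c))"
    proof
      assume *: "c = - c \<and> a = - (a + c)"
      then have "2 * c = 0" by (metis add.right_inverse mult_2)
      then have "c = 0" using False by simp
      then have "2 * a = 0" using * by (metis add.right_inverse add.right_neutral mult_2)
      then have "a = 0" using False by simp
      then show False using ad \<open>c = 0\<close> by simp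
    qed
    then show ?thesis using up by (auto simp: A msim_def)
  qed
  moreover have "b = 0"
  proof (cases "(2::'l) = 0")
    case True
    then have "mmul A (1, 0, 1, 1) = mmul (1, 0, 1, 1) A" using lo msim_char_2 by blast
    then show ?thesis by (simp add: A)
  next
    case False
    have "\<not> (b = - b \<and> d = - (b + d))"
    proof
      assume *: "b = - b \<and> d = - (b + d)"
      then have "2 * b = 0" by (metis add.right_inverse mult_2)
      then have "b = 0" using False by simp
      then have "2 * d = 0" using * by (metis add.right_inverse add.left_neutral mult_2)
      then have "d = 0" using False by simp
      then show False using ad \<open>b = 0\<close> by simp
    qed
    then show ?thesis using lo by (auto simp: A msim_def)
  qed
  ultimately have "(a - 1) * (a + 1) = 0" "A = (a, 0, 0, a)" using ad A by (auto simp: algebra_simps)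
  moreover have "a = 1 \<or> a = - 1" using calculation(1) by (auto simp: eq_neg_iff_add_eq_0)
  ultimately show ?thesis by (auto simp: msim_def mone_def)
qed

text \<open>Surjectivity makes \<open>G\<close> the whole of PSL_2 over the field of matrix entries,
  so transvections are available in \<open>G\<close>.\<close>

locale psl_onto = psl_rep G M for G :: "('a, 'b) monoid_scheme" (structure) and M :: "'a \<Rightarrow> 'l::field mat2" +
  assumes M_onto: "mdet A = 1 \<Longrightarrow> \<exists>g\<in>carrier G. msim (M g) A"
begin

lemma trivial_center:
  assumes w: "w \<in> carrier G" and comm: "\<And>g. g \<in> carrier G \<Longrightarrow> w \<otimes> g = g \<otimes> w"
  shows "w = \<one>"
proof -
  have "msim (mmul (M w) A) (mmul A (M w))" if A: "mdet A = 1" for A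
  proof -
    obtain g where g: "g \<in> carrier G" "msim (M g) A" using M_onto[OF A] by blast
    have "msim (mmul (M w) A) (mmul (M w) (M g))" by (rule msim_mmul[OF msim_refl msim_sym[OF g(2)]])
    also have "msim \<dots> (mmul (M g) (M w))" using commute_iff[OF w g(1)] comm[OF g(1)] by simp
    also (msim_trans) have "msim \<dots> (mmul A (M w))" by (rule msim_mmul[OF g(2) msim_refl])
    finally (msim_trans) show ?thesis .
  qed
  then have "msim (M w) mone"
    using msim_mone_of_commutes_transvections[OF det_M[OF w]] by simp
  then show ?thesis using M_one_iff w by blast
qed

lemma no_central_invol:
  assumes "generate G R = carrier G" "R \<subseteq> carrier G" "invol w" "\<And>r. r \<in> R \<Longrightarrow> w \<otimes> r = r \<otimes> w"
  shows False
proof -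
  have w: "w \<in> carrier G" "w \<noteq> \<one>" using assms(3) by (auto simp: invol_def)
  define C where "C = {g \<in> carrier G. cnj g w = w}"
  have "subgroup C G" unfolding C_def by (rule subgroup_centralizer[OF w(1)])
  moreover have "R \<subseteq> C"
    using assms(2,4) w by (auto simp: C_def cnj_eq_self_iff subset_eq)
  ultimately have "carrier G \<subseteq> C" using generate_subgroup_incl[of R C] assms(1) by simp
  have cw: "w \<otimes> g = g \<otimes> w" if "g \<in> carrier G" for g
  proof -
    have "g \<in> C" using \<open>carrier G \<subseteq> C\<close> that by blast
    then have "g \<in> carrier G" "cnj g w = w" by (simp_all add: C_def)
    then show ?thesis using cnj_eq_self_iff[of g w] w(1) by simp
  qed
  have "w = \<one>" by (rule trivial_center[OF w(1)], rule cw)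
  then show False using w(2) by simp
qed

text \<open>Every transvection is a square, hence lies in every subgroup of index two.\<close>

lemma eq_of_card_le_double:
  assumes two: "(2::'l) \<noteq> 0" and H: "subgroup H G" and le: "card (carrier G) \<le> 2 * card H"
  shows "H = carrier G"
proof -
  interpret H: subgroup H G by (rule H)
  have finH: "finite H" using finite_subset[OF H.subset finite_G] .
  \<comment> \<open>If \<open>g\<close> lies outside \<open>H\<close>, then \<open>H\<close> and its
    coset by \<open>g\<close> fill the group, and \<open>g \<otimes> g\<close> cannot lie in that
    coset.\<close>
  have sq: "g \<otimes> g \<in> H" if g: "g \<in> carrier G" for g
  proof (cases "g \<in> H")
    case False
    have disj: "H \<inter> (\<lambda>h. g \<otimes> h) ` H = {}"
    proof (rule ccontr)
      assume "H \<inter> (\<lambda>h. g \<otimes> h) ` H \<noteq> {}"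
      then obtain h where h: "h \<in> H" "g \<otimes> h \<in> H" by blast
      then have "g \<otimes> h \<otimes> inv h \<in> H" by simp
      then show False using False h g H.subset by (simp add: m_assoc subset_eq)
    qed
    have sub: "H \<union> (\<lambda>h. g \<otimes> h) ` H \<subseteq> carrier G" using g H.subset by auto
    have "card ((\<lambda>h. g \<otimes> h) ` H) = card H"
      using g H.subset by (intro card_image) (auto simp: inj_on_def subset_eq)
    then have "card (H \<union> (\<lambda>h. g \<otimes> h) ` H) = 2 * card H"
      using disj finH by (simp add: card_Un_disjoint)
    then have "H \<union> (\<lambda>h. g \<otimes> h) ` H = carrier G"
      using le card_mono[OF finite_G sub] by (intro card_subset_eq[OF finite_G sub]) linarith
    moreover have "g \<otimes> g \<notin> (\<lambda>h. g \<otimes> h) ` H" using False g H.subset by (auto simp: subset_eq)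
    ultimately show ?thesis using g by blast
  qed simp
  have trans: "\<exists>h\<in>H. msim (M h) A" if A: "mdet B = 1" "A = mmul B B" for A B
  proof -
    obtain g where g: "g \<in> carrier G" "msim (M g) B" using M_onto A by blast
    have "msim (M (g \<otimes> g)) A" unfolding A(2) by (rule msim_trans[OF M_mult[OF g(1) g(1)] msim_mmul[OF g(2) g(2)]])
    then show ?thesis using sq g by blast
  qed
  have up: "\<exists>h\<in>H. msim (M h) (1, t, 0, 1)" for t
    by (rule trans[of "(1, t / 2, 0, 1)"]) (use two in \<open>auto simp flip: mult_2\<close>)
  have lo: "\<exists>h\<in>H. msim (M h) (1, 0, t, 1)" for t
    by (rule trans[of "(1, 0, t / 2, 1)"]) (use two in \<open>auto simp flip: mult_2\<close>)
  \<comment> \<open>A matrix with \<open>c \<noteq> 0\<close> is a product of an upper, a lower and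
    an upper transvection with parameters \<open>(a - 1) / c\<close>, \<open>c\<close> and
    \<open>(d - 1) / c\<close>.\<close>
  have main: "g \<in> H" if g: "g \<in> carrier G" "M g = (a, b, c, d)" "c \<noteq> 0" for g a b c d
  proof -
    obtain u where u: "u \<in> H" "msim (M u) (1, (a - 1) / c, 0, 1)" using up by blast
    obtain v where v: "v \<in> H" "msim (M v) (1, 0, c, 1)" using lo by blast
    obtain w where w: "w \<in> H" "msim (M w) (1, (d - 1) / c, 0, 1)" using up by blast
    have c: "u \<in> carrier G" "v \<in> carrier G" "w \<in> carrier G" using u v w H.subset by auto
    have "msim (M (u \<otimes> v)) (mmul (1, (a - 1) / c, 0, 1) (1, 0, c, 1))"
      by (rule msim_trans[OF M_mult[OF c(1,2)] msim_mmul[OF u(2) v(2)]])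
    then have "msim (M (u \<otimes> v \<otimes> w)) (mmul (mmul (1, (a - 1) / c, 0, 1) (1, 0, c, 1)) (1, (d - 1) / c, 0, 1))"
      using msim_trans[OF M_mult msim_mmul[OF _ w(2)]] c by blast
    also have "mmul (mmul (1, (a - 1) / c, 0, 1) (1, 0, c, 1)) (1, (d - 1) / c, 0, 1) = M g"
    proof -
      have "a * d - b * c = 1" using det_M[OF g(1)] g(2) by simp
      then have "b * c = a * d - 1" by (simp add: algebra_simps)
      then have "b = (a * d - 1) / c" using g(3) by (simp add: eq_divide_eq)
      then have "a * ((d - 1) / c) + (a - 1) / c = b"
        by (simp add: add_divide_distrib[symmetric] algebra_simps)
      then show ?thesis using g by simp
    qed
    finally have "u \<otimes> v \<otimes> w = g" by (rule M_inj[rotated 2]) (use c g in auto)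
    moreover have "u \<otimes> v \<otimes> w \<in> H" using u v w by simp
    ultimately show ?thesis by simp
  qed
  have "g \<in> H" if g: "g \<in> carrier G" for g
  proof -
    obtain a b c d where Mg: "M g = (a, b, c, d)" by (cases "M g")
    show ?thesis
    proof (cases "c = 0")
      case False then show ?thesis by (rule main[OF g Mg])
    next
      case True
      then have a0: "a \<noteq> 0" using det_M[OF g] Mg by auto
      \<comment> \<open>A lower transvection on the left puts \<open>a \<noteq> 0\<close> into the
        corner, which reduces to the case before.\<close>
      obtain v where v: "v \<in> H" "msim (M v) (1, 0, 1, 1)" using lo by blast
      have vG: "v \<in> carrier G" using v H.subset by blast
      have "msim (M (v \<otimes> g)) (mmul (1, 0, 1, 1) (M g))"
        by (rule msim_trans[OF M_mult[OF vG g] msim_mmul[OF v(2) msim_refl]])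
      then have ms: "msim (M (v \<otimes> g)) (a, b, a, b + d)" by (simp add: Mg True)
      obtain a' b' c' d' where M': "M (v \<otimes> g) = (a', b', c', d')" by (cases "M (v \<otimes> g)")
      then have "c' \<noteq> 0" using ms a0 by (auto simp: msim_def)
      then have "v \<otimes> g \<in> H" using main[OF _ M'] vG g by simp
      then have "inv v \<otimes> (v \<otimes> g) \<in> H" using v by simp
      then show ?thesis using vG g by (simp flip: m_assoc)
    qed
  qed
  then show ?thesis using H.subset by blast
qed

text \<open>In characteristic two an involution has the form \<open>(a, b, c, a)\<close> with
  \<open>(b, c)\<close> nonzero. Two of them commute exactly when their vectors
  \<open>(b, c)\<close> are proportional, which is transitive for nonzero vectors.\<close>

lemma commuting_invol_trans_char_2:
  assumes two: "(2::'l) = 0" and u: "invol u" and v: "invol v" and w: "invol w"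
    and comm: "u \<otimes> v = v \<otimes> u" "v \<otimes> w = w \<otimes> v"
  shows "u \<otimes> w = w \<otimes> u"
proof -
  note sim = msim_char_2[OF two]
  have form: "\<exists>a b c. M r = (a, b, c, a) \<and> (b \<noteq> 0 \<or> c \<noteq> 0)" if r: "invol r" for r
  proof -
    have rG: "r \<in> carrier G" "r \<noteq> \<one>" "r \<otimes> r = \<one>" using r by (auto simp: invol_def)
    have ns: "\<not> msim (M r) mone" using M_one_iff rG by blast
    have "msim (mmul (M r) (M r)) mone"
      using msim_trans[OF msim_sym[OF M_mult[of r r]], of mone] M_one_iff[of \<one>] rG by simp
    then have tr: "mtr (M r) = 0" by (rule trace_zero_of_square[OF det_M[OF rG(1)] _ ns])
    obtain a b c d where Mr: "M r = (a, b, c, d)" by (cases "M r")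
    have "d = a"
    proof -
      have "a + d = a + a" using tr Mr two mult_2[of a] by simp
      then show ?thesis by simp
    qed
    moreover have "b \<noteq> 0 \<or> c \<noteq> 0"
    proof (rule ccontr)
      assume bc: "\<not> (b \<noteq> 0 \<or> c \<noteq> 0)"
      then have "a * a = 1" using det_M[OF rG(1)] Mr \<open>d = a\<close> by simp
      then have "(a - 1) * (a + 1) = 0" by (simp add: algebra_simps)
      then have "a = 1 \<or> a = - 1" by (auto simp: eq_neg_iff_add_eq_0)
      then show False using ns Mr \<open>d = a\<close> bc by (auto simp: msim_def mone_def)
    qed
    ultimately show ?thesis using Mr by blast
  qed
  obtain a b c where Mu: "M u = (a, b, c, a)" using form[OF u] by blast
  obtain a' b' c' where Mv: "M v = (a', b', c', a')" "b' \<noteq> 0 \<or> c' \<noteq> 0" using form[OF v] by blast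
  obtain p q s where Mw: "M w = (p, q, s, p)" using form[OF w] by blast
  have G: "u \<in> carrier G" "v \<in> carrier G" "w \<in> carrier G" using u v w by (auto simp: invol_def)
  have "mmul (M u) (M v) = mmul (M v) (M u)" "mmul (M v) (M w) = mmul (M w) (M v)"
    using iffD1[OF commute_iff[OF G(1,2)] comm(1)] iffD1[OF commute_iff[OF G(2,3)] comm(2)]
    by (simp_all only: sim)
  then have "fst (mmul (M u) (M v)) = fst (mmul (M v) (M u))" "fst (mmul (M v) (M w)) = fst (mmul (M w) (M v))"
    by simp_all
  then have "a * a' + b * c' = a' * a + b' * c" "a' * p + b' * s = p * a' + q * c'"
    by (simp_all only: Mu Mv Mw mmul.simps fst_conv)
  then have e1: "b * c' = b' * c" and e2: "b' * s = q * c'"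
    by (simp_all only: mult.commute[of a a'] mult.commute[of p a'] add_left_cancel)
  have "b' * (b * s) = b * (b' * s)" by (rule mult.left_commute)
  also have "\<dots> = q * (b * c')" by (simp only: e2 mult.left_commute)
  also have "\<dots> = b' * (q * c)" by (simp only: e1 mult.left_commute)
  finally have f1: "b' * (b * s) = b' * (q * c)" .
  have "c' * (b * s) = (b * c') * s" by (simp only: mult_ac)
  also have "\<dots> = (b' * c) * s" by (simp only: e1)
  also have "\<dots> = c * (b' * s)" by (simp only: mult_ac)
  also have "\<dots> = c * (q * c')" by (simp only: e2)
  also have "\<dots> = c' * (q * c)" by (simp only: mult_ac)
  finally have f2: "c' * (b * s) = c' * (q * c)" .
  have bs: "b * s = q * c" using f1 f2 Mv(2) mult_left_cancel by blast
  have "a * p + b * s = p * a + q * c" by (simp only: bs mult.commute[of a p])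
  moreover have "c * q + a * p = s * b + p * a"
    by (simp only: mult.commute[of c q] bs[symmetric] mult.commute[of b s] mult.commute[of a p])
  moreover have "a * q + b * p = p * b + q * a" "c * p + a * s = s * a + p * c"
    by (simp_all add: algebra_simps)
  ultimately have "mmul (M u) (M w) = mmul (M w) (M u)" by (simp only: Mu Mw mmul.simps)
  then show ?thesis using commute_iff[OF G(1,3)] by simp
qed

end

section \<open>From the quotient group to matrices over the algebraic closure\<close>

fun map_mat2 :: "('k \<Rightarrow> 'l) \<Rightarrow> 'k mat2 \<Rightarrow> 'l mat2" where
  "map_mat2 f (a, b, c, d) = (f a, f b, f c, f d)"

lemma psl_rep_to_ac:
  assumes "psl_rep G M"
  shows "psl_rep G (\<lambda>g. map_mat2 to_ac (M g))"
proof -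
  interpret psl_rep G M by fact
  have mult: "map_mat2 to_ac (mmul A B) = mmul (map_mat2 to_ac A) (map_mat2 to_ac B)" for A B :: "'c mat2"
    by (cases A; cases B) simp
  have neg: "map_mat2 to_ac (mneg A) = mneg (map_mat2 to_ac A)" for A :: "'c mat2" by (cases A) simp
  have inj: "map_mat2 to_ac A = map_mat2 to_ac B \<longleftrightarrow> A = B" for A B :: "'c mat2"
    by (cases A; cases B) simp
  have sim: "msim (map_mat2 to_ac A) (map_mat2 to_ac B) \<longleftrightarrow> msim A B" for A B :: "'c mat2"
    by (simp add: msim_def inj flip: neg)
  have one: "mone = map_mat2 to_ac (mone :: 'c mat2)" by (simp add: mone_def)
  have det: "mdet (map_mat2 to_ac A) = to_ac (mdet A)" for A :: "'c mat2" by (cases A) simp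
  show ?thesis
    by unfold_locales (simp_all add: finite_G det det_M sim M_mult M_one_iff one flip: mult)
qed

definition mat2_of :: "'f::field ^ 2 ^ 2 \<Rightarrow> 'f mat2" where
  "mat2_of A = (A $ 1 $ 1, A $ 1 $ 2, A $ 2 $ 1, A $ 2 $ 2)"

lemma mat2_of_mult: "mat2_of (A ** B) = mmul (mat2_of A) (mat2_of B)"
  by (simp add: mat2_of_def matrix_matrix_mult_def sum_2)

lemma mat2_of_inj: "mat2_of A = mat2_of B \<longleftrightarrow> A = B"
  by (auto simp: mat2_of_def vec_eq_iff forall_2)

lemma mdet_mat2_of: "mdet (mat2_of A) = det A"
  by (simp add: mat2_of_def det_2)

lemma mat2_of_surj: "\<exists>A. mat2_of A = B"
proof -
  obtain a b c d where "B = (a, b, c, d)" by (cases B)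
  then have "mat2_of (vector [vector [a, b], vector [c, d]]) = B" by (simp add: mat2_of_def)
  then show ?thesis by blast
qed

lemma center_SL_2: "A \<in> center SL \<longleftrightarrow> msim (mat2_of A) (mone :: 'f::field mat2)"
proof
  assume A: "A \<in> center SL"
  then have d: "mdet (mat2_of A) = 1" by (simp add: center_def SL_def mdet_mat2_of)
  have "mmul (mat2_of A) B = mmul B (mat2_of A)" if "mdet B = 1" for B
  proof -
    obtain B' where B': "mat2_of B' = B" using mat2_of_surj by blast
    then have "B' \<in> carrier SL" using that by (auto simp: SL_def mdet_mat2_of[symmetric])
    then have "B' ** A = A ** B'" using A by (simp add: center_def SL_def)
    then show ?thesis using mat2_of_mult[of A B'] mat2_of_mult[of B' A] B' by simp
  qed
  then show "msim (mat2_of A) mone"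
    by (intro msim_mone_of_commutes_transvections[OF d]) simp_all
next
  assume A: "msim (mat2_of A) mone"
  have "mmul (mat2_of A) B = mmul B (mat2_of A)" for B using A by (auto simp: msim_def)
  then have "mat2_of (A ** B) = mat2_of (B ** A)" for B by (simp add: mat2_of_mult)
  moreover have "det A = 1" using A by (auto simp: msim_def simp flip: mdet_mat2_of)
  ultimately show "A \<in> center SL" by (simp add: center_def SL_def mat2_of_inj)
qed

text \<open>\<open>M\<close> picks an arbitrary matrix from the coset belonging to a group element.
  The centre of \<open>SL\<close> consists of plus and minus the identity, so the choice is unique
  up to sign and \<open>M\<close> is multiplicative only in the sense of
  \<open>msim\<close>.\<close>

lemma psl_onto_of_iso:
  fixes G :: "('a, 'b) monoid_scheme"
  assumes G: "group G" and iso: "G \<cong> (PSL :: ('f::{field,finite} ^ 2 ^ 2) set monoid)"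
  shows "\<exists>M :: 'a \<Rightarrow> 'f mat2. psl_onto G M"
proof -
  interpret G: group G by (rule G)
  interpret S: group "SL :: ('f ^ 2 ^ 2) monoid" by (rule group_SL)
  let ?N = "center (SL :: ('f ^ 2 ^ 2) monoid)"
  interpret N: normal ?N SL by (rule center_normal[OF group_SL])
  obtain \<psi> where \<psi>: "\<psi> \<in> iso G (PSL :: ('f ^ 2 ^ 2) set monoid)" using iso by (auto simp: is_iso_def)
  have hom: "\<psi> \<in> hom G (PSL :: ('f ^ 2 ^ 2) set monoid)" and
    bij: "bij_betw \<psi> (carrier G) (carrier (PSL :: ('f ^ 2 ^ 2) set monoid))"
    using \<psi> by (auto simp: iso_def)
  have finG: "finite (carrier G)" using bij_betw_finite[OF bij] by simp
  have cos: "\<psi> g \<in> rcosets\<^bsub>SL\<^esub> ?N" if "g \<in> carrier G" for g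
    using bij_betwE[OF bij] that by (auto simp: PSL_def FactGroup_def)
  define rep where "rep g = (SOME A. A \<in> \<psi> g)" for g
  have rep: "rep g \<in> carrier SL \<and> \<psi> g = ?N #>\<^bsub>SL\<^esub> rep g" if g: "g \<in> carrier G" for g
  proof -
    obtain A where A: "A \<in> carrier SL" "\<psi> g = ?N #>\<^bsub>SL\<^esub> A" using cos[OF g] by (auto simp: RCOSETS_def)
    then have "\<psi> g \<noteq> {}" using S.rcos_self[OF A(1) N.subgroup_axioms] by auto
    then have "rep g \<in> \<psi> g" unfolding rep_def by (simp add: some_in_eq)
    then show ?thesis
      using A S.repr_independence[OF _ A(1) N.subgroup_axioms] S.r_coset_subset_G[OF N.subset A(1)] by blast
  qed
  have mem: "msim (mat2_of B) (mat2_of A)" if A: "A \<in> carrier SL" and B: "B \<in> ?N #>\<^bsub>SL\<^esub> A" for A B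
  proof -
    obtain z where z: "z \<in> ?N" "B = z ** A" using B by (auto simp: r_coset_def SL_def)
    have "msim (mmul (mat2_of z) (mat2_of A)) (mmul mone (mat2_of A))"
      using z(1) by (intro msim_mmul) (simp_all add: center_SL_2)
    then show ?thesis using z(2) by (simp add: mat2_of_mult)
  qed
  have self: "A \<in> ?N #>\<^bsub>SL\<^esub> A" if "A \<in> carrier SL" for A
    using S.rcos_self[OF that N.subgroup_axioms] .
  have "psl_onto G (\<lambda>g. mat2_of (rep g))"
  proof (intro psl_onto.intro psl_rep.intro psl_rep_axioms.intro psl_onto_axioms.intro)
    show "group G" by (rule G)
    show "finite (carrier G)" by (rule finG)
    show "mdet (mat2_of (rep g)) = 1" if "g \<in> carrier G" for g
      using rep[OF that] by (simp add: mdet_mat2_of SL_def)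
    show "msim (mat2_of (rep (g \<otimes>\<^bsub>G\<^esub> h))) (mmul (mat2_of (rep g)) (mat2_of (rep h)))"
      if g: "g \<in> carrier G" and h: "h \<in> carrier G" for g h
    proof -
      have "\<psi> (g \<otimes>\<^bsub>G\<^esub> h) = \<psi> g \<otimes>\<^bsub>PSL\<^esub> \<psi> h" using hom g h by (simp add: hom_def)
      also have "\<dots> = \<psi> g <#>\<^bsub>SL\<^esub> \<psi> h" by (simp add: PSL_def FactGroup_def)
      also have "\<dots> = ?N #>\<^bsub>SL\<^esub> (rep g \<otimes>\<^bsub>SL\<^esub> rep h)" using rep[OF g] rep[OF h] N.rcos_sum by simp
      finally have "rep (g \<otimes>\<^bsub>G\<^esub> h) \<in> ?N #>\<^bsub>SL\<^esub> (rep g \<otimes>\<^bsub>SL\<^esub> rep h)"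
        using rep[of "g \<otimes>\<^bsub>G\<^esub> h"] self g h by auto
      then have "msim (mat2_of (rep (g \<otimes>\<^bsub>G\<^esub> h))) (mat2_of (rep g \<otimes>\<^bsub>SL\<^esub> rep h))"
        using mem rep[OF g] rep[OF h] by simp
      then show ?thesis by (simp add: mat2_of_mult SL_def)
    qed
    show "msim (mat2_of (rep g)) mone \<longleftrightarrow> g = \<one>\<^bsub>G\<^esub>" if g: "g \<in> carrier G" for g
    proof -
      have one: "\<psi> \<one>\<^bsub>G\<^esub> = ?N" using hom_one[OF hom G group_PSL] by (simp add: PSL_def FactGroup_def)
      have "msim (mat2_of (rep g)) mone \<longleftrightarrow> rep g \<in> ?N" by (simp add: center_SL_2)
      also have "\<dots> \<longleftrightarrow> \<psi> g = ?N"
        using rep[OF g] S.coset_join1[OF _ _ N.subgroup_axioms] S.coset_join2[OF _ N.subgroup_axioms] by metis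
      also have "\<dots> \<longleftrightarrow> \<psi> g = \<psi> \<one>\<^bsub>G\<^esub>" by (simp only: one)
      also have "\<dots> \<longleftrightarrow> g = \<one>\<^bsub>G\<^esub>"
        by (rule inj_on_eq_iff[OF bij_betw_imp_inj_on[OF bij] g G.one_closed])
      finally show ?thesis .
    qed
    show "\<exists>g\<in>carrier G. msim (mat2_of (rep g)) A" if A: "mdet A = 1" for A
    proof -
      obtain B where B: "mat2_of B = A" using mat2_of_surj by blast
      then have BS: "B \<in> carrier SL" using A by (auto simp: SL_def mdet_mat2_of[symmetric])
      then have "?N #>\<^bsub>SL\<^esub> B \<in> carrier PSL" by (auto simp: PSL_def FactGroup_def RCOSETS_def)
      then obtain g where g: "g \<in> carrier G" "\<psi> g = ?N #>\<^bsub>SL\<^esub> B" using bij by (metis bij_betw_def imageE)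
      then have "rep g \<in> ?N #>\<^bsub>SL\<^esub> B" using rep[OF g(1)] self by metis
      then show ?thesis using mem[OF BS] g B by blast
    qed
  qed
  then show ?thesis by blast
qed

theorem mainTheorem5:
  fixes G :: "('a, 'b) monoid_scheme" (structure)
    and q :: nat
    and \<rho>\<^sub>0 \<rho>\<^sub>1 \<rho>\<^sub>2 \<rho>\<^sub>3 :: 'a
  assumes "primepow q"
    and "CARD('f::{field,finite}) = q"
    and "group G"
    and "G \<cong> (PSL :: ('f ^ 2 ^ 2) set monoid)"
    and "string_representation G 4 [\<rho>\<^sub>0, \<rho>\<^sub>1, \<rho>\<^sub>2, \<rho>\<^sub>3]"
  defines "G\<^sub>3 \<equiv> G\<lparr>carrier := generate G {\<rho>\<^sub>0, \<rho>\<^sub>1, \<rho>\<^sub>2}\<rparr>"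
  shows "G\<^sub>3 \<cong> sym_group 4 \<or> G\<^sub>3 \<cong> alt_group 5 \<or> G\<^sub>3 \<cong> G"
proof -
  obtain M :: "'a \<Rightarrow> 'f mat2" where M: "psl_onto G M" using psl_onto_of_iso[OF assms(3,4)] by blast
  interpret psl_onto G M by (rule M)
  let ?g = "[\<rho>\<^sub>0, \<rho>\<^sub>1, \<rho>\<^sub>2, \<rho>\<^sub>3]"
  have s: "distinct ?g" "\<And>r. r \<in> set ?g \<Longrightarrow> involution G r" "generate G (set ?g) = carrier G"
    "\<And>i j. i < 4 \<Longrightarrow> j < 4 \<Longrightarrow> \<bar>int i - int j\<bar> > 1 \<Longrightarrow> ?g ! i \<otimes> ?g ! j = ?g ! j \<otimes> ?g ! i"
    using assms(5) unfolding string_representation_def by blast+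
  have inv: "invol r" if "r \<in> set ?g" for r
  proof -
    have r: "r \<in> carrier G" "ord r = 2" using s(2)[OF that] by (auto simp: involution_def)
    then have "r [^] (2::nat) = \<one>" using pow_ord_eq_1 by metis
    moreover have "r \<noteq> \<one>" using ord_eq_1 r by fastforce
    ultimately show ?thesis using r by (simp add: invol_def numeral_2_eq_2)
  qed
  have r: "invol \<rho>\<^sub>0" "invol \<rho>\<^sub>1" "invol \<rho>\<^sub>2" "invol \<rho>\<^sub>3" using inv by auto
  have d: "\<rho>\<^sub>0 \<noteq> \<rho>\<^sub>1" "\<rho>\<^sub>0 \<noteq> \<rho>\<^sub>2" "\<rho>\<^sub>0 \<noteq> \<rho>\<^sub>3" "\<rho>\<^sub>1 \<noteq> \<rho>\<^sub>2" "\<rho>\<^sub>1 \<noteq> \<rho>\<^sub>3" using s(1) by auto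
  have comm: "\<rho>\<^sub>0 \<otimes> \<rho>\<^sub>2 = \<rho>\<^sub>2 \<otimes> \<rho>\<^sub>0" "\<rho>\<^sub>0 \<otimes> \<rho>\<^sub>3 = \<rho>\<^sub>3 \<otimes> \<rho>\<^sub>0" "\<rho>\<^sub>1 \<otimes> \<rho>\<^sub>3 = \<rho>\<^sub>3 \<otimes> \<rho>\<^sub>1"
    using s(4)[of 0 2] s(4)[of 0 3] s(4)[of 1 3] by (simp_all add: numeral_2_eq_2 numeral_3_eq_3)
  have gen: "generate G {\<rho>\<^sub>0, \<rho>\<^sub>1, \<rho>\<^sub>2, \<rho>\<^sub>3} = carrier G" using s(3) by simp
  have sub: "{\<rho>\<^sub>0, \<rho>\<^sub>1, \<rho>\<^sub>2, \<rho>\<^sub>3} \<subseteq> carrier G" using r by (auto simp: invol_def)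
  note nocentral = no_central_invol[OF gen sub]
  \<comment> \<open>Here \<open>r3\<close> links \<open>r0\<close> and \<open>r1\<close>: both
    commute with it, so they would commute with each other and \<open>r0\<close> would be
    central.\<close>
  have two: "(2::'f) \<noteq> 0"
  proof
    assume "(2::'f) = 0"
    then have "\<rho>\<^sub>0 \<otimes> \<rho>\<^sub>1 = \<rho>\<^sub>1 \<otimes> \<rho>\<^sub>0"
      using commuting_invol_trans_char_2[OF _ r(1,4,2) comm(2)] comm(3) by simp
    then show False using nocentral[OF r(1)] comm by auto
  qed
  \<comment> \<open>The same group is represented a second time, over the closure; the
    representation over the finite field is kept because only that one is onto.\<close>
  interpret S: split_rep G "\<lambda>g. map_mat2 to_ac (M g)"
  proof (intro split_rep.intro split_rep_axioms.intro)
    show "psl_rep G (\<lambda>g. map_mat2 to_ac (M g))" by (rule psl_rep_to_ac[OF psl_rep_axioms])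
    show "\<exists>y. y^2 = x" for x :: "'f alg_closure" by (rule nth_root_exists) simp
    show "(2 :: 'f alg_closure) \<noteq> 0" using two by (metis to_ac_0 to_ac_eq_iff to_ac_numeral)
  qed
  let ?H = "generate G {\<rho>\<^sub>0, \<rho>\<^sub>1, \<rho>\<^sub>2}"
  have H: "subgroup ?H G" using sub by (intro generate_is_subgroup) simp
  have "G\<lparr>carrier := ?H\<rparr> \<cong> sym_group 4 \<or> G\<lparr>carrier := ?H\<rparr> \<cong> alt_group 5 \<or> card (carrier G) \<le> 2 * card ?H"
  proof (rule S.three_generator_cases[OF r d comm gen])
    show False if "invol w" "\<And>r. r \<in> {\<rho>\<^sub>0, \<rho>\<^sub>1, \<rho>\<^sub>2, \<rho>\<^sub>3} \<Longrightarrow> w \<otimes> r = r \<otimes> w" for w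
      using that by (rule nocentral)
  qed
  moreover have "G\<lparr>carrier := ?H\<rparr> \<cong> G" if "card (carrier G) \<le> 2 * card ?H"
    using eq_of_card_le_double[OF two H that] by simp
  ultimately show ?thesis unfolding G\<^sub>3_def by blast
qed

end
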